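(* Consider the general stochastic block model with $r\ge1$ clusters of sizes $K_k=\rho_k n$ ($k\in[r]$) and $n-\sum_kK_k$ outlier vertices, with $a>b>0$ and $\rho_1\ge\dots\ge\rho_r>0$ fixed. Suppose there exist $\psi_1>0,\psi_2>0$ with $b+\psi_1+\psi_2<a$ such that $$I(a,b+\psi_1+\psi_2)>1/\rho_r,\quad I(b,b+\psi_1)>1/\rho_r,\quad I(b,b+\psi_2)>1/\rho_{r-1},\quad I(b,b+\psi_1+\psi_2)>1/\rho_r,$$ where the second and third conditions are dropped if $r=1$, and the fourth condition is dropped unless $r=1$ and there are outlier vertices. Let $\eta^*=C\sqrt{\log n}$ for a sufficiently large constant $C$ and $\lambda^*=(b+\psi_1+\psi_2)\frac{\log n}{n}$. Let $\widehat Z_{\mathrm{SDP}}$ be produced by either (i) $\max_Z\langle A,Z\rangle$ s.t. $Z\succeq0$, $Z_{ii}\le1$, $Z_{ij}\ge0$, $\langle\mathbf I,Z\rangle=K_1+\dots+K_r$, $\langle\mathbf J,Z\rangle=K_1^2+\dots+K_r^2$; or (ii) $\max_Z\langle A,Z\rangle-\eta^*\langle\mathbf I,Z\rangle-\lambda^*\langle\mathbf J,Z\rangle$ s.t. $Z\succeq0$, $Z_{ii}\le1$, $Z_{ij}\ge0$. Then $\min_{Z^*\in\mathcal Z_n}\mathbb P\{\widehat Z_{\mathrm{SDP}}=Z^*\}\ge1-n^{-\Omega(1)}$ (where $\widehat Z_{\mathrm{SDP}}=Z^*$ means $Z^*$ is the unique optimal solution).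
   Context: General SBM: out of $n$ vertices, disjoint clusters $C_1,\dots,C_r$ of sizes $K_1,\dots,K_r$ are planted and the remaining vertices are outliers (belonging to no cluster). Two vertices in the same cluster are connected with probability $p=a\log n/n$; every other pair is connected with probability $q=b\log n/n$, all independently. $A$ is the adjacency matrix. $\xi^*_k$ is the indicator vector of $C_k$, $Z^*=\sum_{k=1}^r\xi^*_k(\xi^*_k)^\top$, and $\mathcal Z_n$ is the set of all such cluster matrices (for the given sizes). $\mathbf I$ is the identity and $\mathbf J$ the all-ones matrix. For $\mu,d>0$, $I(\mu,d)=\mu-d\log\frac{e\mu}{d}$. *)

theory Defs
  imports "HOL-Probability.Probability"
begin

text \<open>Square n x n real matrices are represented as functions nat => nat => real,
  required to vanish outside the index range {0..<n} x {0..<n}.\<close>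

definition supported_n :: "nat \<Rightarrow> (nat \<Rightarrow> nat \<Rightarrow> real) \<Rightarrow> bool" where
  "supported_n n Z \<longleftrightarrow> (\<forall>i j. (n \<le> i \<or> n \<le> j) \<longrightarrow> Z i j = 0)"

definition inner_n :: "nat \<Rightarrow> (nat \<Rightarrow> nat \<Rightarrow> real) \<Rightarrow> (nat \<Rightarrow> nat \<Rightarrow> real) \<Rightarrow> real" where
  "inner_n n A Z = (\<Sum>i<n. \<Sum>j<n. A i j * Z i j)"

definition Id_n :: "nat \<Rightarrow> nat \<Rightarrow> nat \<Rightarrow> real" where
  "Id_n n = (\<lambda>i j. if i < n \<and> j < n \<and> i = j then 1 else 0)"

definition J_n :: "nat \<Rightarrow> nat \<Rightarrow> nat \<Rightarrow> real" where
  "J_n n = (\<lambda>i j. if i < n \<and> j < n then 1 else 0)"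

definition psd_n :: "nat \<Rightarrow> (nat \<Rightarrow> nat \<Rightarrow> real) \<Rightarrow> bool" where
  "psd_n n Z \<longleftrightarrow> (\<forall>i<n. \<forall>j<n. Z i j = Z j i) \<and>
     (\<forall>x :: nat \<Rightarrow> real. 0 \<le> (\<Sum>i<n. \<Sum>j<n. x i * Z i j * x j))"

definition sdp_base_feasible :: "nat \<Rightarrow> (nat \<Rightarrow> nat \<Rightarrow> real) \<Rightarrow> bool" where
  "sdp_base_feasible n Z \<longleftrightarrow> supported_n n Z \<and> psd_n n Z \<and>
     (\<forall>i<n. Z i i \<le> 1) \<and> (\<forall>i<n. \<forall>j<n. 0 \<le> Z i j)"

definition sdp1_feasible :: "nat \<Rightarrow> nat \<Rightarrow> (nat \<Rightarrow> nat) \<Rightarrow> (nat \<Rightarrow> nat \<Rightarrow> real) \<Rightarrow> bool" where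
  "sdp1_feasible n r K Z \<longleftrightarrow> sdp_base_feasible n Z \<and>
     inner_n n (Id_n n) Z = real (\<Sum>k\<in>{1..r}. K k) \<and>
     inner_n n (J_n n) Z = real (\<Sum>k\<in>{1..r}. (K k)^2)"

definition sdp2_objective :: "nat \<Rightarrow> real \<Rightarrow> real \<Rightarrow> (nat \<Rightarrow> nat \<Rightarrow> real) \<Rightarrow> (nat \<Rightarrow> nat \<Rightarrow> real) \<Rightarrow> real" where
  "sdp2_objective n eta lam A Z = inner_n n A Z - eta * inner_n n (Id_n n) Z - lam * inner_n n (J_n n) Z"

definition unique_maximizer :: "('a \<Rightarrow> bool) \<Rightarrow> ('a \<Rightarrow> real) \<Rightarrow> 'a \<Rightarrow> bool" where
  "unique_maximizer F f Z0 \<longleftrightarrow> F Z0 \<and> (\<forall>Z. F Z \<and> Z \<noteq> Z0 \<longrightarrow> f Z < f Z0)"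

definition valid_clusters :: "nat \<Rightarrow> nat \<Rightarrow> (nat \<Rightarrow> nat) \<Rightarrow> (nat \<Rightarrow> nat set) \<Rightarrow> bool" where
  "valid_clusters n r K C \<longleftrightarrow>
     (\<forall>k\<in>{1..r}. C k \<subseteq> {..<n} \<and> card (C k) = K k) \<and>
     (\<forall>k\<in>{1..r}. \<forall>l\<in>{1..r}. k \<noteq> l \<longrightarrow> C k \<inter> C l = {})"

definition cluster_matrix :: "nat \<Rightarrow> (nat \<Rightarrow> nat set) \<Rightarrow> nat \<Rightarrow> nat \<Rightarrow> real" where
  "cluster_matrix r C = (\<lambda>i j. \<Sum>k\<in>{1..r}. indicator (C k) i * indicator (C k) j)"

definition same_cluster :: "nat \<Rightarrow> (nat \<Rightarrow> nat set) \<Rightarrow> nat \<Rightarrow> nat \<Rightarrow> bool" where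
  "same_cluster r C i j \<longleftrightarrow> (\<exists>k\<in>{1..r}. i \<in> C k \<and> j \<in> C k)"

definition sbm_adj :: "nat \<Rightarrow> nat \<Rightarrow> (nat \<Rightarrow> nat set) \<Rightarrow> real \<Rightarrow> real \<Rightarrow> (nat \<Rightarrow> nat \<Rightarrow> real) pmf" where
  "sbm_adj n r C p q =
     map_pmf (\<lambda>e i j. if i < j then (if e (i, j) then 1 else 0)
                      else if j < i then (if e (j, i) then 1 else 0) else 0)
       (Pi_pmf {(i, j). i < j \<and> j < n} False
          (\<lambda>(i, j). bernoulli_pmf (if same_cluster r C i j then p else q)))"

definition rate_I :: "real \<Rightarrow> real \<Rightarrow> real" where
  "rate_I \<mu> d = \<mu> - d * ln (exp 1 * \<mu> / d)"

definition cluster_size :: "(nat \<Rightarrow> real) \<Rightarrow> nat \<Rightarrow> nat \<Rightarrow> nat" where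
  "cluster_size \<rho> n k = nat \<lfloor>\<rho> k * real n\<rfloor>"

end

theory Submission
  imports Defs "HOL-Real_Asymp.Real_Asymp"
begin

text \<open>
  Program (i) follows from program (ii), since its two extra constraints fix the penalty terms.
  For (ii) one exhibits a dual certificate \<open>S = D - B - A + \<eta>I + \<lambda>J\<close> that annihilates the cluster
  indicators. Writing \<open>e(i, C)\<close> for the number of edges from \<open>i\<close> to \<open>C\<close>, one takes
  \<open>d\<^sub>i = e(i, C\<^sub>k) - \<eta> - \<lambda>K\<^sub>k\<close> on cluster \<open>C\<^sub>k\<close>, and on the block \<open>C\<^sub>k \<times> C\<^sub>l\<close> the entries
  \<open>B\<^sub>i\<^sub>j = \<lambda> - e(i, C\<^sub>l)/K\<^sub>l - e(j, C\<^sub>k)/K\<^sub>k + e(C\<^sub>k, C\<^sub>l)/(K\<^sub>kK\<^sub>l)\<close>. The quadratic form of \<open>B\<close> vanishes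
  orthogonally to the cluster indicators, so there \<open>S\<close> is positive definite as soon as
  \<open>\<eta>\<close> exceeds the spectral norm of \<open>A - EA\<close>. The signs of \<open>d\<close> and \<open>B\<close> follow from Chernoff bounds
  for the degrees, whose exponents are the rates \<open>I\<close>; the density \<open>e(C\<^sub>k, C\<^sub>l)/(K\<^sub>kK\<^sub>l)\<close> is again
  controlled by the spectral norm.

  The bound \<open>\<parallel>A - EA\<parallel> = O(\<surd>log n)\<close> is proved by the trace method in the style of Bandeira and
  van Handel: grouping closed walks by the equality pattern of their vertices shows that
  \<open>E tr (A - EA)\<^sup>2\<^sup>k\<close> is at most \<open>n/r\<close> times \<open>E tr Y\<^sup>2\<^sup>k\<close>, where \<open>Y\<close> is a dense \<open>r \<times> r\<close>
  symmetric matrix of size \<open>r \<sim> np + k \<sim> log n\<close> with independent entries in \<open>{-1, 2}\<close>. The moments of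
  the norm of \<open>Y\<close> are bounded by a sum over an integer net.
\<close>

section \<open>Quadratic forms and the spectral norm\<close>

definition sym_mat :: "nat \<Rightarrow> (nat \<Rightarrow> nat \<Rightarrow> real) \<Rightarrow> bool" where
  "sym_mat n M \<longleftrightarrow> (\<forall>i<n. \<forall>j<n. M i j = M j i)"

definition bilin :: "nat \<Rightarrow> (nat \<Rightarrow> nat \<Rightarrow> real) \<Rightarrow> (nat \<Rightarrow> real) \<Rightarrow> (nat \<Rightarrow> real) \<Rightarrow> real" where
  "bilin n M x y = (\<Sum>i<n. \<Sum>j<n. x i * M i j * y j)"

definition mat_vec :: "nat \<Rightarrow> (nat \<Rightarrow> nat \<Rightarrow> real) \<Rightarrow> (nat \<Rightarrow> real) \<Rightarrow> nat \<Rightarrow> real" where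
  "mat_vec n M x = (\<lambda>i. \<Sum>j<n. M i j * x j)"

abbreviation l2norm :: "nat \<Rightarrow> (nat \<Rightarrow> real) \<Rightarrow> real" where
  "l2norm n x \<equiv> L2_set x {..<n}"

text \<open>This is the numerical radius, which is the spectral norm only for symmetric \<open>M\<close>.\<close>

definition spectral_norm :: "nat \<Rightarrow> (nat \<Rightarrow> nat \<Rightarrow> real) \<Rightarrow> real" where
  "spectral_norm n M = (SUP x\<in>{x. l2norm n x \<le> 1}. \<bar>bilin n M x x\<bar>)"

lemma sym_matD: "sym_mat n M \<Longrightarrow> i < n \<Longrightarrow> j < n \<Longrightarrow> M i j = M j i"
  by (simp add: sym_mat_def)

lemma L2_set_power2: "(L2_set f A)\<^sup>2 = (\<Sum>i\<in>A. (f i)\<^sup>2)"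
  by (simp add: L2_set_def sum_nonneg)

lemma L2_set_scale: "L2_set (\<lambda>i. c * f i) A = \<bar>c\<bar> * L2_set f A"
  by (simp add: L2_set_def power_mult_distrib sum_distrib_left[symmetric] real_sqrt_mult)

lemma abs_sum_mult_le_L2_set: "\<bar>\<Sum>i\<in>A. f i * g i\<bar> \<le> L2_set f A * L2_set g A"
proof -
  have "\<bar>\<Sum>i\<in>A. f i * g i\<bar> \<le> (\<Sum>i\<in>A. \<bar>f i\<bar> * \<bar>g i\<bar>)"
    unfolding abs_mult[symmetric] by (rule sum_abs)
  also have "\<dots> \<le> L2_set f A * L2_set g A" by (rule L2_set_mult_ineq)
  finally show ?thesis .
qed

lemma L2_set_parallelogram:
  "(L2_set (\<lambda>i. f i + g i) A)\<^sup>2 + (L2_set (\<lambda>i. f i - g i) A)\<^sup>2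
      = 2 * ((L2_set f A)\<^sup>2 + (L2_set g A)\<^sup>2)"
  unfolding L2_set_power2 sum.distrib[symmetric] sum_distrib_left
  by (intro sum.cong refl) (simp add: power2_eq_square algebra_simps)

lemma bilin_eq_sum_mat_vec: "bilin n M x y = (\<Sum>i<n. x i * mat_vec n M y i)"
  by (simp add: bilin_def mat_vec_def sum_distrib_left mult.assoc)

lemma bilin_add_left: "bilin n M (\<lambda>i. x i + x' i) y = bilin n M x y + bilin n M x' y"
  by (simp add: bilin_def algebra_simps sum.distrib)

lemma bilin_add_right: "bilin n M x (\<lambda>i. y i + y' i) = bilin n M x y + bilin n M x y'"
  by (simp add: bilin_def algebra_simps sum.distrib)

lemma bilin_diff_left: "bilin n M (\<lambda>i. x i - x' i) y = bilin n M x y - bilin n M x' y"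
  by (simp add: bilin_def algebra_simps sum_subtractf)

lemma bilin_diff_right: "bilin n M x (\<lambda>i. y i - y' i) = bilin n M x y - bilin n M x y'"
  by (simp add: bilin_def algebra_simps sum_subtractf)

lemma bilin_scale: "bilin n M (\<lambda>i. c * x i) (\<lambda>i. d * y i) = c * d * bilin n M x y"
  by (simp add: bilin_def sum_distrib_left mult_ac)

lemma bilin_commute:
  assumes "sym_mat n M"
  shows "bilin n M x y = bilin n M y x"
  unfolding bilin_def
  by (subst sum.swap, intro sum.cong refl, subst sym_matD[OF assms]) (auto simp: mult_ac)

lemma bilin_eq_0_of_l2norm_eq_0:
  assumes "l2norm n x = 0 \<or> l2norm n y = 0"
  shows "bilin n M x y = 0"
  using assms by (auto simp: bilin_def L2_set_eq_0_iff)

lemma bdd_above_abs_quadratic_form: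
  "bdd_above ((\<lambda>x. \<bar>bilin n M x x\<bar>) ` {x. l2norm n x \<le> 1})"
proof (rule bdd_aboveI2)
  fix x assume "x \<in> {x. l2norm n x \<le> 1}"
  then have x: "\<bar>x i\<bar> \<le> 1" if "i < n" for i
    using member_le_L2_set[of "{..<n}" i x] member_le_L2_set[of "{..<n}" i "\<lambda>i. - x i"] that
    by (simp add: L2_set_def del: real_sqrt_le_1_iff)
  have "\<bar>bilin n M x x\<bar> \<le> (\<Sum>i<n. \<Sum>j<n. \<bar>x i * M i j * x j\<bar>)"
    unfolding bilin_def by (rule order_trans[OF sum_abs sum_mono]) (rule sum_abs)
  also have "\<dots> \<le> (\<Sum>i<n. \<Sum>j<n. 1 * \<bar>M i j\<bar> * 1)"
    unfolding abs_mult using x by (intro sum_mono mult_mono) auto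
  finally show "\<bar>bilin n M x x\<bar> \<le> (\<Sum>i<n. \<Sum>j<n. 1 * \<bar>M i j\<bar> * 1)" .
qed

lemma abs_quadratic_form_le_spectral_norm_unit:
  "l2norm n x \<le> 1 \<Longrightarrow> \<bar>bilin n M x x\<bar> \<le> spectral_norm n M"
  unfolding spectral_norm_def by (rule cSUP_upper[OF _ bdd_above_abs_quadratic_form]) simp

lemma spectral_norm_nonneg [simp]: "0 \<le> spectral_norm n M"
  using abs_quadratic_form_le_spectral_norm_unit[where x = "\<lambda>_. 0" and n = n and M = M]
  by (simp add: L2_set_def bilin_def)

lemma spectral_norm_leI:
  assumes "\<And>x. l2norm n x \<le> 1 \<Longrightarrow> \<bar>bilin n M x x\<bar> \<le> t"
  shows "spectral_norm n M \<le> t"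
  unfolding spectral_norm_def
proof (rule cSUP_least)
  have "(\<lambda>_. 0) \<in> {x. l2norm n x \<le> 1}" by (simp add: L2_set_def)
  then show "{x. l2norm n x \<le> 1} \<noteq> {}" by blast
qed (use assms in auto)

lemma abs_quadratic_form_le:
  "\<bar>bilin n M x x\<bar> \<le> spectral_norm n M * (l2norm n x)\<^sup>2"
proof (cases "l2norm n x = 0")
  case True
  then show ?thesis by (simp add: bilin_eq_0_of_l2norm_eq_0)
next
  case False
  then have pos: "0 < l2norm n x" by (simp add: less_le)
  define c where "c = 1 / l2norm n x"
  have "l2norm n (\<lambda>i. c * x i) \<le> 1" unfolding L2_set_scale using pos by (simp add: c_def)
  then have "\<bar>bilin n M (\<lambda>i. c * x i) (\<lambda>i. c * x i)\<bar> \<le> spectral_norm n M"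
    by (rule abs_quadratic_form_le_spectral_norm_unit)
  then have "c * c * \<bar>bilin n M x x\<bar> \<le> spectral_norm n M"
    by (simp add: bilin_scale abs_mult)
  then show ?thesis
    using pos by (simp add: c_def field_simps power2_eq_square)
qed

lemma bilin_polarization:
  assumes "sym_mat n M"
  shows "4 * bilin n M x y =
    bilin n M (\<lambda>i. x i + y i) (\<lambda>i. x i + y i) - bilin n M (\<lambda>i. x i - y i) (\<lambda>i. x i - y i)"
  using bilin_commute[OF assms, of y x]
  by (simp add: bilin_add_left bilin_add_right bilin_diff_left bilin_diff_right)

lemma abs_bilin_le_add_power2:
  assumes "sym_mat n M"
  shows "2 * \<bar>bilin n M x y\<bar> \<le> spectral_norm n M * ((l2norm n x)\<^sup>2 + (l2norm n y)\<^sup>2)"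
proof -
  have "4 * \<bar>bilin n M x y\<bar>
      \<le> spectral_norm n M * ((l2norm n (\<lambda>i. x i + y i))\<^sup>2 + (l2norm n (\<lambda>i. x i - y i))\<^sup>2)"
    using bilin_polarization[OF assms, of x y]
      abs_quadratic_form_le[of n M "\<lambda>i. x i + y i"] abs_quadratic_form_le[of n M "\<lambda>i. x i - y i"]
    by (simp add: distrib_left)
  also have "\<dots> = 2 * (spectral_norm n M * ((l2norm n x)\<^sup>2 + (l2norm n y)\<^sup>2))"
    unfolding L2_set_parallelogram by simp
  finally show ?thesis by simp
qed

lemma abs_bilin_le:
  assumes "sym_mat n M"
  shows "\<bar>bilin n M x y\<bar> \<le> spectral_norm n M * l2norm n x * l2norm n y"
proof (cases "l2norm n x = 0 \<or> l2norm n y = 0")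
  case True
  then show ?thesis by (simp add: bilin_eq_0_of_l2norm_eq_0)
next
  case False
  define c d where "c = l2norm n x" and "d = l2norm n y"
  have cd: "0 < c" "0 < d" using False by (auto simp: c_def d_def less_le)
  \<comment> \<open>rescaled to a common length, so that the arithmetic mean becomes the product of the lengths\<close>
  have "2 * \<bar>bilin n M (\<lambda>i. d * x i) (\<lambda>i. c * y i)\<bar> \<le> spectral_norm n M * ((d * c)\<^sup>2 + (c * d)\<^sup>2)"
    using abs_bilin_le_add_power2[OF assms, of "\<lambda>i. d * x i" "\<lambda>i. c * y i"]
    by (simp add: L2_set_scale c_def d_def)
  then have "(c * d) * \<bar>bilin n M x y\<bar> \<le> (c * d) * (spectral_norm n M * c * d)"
    using cd by (simp add: bilin_scale abs_mult power2_eq_square mult_ac)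
  then show ?thesis using cd by (simp add: c_def d_def)
qed

lemma l2norm_mat_vec_le:
  assumes "sym_mat n M"
  shows "l2norm n (mat_vec n M x) \<le> spectral_norm n M * l2norm n x"
proof (cases "l2norm n (mat_vec n M x) = 0")
  case False
  let ?y = "mat_vec n M x"
  have "l2norm n ?y * l2norm n ?y = bilin n M ?y x"
    by (simp add: bilin_eq_sum_mat_vec flip: power2_eq_square L2_set_power2)
  also have "\<dots> \<le> l2norm n ?y * (spectral_norm n M * l2norm n x)"
    using abs_bilin_le[OF assms, of ?y x] by (simp add: mult_ac)
  finally show ?thesis using False by (simp add: less_le)
qed simp

section \<open>Trace powers and closed walks\<close>

definition trace_power :: "nat \<Rightarrow> (nat \<Rightarrow> nat \<Rightarrow> real) \<Rightarrow> nat \<Rightarrow> real" where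
  "trace_power n M m = (\<Sum>i<n. (mat_vec n M ^^ m) (indicator {i}) i)"

lemma sum_mult_indicator_singleton:
  fixes f :: "nat \<Rightarrow> real"
  shows "i < n \<Longrightarrow> (\<Sum>j<n. f j * indicator {i} j) = f i"
  by (simp add: indicator_def if_distrib[of "\<lambda>c. _ * c"] cong: if_cong)

lemma sum_indicator_singleton_mult:
  fixes f :: "nat \<Rightarrow> real"
  shows "i < n \<Longrightarrow> (\<Sum>j<n. indicator {i} j * f j) = f i"
  using sum_mult_indicator_singleton[of i n f] by (simp only: mult.commute)

lemma l2norm_indicator_singleton: "i < n \<Longrightarrow> l2norm n (indicator {i}) = 1"
  unfolding L2_set_def
  using sum_mult_indicator_singleton[of i n "indicator {i}"] by (simp add: power2_eq_square)

lemma mat_vec_funpow_adjoint: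
  assumes "sym_mat n M"
  shows "(\<Sum>i<n. x i * (mat_vec n M ^^ m) y i) = (\<Sum>i<n. (mat_vec n M ^^ m) x i * y i)"
proof (induction m arbitrary: x)
  case (Suc m)
  let ?T = "mat_vec n M"
  have "(\<Sum>i<n. x i * (?T ^^ Suc m) y i) = bilin n M x ((?T ^^ m) y)"
    by (simp add: bilin_eq_sum_mat_vec)
  also have "\<dots> = (\<Sum>i<n. ?T x i * (?T ^^ m) y i)"
    by (subst bilin_commute[OF assms]) (simp add: bilin_eq_sum_mat_vec mult.commute)
  also have "\<dots> = (\<Sum>i<n. (?T ^^ m) (?T x) i * y i)" by (rule Suc.IH)
  finally show ?case by (simp add: funpow_swap1)
qed simp

lemma sum_mult_mat_vec_funpow_double:
  assumes "sym_mat n M"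
  shows "(\<Sum>i<n. x i * (mat_vec n M ^^ (2 * h)) x i) = (l2norm n ((mat_vec n M ^^ h) x))\<^sup>2"
proof -
  have "(\<Sum>i<n. x i * (mat_vec n M ^^ (2 * h)) x i) =
      (\<Sum>i<n. x i * (mat_vec n M ^^ h) ((mat_vec n M ^^ h) x) i)"
    by (simp add: mult_2 funpow_add)
  also have "\<dots> = (\<Sum>i<n. (mat_vec n M ^^ h) x i * (mat_vec n M ^^ h) x i)"
    by (rule mat_vec_funpow_adjoint[OF assms])
  also have "\<dots> = (l2norm n ((mat_vec n M ^^ h) x))\<^sup>2"
    unfolding L2_set_power2 by (simp add: power2_eq_square)
  finally show ?thesis .
qed

lemma trace_power_double:
  assumes "sym_mat n M"
  shows "trace_power n M (2 * h) = (\<Sum>i<n. (l2norm n ((mat_vec n M ^^ h) (indicator {i})))\<^sup>2)"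
  unfolding trace_power_def sum_mult_mat_vec_funpow_double[OF assms, symmetric]
  by (intro sum.cong refl) (simp only: lessThan_iff sum_indicator_singleton_mult)

lemma mat_vec_funpow_eq_sum_indicator:
  assumes "l < n"
  shows "(mat_vec n M ^^ h) x l = (\<Sum>j<n. (mat_vec n M ^^ h) (indicator {j}) l * x j)"
  using assms
proof (induction h arbitrary: l)
  case 0
  then show ?case
    by (simp add: indicator_def if_distrib[of "\<lambda>c. c * _"] cong: if_cong)
next
  case (Suc h)
  have step: "(mat_vec n M ^^ Suc h) y l = (\<Sum>k<n. M l k * (mat_vec n M ^^ h) y k)" for y
    by (simp add: mat_vec_def)
  have "(\<Sum>k<n. M l k * (mat_vec n M ^^ h) x k) =
      (\<Sum>k<n. \<Sum>j<n. M l k * (mat_vec n M ^^ h) (indicator {j}) k * x j)"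
    by (intro sum.cong refl, subst Suc.IH) (simp_all add: sum_distrib_left mult.assoc)
  also have "\<dots> = (\<Sum>j<n. (\<Sum>k<n. M l k * (mat_vec n M ^^ h) (indicator {j}) k) * x j)"
    by (subst sum.swap) (simp add: sum_distrib_right)
  finally show ?case unfolding step .
qed

lemma l2norm_mat_vec_funpow_le_trace_power:
  assumes "sym_mat n M"
  shows "(l2norm n ((mat_vec n M ^^ h) x))\<^sup>2 \<le> trace_power n M (2 * h) * (l2norm n x)\<^sup>2"
proof -
  let ?T = "mat_vec n M ^^ h"
  have "(l2norm n (?T x))\<^sup>2 = (\<Sum>l<n. (\<Sum>j<n. ?T (indicator {j}) l * x j)\<^sup>2)"
    unfolding L2_set_power2
    by (intro sum.cong refl arg_cong[where f = "\<lambda>z. z\<^sup>2"] mat_vec_funpow_eq_sum_indicator) simp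
  also have "\<dots> \<le> (\<Sum>l<n. (\<Sum>j<n. (?T (indicator {j}) l)\<^sup>2) * (\<Sum>j<n. (x j)\<^sup>2))"
    by (intro sum_mono Cauchy_Schwarz_ineq_sum)
  also have "\<dots> = (\<Sum>j<n. \<Sum>l<n. (?T (indicator {j}) l)\<^sup>2) * (l2norm n x)\<^sup>2"
    unfolding sum_distrib_right[symmetric] L2_set_power2 by (subst sum.swap) simp
  finally show ?thesis by (simp add: trace_power_double[OF assms] L2_set_power2)
qed

lemma abs_quadratic_form_power_le:
  assumes sym: "sym_mat n M" and x: "l2norm n x \<le> 1"
  shows "\<bar>bilin n M x x\<bar> ^ (2 ^ s) \<le> \<bar>\<Sum>i<n. x i * (mat_vec n M ^^ (2 ^ s)) x i\<bar>"
proof (induction s)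
  case 0
  show ?case by (simp add: bilin_eq_sum_mat_vec)
next
  case (Suc s)
  let ?h = "2 ^ s :: nat"
  let ?y = "(mat_vec n M ^^ ?h) x"
  have "\<bar>bilin n M x x\<bar> ^ (2 ^ Suc s) = (\<bar>bilin n M x x\<bar> ^ ?h)\<^sup>2"
    by (simp flip: power_mult add: mult.commute)
  also have "\<dots> \<le> \<bar>\<Sum>i<n. x i * ?y i\<bar>\<^sup>2"
    by (intro power_mono Suc.IH) simp
  also have "\<dots> \<le> (l2norm n x * l2norm n ?y)\<^sup>2"
    by (intro power_mono abs_sum_mult_le_L2_set) simp
  also have "\<dots> \<le> (l2norm n ?y)\<^sup>2"
    using x by (intro power_mono mult_left_le_one_le) auto
  also have "\<dots> = (\<Sum>i<n. x i * (mat_vec n M ^^ (2 * ?h)) x i)"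
    by (rule sum_mult_mat_vec_funpow_double[OF sym, symmetric])
  finally show ?case by simp
qed

lemma spectral_norm_le_of_trace_power_le:
  assumes sym: "sym_mat n M" and "0 \<le> t" and tr: "trace_power n M (2 ^ Suc s) \<le> t ^ (2 ^ Suc s)"
  shows "spectral_norm n M \<le> t"
proof (rule spectral_norm_leI)
  fix x assume x: "l2norm n x \<le> 1"
  let ?h = "2 ^ s :: nat"
  have "\<bar>bilin n M x x\<bar> ^ (2 ^ Suc s) \<le> \<bar>\<Sum>i<n. x i * (mat_vec n M ^^ (2 * ?h)) x i\<bar>"
    using abs_quadratic_form_power_le[OF sym x, of "Suc s"] by simp
  also have "\<dots> = (l2norm n ((mat_vec n M ^^ ?h) x))\<^sup>2"
    by (simp add: sum_mult_mat_vec_funpow_double[OF sym])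
  also have "\<dots> \<le> trace_power n M (2 * ?h) * (l2norm n x)\<^sup>2"
    by (rule l2norm_mat_vec_funpow_le_trace_power[OF sym])
  also have "\<dots> \<le> trace_power n M (2 * ?h)"
    using x by (intro mult_right_le_one_le)
      (auto simp: trace_power_double[OF sym] sum_nonneg power_le_one)
  also have "\<dots> \<le> t ^ (2 ^ Suc s)" using tr by simp
  finally show "\<bar>bilin n M x x\<bar> \<le> t"
    using \<open>0 \<le> t\<close> by (subst (asm) power_mono_iff) auto
qed

lemma trace_power_le_spectral_norm:
  assumes sym: "sym_mat n M"
  shows "trace_power n M (2 * h) \<le> n * spectral_norm n M ^ (2 * h)"
proof -
  have "l2norm n ((mat_vec n M ^^ h) x) \<le> spectral_norm n M ^ h * l2norm n x" for x
  proof (induction h)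
    case (Suc h)
    have "l2norm n ((mat_vec n M ^^ Suc h) x) \<le> spectral_norm n M * l2norm n ((mat_vec n M ^^ h) x)"
      using l2norm_mat_vec_le[OF sym] by simp
    also have "\<dots> \<le> spectral_norm n M * (spectral_norm n M ^ h * l2norm n x)"
      by (intro mult_left_mono Suc.IH) simp
    finally show ?case by simp
  qed simp
  then have "(l2norm n ((mat_vec n M ^^ h) (indicator {i})))\<^sup>2 \<le> (spectral_norm n M ^ h)\<^sup>2"
    if "i < n" for i
    using that by (metis L2_set_nonneg l2norm_indicator_singleton mult.right_neutral power_mono)
  then have "trace_power n M (2 * h) \<le> (\<Sum>i<n. (spectral_norm n M ^ h)\<^sup>2)"
    unfolding trace_power_double[OF sym] by (intro sum_mono) auto
  then show ?thesis by (simp flip: power_mult add: mult.commute)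
qed

definition walks :: "nat \<Rightarrow> nat \<Rightarrow> (nat \<Rightarrow> nat) set" where
  "walks n m = {..m} \<rightarrow>\<^sub>E {..<n}"

definition walk_prod :: "(nat \<Rightarrow> nat \<Rightarrow> real) \<Rightarrow> nat \<Rightarrow> (nat \<Rightarrow> nat) \<Rightarrow> real" where
  "walk_prod M m w = (\<Prod>t<m. M (w t) (w (Suc t)))"

lemma finite_walks [simp]: "finite (walks n m)"
  by (simp add: walks_def finite_PiE)

lemma bij_betw_walks_Suc:
  "bij_betw (\<lambda>(w, j). w(Suc m := j))
    ({w \<in> walks n m. w 0 = i} \<times> {..<n}) {w \<in> walks n (Suc m). w 0 = i}"
proof (rule bij_betw_byWitness[where f' = "\<lambda>w. (restrict w {..m}, w (Suc m))"])
  show "\<forall>p\<in>{w \<in> walks n m. w 0 = i} \<times> {..<n}.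
      (restrict ((\<lambda>(w, j). w(Suc m := j)) p) {..m}, ((\<lambda>(w, j). w(Suc m := j)) p) (Suc m)) = p"
    by (auto simp: fun_eq_iff restrict_def walks_def PiE_iff extensional_def)
  show "\<forall>w\<in>{w \<in> walks n (Suc m). w 0 = i}. (\<lambda>(w, j). w(Suc m := j)) (restrict w {..m}, w (Suc m)) = w"
    by (auto simp: fun_eq_iff restrict_def walks_def PiE_iff extensional_def le_Suc_eq)
qed (auto simp: walks_def PiE_iff extensional_def le_Suc_eq)

lemma walk_prod_Suc_upd:
  "walk_prod M (Suc m) (w(Suc m := j)) = walk_prod M m w * M (w m) j"
  by (simp add: walk_prod_def)

lemma mat_vec_funpow_eq_sum_walks:
  assumes "i < n"
  shows "(mat_vec n M ^^ m) x i = (\<Sum>w | w \<in> walks n m \<and> w 0 = i. walk_prod M m w * x (w m))"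
proof (induction m arbitrary: x)
  case 0
  have "{w. w \<in> walks n 0 \<and> w 0 = i} = {(\<lambda>t. if t = 0 then i else undefined)}"
    using assms by (auto simp: walks_def PiE_iff extensional_def fun_eq_iff)
  then show ?case by (simp add: walk_prod_def)
next
  case (Suc m)
  let ?P = "\<lambda>m. {w. w \<in> walks n m \<and> w 0 = i}"
  have "(mat_vec n M ^^ Suc m) x i = (\<Sum>w\<in>?P m. walk_prod M m w * mat_vec n M x (w m))"
    by (simp add: Suc.IH funpow_swap1)
  also have "\<dots> = (\<Sum>(w, j)\<in>?P m \<times> {..<n}. walk_prod M m w * M (w m) j * x j)"
    by (subst sum.cartesian_product[symmetric]) (simp add: mat_vec_def sum_distrib_left mult.assoc)
  also have "\<dots> = (\<Sum>(w, j)\<in>?P m \<times> {..<n}.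
      walk_prod M (Suc m) (w(Suc m := j)) * x ((w(Suc m := j)) (Suc m)))"
    by (simp add: walk_prod_Suc_upd)
  also have "\<dots> = (\<Sum>w\<in>?P (Suc m). walk_prod M (Suc m) w * x (w (Suc m)))"
    using sum.reindex_bij_betw[OF bij_betw_walks_Suc[of m n i],
        of "\<lambda>w. walk_prod M (Suc m) w * x (w (Suc m))"]
    by (simp add: case_prod_unfold)
  finally show ?case .
qed

lemma trace_power_eq_sum_closed_walks:
  "trace_power n M m = (\<Sum>w | w \<in> walks n m \<and> w 0 = w m. walk_prod M m w)"
proof -
  let ?W = "{w. w \<in> walks n m \<and> w 0 = w m}"
  have "(mat_vec n M ^^ m) (indicator {i}) i = (\<Sum>w | w \<in> ?W \<and> w 0 = i. walk_prod M m w)"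
    if "i < n" for i
    unfolding mat_vec_funpow_eq_sum_walks[OF that]
    by (rule sum.mono_neutral_cong_right) (auto simp: indicator_def)
  then have "trace_power n M m = (\<Sum>i<n. \<Sum>w | w \<in> ?W \<and> w 0 = i. walk_prod M m w)"
    by (simp add: trace_power_def)
  also have "\<dots> = (\<Sum>w\<in>?W. walk_prod M m w)"
    by (rule sum.group) (simp, simp, auto simp: walks_def PiE_iff)
  finally show ?thesis .
qed

section \<open>Random symmetric matrices\<close>

definition pairs :: "nat \<Rightarrow> (nat \<times> nat) set" where
  "pairs n = {(i, j). i < j \<and> j < n}"

definition edge_pmf :: "nat \<Rightarrow> (nat \<times> nat \<Rightarrow> real) \<Rightarrow> (nat \<times> nat \<Rightarrow> bool) pmf" where
  "edge_pmf n P = Pi_pmf (pairs n) False (\<lambda>e. bernoulli_pmf (P e))"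

abbreviation edge_expectation ::
    "nat \<Rightarrow> (nat \<times> nat \<Rightarrow> real) \<Rightarrow> ((nat \<times> nat \<Rightarrow> bool) \<Rightarrow> real) \<Rightarrow> real" where
  "edge_expectation n P \<equiv> measure_pmf.expectation (edge_pmf n P)"

abbreviation edge_prob ::
    "nat \<Rightarrow> (nat \<times> nat \<Rightarrow> real) \<Rightarrow> (nat \<times> nat \<Rightarrow> bool) set \<Rightarrow> real" where
  "edge_prob n P \<equiv> measure_pmf.prob (edge_pmf n P)"

definition symmat :: "(nat \<times> nat \<Rightarrow> real) \<Rightarrow> nat \<Rightarrow> nat \<Rightarrow> real" where
  "symmat x i j = (if i < j then x (i, j) else if j < i then x (j, i) else 0)"

definition entry_moment ::
    "(nat \<times> nat \<Rightarrow> real) \<Rightarrow> (nat \<times> nat \<Rightarrow> bool \<Rightarrow> real) \<Rightarrow> nat \<times> nat \<Rightarrow> nat \<Rightarrow> real" where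
  "entry_moment P f e k = measure_pmf.expectation (bernoulli_pmf (P e)) (\<lambda>v. f e v ^ k)"

lemma finite_pairs [simp]: "finite (pairs n)"
  by (rule finite_subset[of _ "{..<n} \<times> {..<n}"]) (auto simp: pairs_def)

lemma sym_mat_symmat [simp]: "sym_mat n (symmat x)"
  by (auto simp: sym_mat_def symmat_def)

lemma finite_set_edge_pmf: "finite (set_pmf (edge_pmf n P))"
  unfolding edge_pmf_def
  by (rule finite_subset[OF set_Pi_pmf_subset']) auto

lemma integrable_edge_pmf [simp]: "integrable (measure_pmf (edge_pmf n P)) (g :: _ \<Rightarrow> real)"
  by (intro integrable_measure_pmf_finite finite_set_edge_pmf)

lemma expectation_edge_pmf_component:
  fixes g :: "bool \<Rightarrow> real"
  assumes "e \<in> pairs n"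
  shows "edge_expectation n P (\<lambda>\<omega>. g (\<omega> e)) = measure_pmf.expectation (bernoulli_pmf (P e)) g"
proof -
  have "map_pmf (\<lambda>\<omega>. \<omega> e) (edge_pmf n P) = bernoulli_pmf (P e)"
    using assms unfolding edge_pmf_def by (subst Pi_pmf_component) auto
  then have "measure_pmf.expectation (bernoulli_pmf (P e)) g =
      measure_pmf.expectation (map_pmf (\<lambda>\<omega>. \<omega> e) (edge_pmf n P)) g" by simp
  then show ?thesis by simp
qed

lemma expectation_prod_edge_pmf:
  fixes g :: "nat \<times> nat \<Rightarrow> bool \<Rightarrow> real"
  shows "edge_expectation n P (\<lambda>\<omega>. \<Prod>e\<in>pairs n. g e (\<omega> e)) =
    (\<Prod>e\<in>pairs n. measure_pmf.expectation (bernoulli_pmf (P e)) (g e))"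
proof (cases "pairs n = {}")
  case False
  have "prob_space.indep_vars (measure_pmf (edge_pmf n P)) (\<lambda>_. count_space UNIV)
      (\<lambda>e \<omega>. \<omega> e) (pairs n)"
    unfolding edge_pmf_def by (rule indep_vars_Pi_pmf) simp
  then have "prob_space.indep_vars (measure_pmf (edge_pmf n P)) (\<lambda>_. borel)
      (\<lambda>e \<omega>. g e (\<omega> e)) (pairs n)"
    by (rule prob_space.indep_vars_compose2[OF measure_pmf.prob_space_axioms]) auto
  then have "edge_expectation n P (\<lambda>\<omega>. \<Prod>e\<in>pairs n. g e (\<omega> e)) =
      (\<Prod>e\<in>pairs n. edge_expectation n P (\<lambda>\<omega>. g e (\<omega> e)))"
    by (intro prob_space.indep_vars_lebesgue_integral[OF measure_pmf.prob_space_axioms]) auto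
  then show ?thesis
    by (simp add: expectation_edge_pmf_component cong: prod.cong)
qed simp

section \<open>Comparison of trace moments\<close>

definition walk_edge :: "(nat \<Rightarrow> nat) \<Rightarrow> nat \<Rightarrow> nat \<times> nat" where
  "walk_edge w t = (min (w t) (w (Suc t)), max (w t) (w (Suc t)))"

definition walk_edge_count :: "nat \<Rightarrow> (nat \<Rightarrow> nat) \<Rightarrow> nat \<times> nat \<Rightarrow> nat" where
  "walk_edge_count m w e = card {t \<in> {..<m}. walk_edge w t = e}"

definition loopless :: "nat \<Rightarrow> (nat \<Rightarrow> nat) \<Rightarrow> bool" where
  "loopless m w \<longleftrightarrow> (\<forall>t<m. w t \<noteq> w (Suc t))"

text \<open>Only these walks contribute to a trace moment of a matrix with centred entries.\<close>

definition doubled_walk :: "nat \<Rightarrow> (nat \<Rightarrow> nat) \<Rightarrow> bool" where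
  "doubled_walk m w \<longleftrightarrow> w 0 = w m \<and> loopless m w \<and> (\<forall>t<m. 2 \<le> walk_edge_count m w (walk_edge w t))"

lemma walk_edge_count_eq_0_iff: "walk_edge_count m w e = 0 \<longleftrightarrow> e \<notin> walk_edge w ` {..<m}"
  by (auto simp: walk_edge_count_def)

lemma walk_edge_in_pairs:
  assumes "w \<in> walks n m" "loopless m w" "t < m"
  shows "walk_edge w t \<in> pairs n"
proof -
  have "w t < n" "w (Suc t) < n" "w t \<noteq> w (Suc t)"
    using assms by (auto simp: walks_def PiE_iff loopless_def Suc_le_eq)
  then show ?thesis by (auto simp: walk_edge_def pairs_def min_def max_def)
qed

lemma walk_prod_symmat:
  assumes w: "w \<in> walks n m" "loopless m w"
  shows "walk_prod (symmat x) m w = (\<Prod>e\<in>pairs n. x e ^ walk_edge_count m w e)"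
proof -
  have "walk_prod (symmat x) m w = (\<Prod>t<m. x (walk_edge w t))"
    unfolding walk_prod_def
    by (intro prod.cong refl)
       (use w in \<open>auto simp: loopless_def symmat_def walk_edge_def min_def max_def\<close>)
  also have "\<dots> = (\<Prod>e\<in>pairs n. \<Prod>t | t \<in> {..<m} \<and> walk_edge w t = e. x (walk_edge w t))"
    by (rule prod.group[symmetric]) (use walk_edge_in_pairs[OF w] in auto)
  also have "\<dots> = (\<Prod>e\<in>pairs n. x e ^ walk_edge_count m w e)"
    by (intro prod.cong refl) (simp add: walk_edge_count_def)
  finally show ?thesis .
qed

lemma walk_prod_symmat_eq_0_of_loop:
  assumes "\<not> loopless m w"
  shows "walk_prod (symmat x) m w = 0"
proof -
  from assms obtain t where "t < m" "w t = w (Suc t)" by (auto simp: loopless_def)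
  then show ?thesis
    unfolding walk_prod_def by (intro prod_zero bexI[of _ t]) (auto simp: symmat_def)
qed

lemma expectation_walk_prod:
  assumes "w \<in> walks n m" "loopless m w"
  shows "edge_expectation n P (\<lambda>\<omega>. walk_prod (symmat (\<lambda>e. f e (\<omega> e))) m w) =
    (\<Prod>e\<in>pairs n. entry_moment P f e (walk_edge_count m w e))"
  unfolding walk_prod_symmat[OF assms] entry_moment_def
  by (rule expectation_prod_edge_pmf[where g = "\<lambda>e v. f e v ^ walk_edge_count m w e"])

lemma expectation_walk_prod_eq_0:
  assumes w: "w \<in> walks n m" "w 0 = w m" "\<not> doubled_walk m w"
    and mean: "\<And>e. e \<in> pairs n \<Longrightarrow> entry_moment P f e 1 = 0"
  shows "edge_expectation n P (\<lambda>\<omega>. walk_prod (symmat (\<lambda>e. f e (\<omega> e))) m w) = 0"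
proof (cases "loopless m w")
  case True
  then obtain t where t: "t < m" "\<not> 2 \<le> walk_edge_count m w (walk_edge w t)"
    using w by (auto simp: doubled_walk_def)
  then have "walk_edge_count m w (walk_edge w t) \<noteq> 0"
    unfolding walk_edge_count_eq_0_iff by simp
  with t have once: "walk_edge_count m w (walk_edge w t) = 1" by simp
  have e: "walk_edge w t \<in> pairs n" by (rule walk_edge_in_pairs[OF w(1) True t(1)])
  show ?thesis
    unfolding expectation_walk_prod[OF w(1) True]
    by (rule prod_zero) (use e once mean[OF e] in \<open>auto intro!: bexI[of _ "walk_edge w t"]\<close>)
qed (simp add: walk_prod_symmat_eq_0_of_loop)

lemma doubled_walk_count_ge_2:
  assumes "doubled_walk m w" "e \<in> walk_edge w ` {..<m}"
  shows "2 \<le> walk_edge_count m w e"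
  using assms by (auto simp: doubled_walk_def)

lemma card_walk_vertices_le: "card (w ` {..m}) \<le> card (walk_edge w ` {..<m}) + 1"
proof (induction m)
  case (Suc m)
  show ?case
  proof (cases "w (Suc m) \<in> w ` {..m}")
    case True
    then have "w ` {..Suc m} = w ` {..m}" by (auto simp: atMost_Suc)
    moreover have "card (walk_edge w ` {..<m}) \<le> card (walk_edge w ` {..<Suc m})"
      by (intro card_mono image_mono) auto
    ultimately show ?thesis using Suc by simp
  next
    case False
    have "walk_edge w m \<notin> walk_edge w ` {..<m}"
    proof
      assume "walk_edge w m \<in> walk_edge w ` {..<m}"
      then obtain t where t: "t < m" "walk_edge w m = walk_edge w t" by auto
      then have "w (Suc m) = w t \<or> w (Suc m) = w (Suc t)"
        by (auto simp: walk_edge_def min_def max_def split: if_splits)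
      with t False show False by auto
    qed
    then have "card (walk_edge w ` {..<Suc m}) = Suc (card (walk_edge w ` {..<m}))"
      by (simp add: lessThan_Suc)
    then show ?thesis using Suc False by (simp add: atMost_Suc)
  qed
qed simp

lemma doubled_walk_card_edges_le:
  assumes "doubled_walk m w"
  shows "2 * card (walk_edge w ` {..<m}) \<le> m"
proof -
  have "(\<Sum>e\<in>walk_edge w ` {..<m}. 2) \<le> (\<Sum>e\<in>walk_edge w ` {..<m}. walk_edge_count m w e)"
    by (intro sum_mono doubled_walk_count_ge_2[OF assms])
  also have "\<dots> = (\<Sum>t<m. 1)"
    unfolding walk_edge_count_def card_eq_sum by (rule sum.group) auto
  finally show ?thesis by simp
qed

lemma doubled_walk_card_vertices_le:
  assumes "doubled_walk (2 * k) w"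
  shows "card (w ` {..2 * k}) \<le> k + 1"
  using card_walk_vertices_le[of w "2 * k"] doubled_walk_card_edges_le[OF assms] by simp

lemma abs_expectation_walk_prod_le:
  assumes w: "w \<in> walks n m" "doubled_walk m w" and \<pi>: "0 \<le> \<pi>" "\<pi> \<le> 1"
    and moment: "\<And>e k. e \<in> pairs n \<Longrightarrow> 2 \<le> k \<Longrightarrow> \<bar>entry_moment P f e k\<bar> \<le> \<pi>"
  shows "\<bar>edge_expectation n P (\<lambda>\<omega>. walk_prod (symmat (\<lambda>e. f e (\<omega> e))) m w)\<bar>
      \<le> \<pi> ^ (card (w ` {..m}) - 1)"
proof -
  let ?M = "\<lambda>e. entry_moment P f e (walk_edge_count m w e)"
  have loopless: "loopless m w" using w by (simp add: doubled_walk_def)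
  then have edges: "walk_edge w ` {..<m} \<subseteq> pairs n" using walk_edge_in_pairs[OF w(1)] by auto
  have "\<bar>\<Prod>e\<in>pairs n. ?M e\<bar> = (\<Prod>e\<in>pairs n. \<bar>?M e\<bar>)" by (rule abs_prod)
  also have "\<dots> = (\<Prod>e\<in>walk_edge w ` {..<m}. \<bar>?M e\<bar>)"
  proof (rule prod.mono_neutral_right)
    show "\<forall>e\<in>pairs n - walk_edge w ` {..<m}. \<bar>?M e\<bar> = 1"
    proof
      fix e assume "e \<in> pairs n - walk_edge w ` {..<m}"
      then have "walk_edge_count m w e = 0" by (simp add: walk_edge_count_eq_0_iff)
      then show "\<bar>?M e\<bar> = 1" by (simp add: entry_moment_def)
    qed
  qed (use edges in auto)
  also have "\<dots> \<le> (\<Prod>e\<in>walk_edge w ` {..<m}. \<pi>)"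
    using edges by (intro prod_mono conjI moment doubled_walk_count_ge_2[OF w(2)]) auto
  also have "\<dots> = \<pi> ^ card (walk_edge w ` {..<m})" by simp
  also have "\<dots> \<le> \<pi> ^ (card (w ` {..m}) - 1)"
    using card_walk_vertices_le[of w m] \<pi> by (intro power_decreasing) auto
  finally show ?thesis unfolding expectation_walk_prod[OF w(1) loopless] .
qed

lemma expectation_walk_prod_ge_1:
  assumes w: "w \<in> walks n m" "doubled_walk m w"
    and moment: "\<And>e k. e \<in> pairs n \<Longrightarrow> 2 \<le> k \<Longrightarrow> 1 \<le> entry_moment P f e k"
  shows "1 \<le> edge_expectation n P (\<lambda>\<omega>. walk_prod (symmat (\<lambda>e. f e (\<omega> e))) m w)"
proof -
  have loopless: "loopless m w" using w by (simp add: doubled_walk_def)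
  show ?thesis
    unfolding expectation_walk_prod[OF w(1) loopless]
  proof (rule prod_ge_1)
    fix e assume e: "e \<in> pairs n"
    show "1 \<le> entry_moment P f e (walk_edge_count m w e)"
    proof (cases "e \<in> walk_edge w ` {..<m}")
      case True
      then show ?thesis by (intro moment e doubled_walk_count_ge_2[OF w(2)])
    next
      case False
      then have "walk_edge_count m w e = 0" by (simp add: walk_edge_count_eq_0_iff)
      then show ?thesis by (simp add: entry_moment_def)
    qed
  qed
qed

definition walk_pattern :: "nat \<Rightarrow> (nat \<Rightarrow> nat) \<Rightarrow> (nat \<times> nat) set" where
  "walk_pattern m w = {(s, t). s \<le> m \<and> t \<le> m \<and> w s = w t}"

lemma walk_pattern_eqD:
  "walk_pattern m w = walk_pattern m w' \<Longrightarrow> s \<le> m \<Longrightarrow> t \<le> m \<Longrightarrow> w s = w t \<longleftrightarrow> w' s = w' t"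
  by (auto simp: walk_pattern_def set_eq_iff)

lemma walk_edge_eq_iff: "walk_edge w s = walk_edge w t \<longleftrightarrow>
    (w s = w t \<and> w (Suc s) = w (Suc t)) \<or> (w s = w (Suc t) \<and> w (Suc s) = w t)"
  by (auto simp: walk_edge_def min_def max_def)

lemma doubled_walk_pattern_cong:
  assumes "walk_pattern m w = walk_pattern m w'"
  shows "doubled_walk m w \<longleftrightarrow> doubled_walk m w'"
proof -
  note same = walk_pattern_eqD[OF assms]
  have "walk_edge w s = walk_edge w t \<longleftrightarrow> walk_edge w' s = walk_edge w' t" if "s < m" "t < m" for s t
    unfolding walk_edge_eq_iff using that by (simp add: same)
  then have count: "walk_edge_count m w (walk_edge w t) = walk_edge_count m w' (walk_edge w' t)"
    if "t < m" for t
    unfolding walk_edge_count_def using that by (intro arg_cong[where f = card]) auto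
  have "w 0 = w m \<longleftrightarrow> w' 0 = w' m" by (simp add: same)
  moreover have "loopless m w \<longleftrightarrow> loopless m w'" by (auto simp: loopless_def same)
  ultimately show ?thesis using count by (auto simp: doubled_walk_def)
qed

lemma walk_pattern_eq_imp_relabelling:
  assumes "walk_pattern m w = walk_pattern m w0"
  shows "\<exists>\<phi>. inj_on \<phi> (w0 ` {..m}) \<and> (\<forall>t\<le>m. w t = \<phi> (w0 t))"
proof -
  define \<phi> where "\<phi> v = w (inv_into {..m} w0 v)" for v
  have \<phi>: "w t = \<phi> (w0 t)" if "t \<le> m" for t
  proof -
    let ?s = "inv_into {..m} w0 (w0 t)"
    have t: "w0 t \<in> w0 ` {..m}" using that by simp
    have "?s \<le> m" using inv_into_into[OF t] by simp
    moreover have "w0 ?s = w0 t" by (rule f_inv_into_f[OF t])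
    ultimately show ?thesis using walk_pattern_eqD[OF assms, of ?s t] that by (simp add: \<phi>_def)
  qed
  moreover have "inj_on \<phi> (w0 ` {..m})"
  proof (intro inj_onI; elim imageE)
    fix v v' s t assume "\<phi> v = \<phi> v'" "v = w0 s" "v' = w0 t" "s \<in> {..m}" "t \<in> {..m}"
    then show "v = v'" using walk_pattern_eqD[OF assms, of s t] \<phi> by simp
  qed
  ultimately show ?thesis by blast
qed

lemma card_vertices_pattern_cong:
  assumes "walk_pattern m w = walk_pattern m w'"
  shows "card (w ` {..m}) = card (w' ` {..m})"
proof -
  obtain \<phi> where \<phi>: "inj_on \<phi> (w' ` {..m})" "\<forall>t\<le>m. w t = \<phi> (w' t)"
    using walk_pattern_eq_imp_relabelling[OF assms] by blast
  have "w ` {..m} = \<phi> ` w' ` {..m}" using \<phi>(2) by (auto simp: image_image)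
  then show ?thesis using card_image[OF \<phi>(1)] by simp
qed

lemma inj_on_relabel: "inj_on (\<lambda>\<phi>. restrict (\<phi> \<circ> w0) {..m}) (w0 ` {..m} \<rightarrow>\<^sub>E B)"
proof (rule inj_onI)
  fix \<phi> \<phi>' assume mem: "\<phi> \<in> w0 ` {..m} \<rightarrow>\<^sub>E B" "\<phi>' \<in> w0 ` {..m} \<rightarrow>\<^sub>E B"
    and eq: "restrict (\<phi> \<circ> w0) {..m} = restrict (\<phi>' \<circ> w0) {..m}"
  show "\<phi> = \<phi>'"
  proof (rule PiE_ext[OF mem])
    fix v assume "v \<in> w0 ` {..m}"
    then obtain t where t: "t \<le> m" "v = w0 t" by auto
    then show "\<phi> v = \<phi>' v" using fun_cong[OF eq, of t] by simp
  qed
qed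

lemma bij_betw_relabellings_walks:
  "bij_betw (\<lambda>\<phi>. restrict (\<phi> \<circ> w0) {..m}) {\<phi> \<in> w0 ` {..m} \<rightarrow>\<^sub>E {..<n}. inj_on \<phi> (w0 ` {..m})}
    {w \<in> walks n m. walk_pattern m w = walk_pattern m w0}"
  (is "bij_betw ?r ?I ?W")
  unfolding bij_betw_def
proof (intro conjI subset_antisym subsetI)
  show "inj_on ?r ?I"
    by (rule inj_on_subset[OF inj_on_relabel]) auto
next
  fix w assume "w \<in> ?r ` ?I"
  then obtain \<phi> where \<phi>: "\<phi> \<in> ?I" and w: "w = ?r \<phi>" by auto
  have "\<phi> (w0 s) = \<phi> (w0 t) \<longleftrightarrow> w0 s = w0 t" if "s \<le> m" "t \<le> m" for s t
    using \<phi> that by (auto simp: inj_on_def)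
  then have "walk_pattern m w = walk_pattern m w0" by (auto simp: w walk_pattern_def)
  moreover have "w \<in> walks n m"
    using \<phi> unfolding w walks_def by (intro restrict_PiE_iff[THEN iffD2]) auto
  ultimately show "w \<in> ?W" by simp
next
  fix w assume w: "w \<in> ?W"
  then have "walk_pattern m w = walk_pattern m w0" by simp
  then obtain \<phi> where \<phi>: "inj_on \<phi> (w0 ` {..m})" "\<forall>t\<le>m. w t = \<phi> (w0 t)"
    using walk_pattern_eq_imp_relabelling by blast
  have "w t < n" if "t \<le> m" for t using w that by (auto simp: walks_def PiE_iff)
  then have "restrict \<phi> (w0 ` {..m}) \<in> ?I"
    using \<phi> by (auto simp: inj_on_def)
  moreover have "w = ?r (restrict \<phi> (w0 ` {..m}))"
  proof (rule extensionalityI)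
    show "w \<in> extensional {..m}" using w by (simp add: walks_def PiE_def)
  qed (simp_all add: \<phi>(2))
  ultimately show "w \<in> ?r ` ?I" by blast
qed

lemma card_walks_pattern:
  "card {w \<in> walks n m. walk_pattern m w = walk_pattern m w0} = (\<Prod>i<card (w0 ` {..m}). n - i)"
  unfolding bij_betw_same_card[OF bij_betw_relabellings_walks, symmetric]
  by (subst card_inj_on_subset_funcset) (auto simp: atLeast0LessThan)

lemma falling_factorial_compare:
  assumes r: "0 < r" "real n * \<pi> + real k \<le> real r" and \<pi>: "0 \<le> \<pi>" and m: "1 \<le> m" "m \<le> k + 1"
  shows "real (\<Prod>i<m. n - i) * \<pi> ^ (m - 1) \<le> real n / real r * real (\<Prod>i<m. r - i)"
proof -
  obtain l where l: "m = Suc l" using m by (cases m) auto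
  have "0 \<le> real n * \<pi>" using \<pi> by simp
  with r have kr: "k \<le> r" by linarith
  have "real (\<Prod>i<m. n - i) = real n * (\<Prod>i<l. real (n - Suc i))"
    unfolding l by (subst prod.lessThan_Suc_shift) simp
  also have "\<dots> * \<pi> ^ (m - 1) = real n * (\<Prod>i<l. real (n - Suc i) * \<pi>)"
    by (simp add: l prod.distrib)
  also have "\<dots> \<le> real n * (\<Prod>i<l. real (r - Suc i))"
  proof (intro mult_left_mono prod_mono conjI)
    fix i assume i: "i \<in> {..<l}"
    have "real (n - Suc i) * \<pi> \<le> real n * \<pi>" using \<pi> by (intro mult_right_mono) auto
    also have "\<dots> \<le> real (r - k)" using r kr by (simp add: of_nat_diff)
    also have "\<dots> \<le> real (r - Suc i)" using i m l by (intro of_nat_mono) auto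
    finally show "real (n - Suc i) * \<pi> \<le> real (r - Suc i)" .
  qed (use \<pi> in auto)
  also have "\<dots> = real n / real r * (real r * (\<Prod>i<l. real (r - Suc i)))" using r by simp
  also have "real r * (\<Prod>i<l. real (r - Suc i)) = real (\<Prod>i<m. r - i)"
    unfolding l by (subst prod.lessThan_Suc_shift) simp
  finally show ?thesis .
qed

lemma sum_doubled_walks_pattern_le:
  assumes r: "0 < r" "real n * \<pi> + real k \<le> real r" and \<pi>: "0 \<le> \<pi>" and w0: "doubled_walk (2 * k) w0"
  shows "(\<Sum>w | w \<in> walks n (2 * k) \<and> walk_pattern (2 * k) w = walk_pattern (2 * k) w0.
      \<pi> ^ (card (w ` {..2 * k}) - 1)) \<le>
    real n / real r *
      real (card {w \<in> walks r (2 * k). walk_pattern (2 * k) w = walk_pattern (2 * k) w0})"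
proof -
  let ?m = "2 * k" and ?v = "card (w0 ` {..2 * k})"
  have "(\<Sum>w | w \<in> walks n ?m \<and> walk_pattern ?m w = walk_pattern ?m w0. \<pi> ^ (card (w ` {..?m}) - 1)) =
      (\<Sum>w | w \<in> walks n ?m \<and> walk_pattern ?m w = walk_pattern ?m w0. \<pi> ^ (?v - 1))"
  proof (intro sum.cong refl)
    fix w assume "w \<in> {w. w \<in> walks n ?m \<and> walk_pattern ?m w = walk_pattern ?m w0}"
    then have "card (w ` {..?m}) = ?v" using card_vertices_pattern_cong[of ?m w w0] by blast
    then show "\<pi> ^ (card (w ` {..?m}) - 1) = \<pi> ^ (?v - 1)" by simp
  qed
  also have "\<dots> = real (\<Prod>i<?v. n - i) * \<pi> ^ (?v - 1)"
    by (simp add: card_walks_pattern)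
  also have "\<dots> \<le> real n / real r * real (\<Prod>i<?v. r - i)"
    by (intro falling_factorial_compare[OF r \<pi>] doubled_walk_card_vertices_le w0)
       (simp add: Suc_le_eq card_gt_0_iff)
  also have "\<dots> = real n / real r *
      real (card {w \<in> walks r ?m. walk_pattern ?m w = walk_pattern ?m w0})"
    by (simp add: card_walks_pattern)
  finally show ?thesis .
qed

lemma sum_doubled_walks_le:
  assumes r: "0 < r" "real n * \<pi> + real k \<le> real r" and \<pi>: "0 \<le> \<pi>"
  shows "(\<Sum>w | w \<in> walks n (2 * k) \<and> doubled_walk (2 * k) w. \<pi> ^ (card (w ` {..2 * k}) - 1)) \<le>
    real n / real r * real (card {w \<in> walks r (2 * k). doubled_walk (2 * k) w})"
proof -
  let ?m = "2 * k"
  let ?G = "\<lambda>n. {w. w \<in> walks n ?m \<and> doubled_walk ?m w}"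
  let ?K = "walk_pattern ?m ` ?G n"
  let ?fibre = "\<lambda>N \<kappa>. {w. w \<in> ?G N \<and> walk_pattern ?m w = \<kappa>}"
  have "(\<Sum>w\<in>?G n. \<pi> ^ (card (w ` {..?m}) - 1)) =
      (\<Sum>\<kappa>\<in>?K. \<Sum>w\<in>?fibre n \<kappa>. \<pi> ^ (card (w ` {..?m}) - 1))"
    by (rule sum.image_gen) simp
  also have "\<dots> \<le> (\<Sum>\<kappa>\<in>?K. real n / real r * real (card (?fibre r \<kappa>)))"
  proof (rule sum_mono)
    fix \<kappa> assume "\<kappa> \<in> ?K"
    then obtain w0 where w0: "doubled_walk ?m w0" "\<kappa> = walk_pattern ?m w0" by auto
    then have "?fibre N \<kappa> = {w \<in> walks N ?m. walk_pattern ?m w = walk_pattern ?m w0}" for N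
      using doubled_walk_pattern_cong[of ?m _ w0] by blast
    then show "(\<Sum>w\<in>?fibre n \<kappa>. \<pi> ^ (card (w ` {..?m}) - 1))
        \<le> real n / real r * real (card (?fibre r \<kappa>))"
      using sum_doubled_walks_pattern_le[OF r \<pi> w0(1)] by simp
  qed
  also have "\<dots> = real n / real r * real (\<Sum>\<kappa>\<in>?K. card (?fibre r \<kappa>))"
    by (simp add: sum_distrib_left)
  also have "(\<Sum>\<kappa>\<in>?K. card (?fibre r \<kappa>)) = card (\<Union>\<kappa>\<in>?K. ?fibre r \<kappa>)"
    by (rule card_UN_disjoint[symmetric]) auto
  also have "real n / real r * real (card (\<Union>\<kappa>\<in>?K. ?fibre r \<kappa>)) \<le> real n / real r * real (card (?G r))"
    by (intro mult_left_mono of_nat_mono card_mono) auto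
  finally show ?thesis by simp
qed

lemma expectation_trace_power_eq_sum_doubled_walks:
  assumes "\<And>e. e \<in> pairs n \<Longrightarrow> entry_moment P f e 1 = 0"
  shows "edge_expectation n P (\<lambda>\<omega>. trace_power n (symmat (\<lambda>e. f e (\<omega> e))) m) =
    (\<Sum>w | w \<in> walks n m \<and> doubled_walk m w.
      edge_expectation n P (\<lambda>\<omega>. walk_prod (symmat (\<lambda>e. f e (\<omega> e))) m w))"
proof -
  have "edge_expectation n P (\<lambda>\<omega>. trace_power n (symmat (\<lambda>e. f e (\<omega> e))) m) =
      (\<Sum>w | w \<in> walks n m \<and> w 0 = w m.
        edge_expectation n P (\<lambda>\<omega>. walk_prod (symmat (\<lambda>e. f e (\<omega> e))) m w))"
    unfolding trace_power_eq_sum_closed_walks by (rule Bochner_Integration.integral_sum) simp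
  also have "\<dots> = (\<Sum>w | w \<in> walks n m \<and> doubled_walk m w.
      edge_expectation n P (\<lambda>\<omega>. walk_prod (symmat (\<lambda>e. f e (\<omega> e))) m w))"
    by (intro sum.mono_neutral_right ballI expectation_walk_prod_eq_0 assms)
       (auto simp: doubled_walk_def)
  finally show ?thesis .
qed

theorem expectation_trace_power_compare:
  assumes r: "0 < r" "real n * \<pi> + real k \<le> real r" and \<pi>: "0 \<le> \<pi>" "\<pi> \<le> 1"
    and mean: "\<And>e. e \<in> pairs n \<Longrightarrow> entry_moment P f e 1 = 0"
    and moment: "\<And>e k. e \<in> pairs n \<Longrightarrow> 2 \<le> k \<Longrightarrow> \<bar>entry_moment P f e k\<bar> \<le> \<pi>"
    and mean': "\<And>e. e \<in> pairs r \<Longrightarrow> entry_moment Q g e 1 = 0"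
    and moment': "\<And>e k. e \<in> pairs r \<Longrightarrow> 2 \<le> k \<Longrightarrow> 1 \<le> entry_moment Q g e k"
  shows "edge_expectation n P (\<lambda>\<omega>. trace_power n (symmat (\<lambda>e. f e (\<omega> e))) (2 * k)) \<le>
    real n / real r * edge_expectation r Q (\<lambda>\<omega>. trace_power r (symmat (\<lambda>e. g e (\<omega> e))) (2 * k))"
proof -
  let ?m = "2 * k"
  let ?E = "\<lambda>w. edge_expectation n P (\<lambda>\<omega>. walk_prod (symmat (\<lambda>e. f e (\<omega> e))) ?m w)"
  let ?F = "\<lambda>w. edge_expectation r Q (\<lambda>\<omega>. walk_prod (symmat (\<lambda>e. g e (\<omega> e))) ?m w)"
  have "(\<Sum>w | w \<in> walks n ?m \<and> doubled_walk ?m w. ?E w) \<le>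
      (\<Sum>w | w \<in> walks n ?m \<and> doubled_walk ?m w. \<pi> ^ (card (w ` {..?m}) - 1))"
    by (rule sum_mono, rule abs_le_D1, rule abs_expectation_walk_prod_le) (use \<pi> moment in auto)
  also have "\<dots> \<le> real n / real r * real (card {w \<in> walks r ?m. doubled_walk ?m w})"
    by (rule sum_doubled_walks_le) fact+
  also have "\<dots> = real n / real r * (\<Sum>w | w \<in> walks r ?m \<and> doubled_walk ?m w. 1)" by simp
  also have "\<dots> \<le> real n / real r * (\<Sum>w | w \<in> walks r ?m \<and> doubled_walk ?m w. ?F w)"
    by (intro mult_left_mono sum_mono expectation_walk_prod_ge_1 moment') auto
  finally show ?thesis
    by (simp only: expectation_trace_power_eq_sum_doubled_walks mean mean')
qed

section \<open>An integer net for the spectral norm\<close>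

definition int_ball :: "nat \<Rightarrow> nat \<Rightarrow> (nat \<Rightarrow> int) set" where
  "int_ball r R = {u \<in> {..<r} \<rightarrow>\<^sub>E UNIV. (\<Sum>i<r. (u i)\<^sup>2) \<le> int R}"

lemma abs_le_square_int: "\<bar>k :: int\<bar> \<le> k\<^sup>2"
proof (cases "k = 0")
  case False
  then have "\<bar>k\<bar> \<le> \<bar>k\<bar>\<^sup>2" by (intro self_le_power) auto
  then show ?thesis by simp
qed simp

lemma int_ball_subset: "int_ball r R \<subseteq> {..<r} \<rightarrow>\<^sub>E {- int R..int R}"
proof
  fix u assume u: "u \<in> int_ball r R"
  have "\<bar>u i\<bar> \<le> int R" if "i < r" for i
  proof -
    have "\<bar>u i\<bar> \<le> (u i)\<^sup>2" by (rule abs_le_square_int)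
    also have "\<dots> \<le> (\<Sum>i<r. (u i)\<^sup>2)" using that by (intro member_le_sum) auto
    also have "\<dots> \<le> int R" using u by (simp add: int_ball_def)
    finally show ?thesis .
  qed
  then have "u i \<in> {- int R..int R}" if "i < r" for i
    using that unfolding atLeastAtMost_iff by (meson abs_le_iff minus_le_iff)
  then show "u \<in> {..<r} \<rightarrow>\<^sub>E {- int R..int R}"
    using u by (auto simp: int_ball_def PiE_iff)
qed

lemma finite_int_ball [simp]: "finite (int_ball r R)"
  by (rule finite_subset[OF int_ball_subset]) (auto intro: finite_PiE)

lemma zero_in_int_ball: "restrict (\<lambda>_. 0) {..<r} \<in> int_ball r R"
  by (simp add: int_ball_def)

lemma sum_half_power_abs: "(\<Sum>j\<in>{- int M..int M}. (1 / 2 :: real) ^ nat \<bar>j\<bar>) = 3 - 2 * (1 / 2) ^ M"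
proof (induction M)
  case (Suc M)
  have "{- int (Suc M)..int (Suc M)} = insert (- int (Suc M)) (insert (int (Suc M)) {- int M..int M})"
    by auto
  then show ?case using Suc by (simp add: nat_add_distrib)
qed simp

text \<open>The weight \<open>\<Prod>\<^sub>i 2\<^bsup>-|u\<^sub>i|\<^esup>\<close> is at least \<open>2\<^bsup>-R\<^esup>\<close> on the ball and has total mass at most \<open>3\<^sup>r\<close>.\<close>

lemma card_int_ball_le: "real (card (int_ball r R)) \<le> 3 ^ r * 2 ^ R"
proof -
  let ?weight = "\<lambda>u. \<Prod>i<r. (1 / 2 :: real) ^ nat \<bar>u i\<bar>"
  have weight_ge: "(1 / 2) ^ R \<le> ?weight u" if "u \<in> int_ball r R" for u
  proof -
    have "int (\<Sum>i<r. nat \<bar>u i\<bar>) \<le> (\<Sum>i<r. (u i)\<^sup>2)"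
      by (simp add: sum_mono abs_le_square_int)
    also have "\<dots> \<le> int R" using that by (simp add: int_ball_def)
    finally have "(\<Sum>i<r. nat \<bar>u i\<bar>) \<le> R" by (simp only: of_nat_le_iff)
    then have "(1 / 2 :: real) ^ R \<le> (1 / 2) ^ (\<Sum>i<r. nat \<bar>u i\<bar>)" by (intro power_decreasing) auto
    then show ?thesis by (simp add: power_sum)
  qed
  have "real (card (int_ball r R)) * (1 / 2) ^ R = (\<Sum>u\<in>int_ball r R. (1 / 2) ^ R)" by simp
  also have "\<dots> \<le> (\<Sum>u\<in>int_ball r R. ?weight u)" by (rule sum_mono) (rule weight_ge)
  also have "\<dots> \<le> (\<Sum>u\<in>{..<r} \<rightarrow>\<^sub>E {- int R..int R}. ?weight u)"
    by (rule sum_mono2)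
       (auto simp: prod_nonneg intro!: finite_PiE dest: subsetD[OF int_ball_subset])
  also have "\<dots> = (\<Prod>i<r. \<Sum>j\<in>{- int R..int R}. (1 / 2 :: real) ^ nat \<bar>j\<bar>)"
    by (rule prod_sum_PiE[symmetric]) auto
  also have "\<dots> \<le> (\<Prod>i<r. 3)"
    by (intro prod_mono conjI sum_nonneg) (auto simp only: sum_half_power_abs, auto)
  finally have "real (card (int_ball r R)) * (1 / 2) ^ R * 2 ^ R \<le> 3 ^ r * 2 ^ R"
    by (intro mult_right_mono) auto
  then show ?thesis by (simp add: power_one_over)
qed

lemma int_ball_rounding:
  assumes r: "0 < r" and x: "l2norm r x \<le> 1"
  obtains u where "u \<in> int_ball r (7 * r)" "l2norm r (\<lambda>i. x i - u i / (2 * sqrt r)) \<le> 1 / 4"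
    "l2norm r (\<lambda>i. u i / (2 * sqrt r)) \<le> 5 / 4"
proof -
  define c where "c = 2 * sqrt r"
  have c: "0 < c" "c\<^sup>2 = 4 * r" using r by (auto simp: c_def power_mult_distrib)
  define u where "u = restrict (\<lambda>i. round (c * x i)) {..<r}"
  have "(x i - u i / c)\<^sup>2 \<le> (1 / (2 * c))\<^sup>2" if "i < r" for i
  proof -
    have "\<bar>c * x i - u i\<bar> \<le> 1 / 2"
      using of_int_round_abs_le[of "c * x i"] that by (simp add: u_def abs_minus_commute)
    moreover have "x i - u i / c = (c * x i - u i) / c" using c by (simp add: diff_divide_distrib)
    ultimately have "\<bar>x i - u i / c\<bar> \<le> 1 / 2 / c"
      using c by (simp only: abs_divide abs_of_pos divide_right_mono)
    then have "\<bar>x i - u i / c\<bar> \<le> 1 / (2 * c)" by simp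
    then have "\<bar>x i - u i / c\<bar>\<^sup>2 \<le> (1 / (2 * c))\<^sup>2" by (intro power_mono) auto
    then show ?thesis by simp
  qed
  then have "(\<Sum>i<r. (x i - u i / c)\<^sup>2) \<le> (\<Sum>i<r. (1 / (2 * c))\<^sup>2)" by (intro sum_mono) auto
  also have "\<dots> = (1 / 4)\<^sup>2" using r by (simp add: power_divide power_mult_distrib c(2))
  finally have err: "l2norm r (\<lambda>i. x i - u i / c) \<le> 1 / 4"
    unfolding L2_set_def by (intro real_le_lsqrt) auto
  have "l2norm r (\<lambda>i. u i / c) = l2norm r (\<lambda>i. x i + - (x i - u i / c))" by simp
  also have "\<dots> \<le> l2norm r x + l2norm r (\<lambda>i. - (x i - u i / c))" by (rule L2_set_triangle_ineq)
  also have "l2norm r (\<lambda>i. - (x i - u i / c)) = l2norm r (\<lambda>i. x i - u i / c)"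
    by (simp add: L2_set_def power2_commute)
  finally have norm_u: "l2norm r (\<lambda>i. u i / c) \<le> 5 / 4" using x err by simp
  have "(\<Sum>i<r. (real_of_int (u i))\<^sup>2) = c\<^sup>2 * (l2norm r (\<lambda>i. u i / c))\<^sup>2"
    using c by (simp add: L2_set_power2 sum_distrib_left power_divide)
  also have "\<dots> \<le> c\<^sup>2 * (5 / 4)\<^sup>2"
    using norm_u by (intro mult_left_mono power_mono) auto
  also have "\<dots> \<le> 7 * r" unfolding c(2) by (simp add: power2_eq_square)
  finally have "real_of_int (\<Sum>i<r. (u i)\<^sup>2) \<le> real_of_int (int (7 * r))" by simp
  then have "u \<in> int_ball r (7 * r)" by (simp only: int_ball_def of_int_le_iff) (simp add: u_def)
  with err norm_u show thesis unfolding c_def by (intro that[of u])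
qed

lemma spectral_norm_le_int_ball:
  assumes r: "0 < r" and sym: "sym_mat r M"
    and net: "\<And>u. u \<in> int_ball r (7 * r) \<Longrightarrow> \<bar>bilin r M u u\<bar> \<le> 4 * r * N"
  shows "spectral_norm r M \<le> 16 / 7 * N"
proof -
  let ?\<sigma> = "spectral_norm r M"
  have "\<bar>bilin r M x x\<bar> \<le> N + 9 / 16 * ?\<sigma>" if x: "l2norm r x \<le> 1" for x
  proof -
    obtain u where u: "u \<in> int_ball r (7 * r)" "l2norm r (\<lambda>i. x i - u i / (2 * sqrt r)) \<le> 1 / 4"
        "l2norm r (\<lambda>i. u i / (2 * sqrt r)) \<le> 5 / 4"
      using int_ball_rounding[OF r x] .
    define y e where "y = (\<lambda>i. u i / (2 * sqrt r))" and "e = (\<lambda>i. x i - y i)"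
    have y: "l2norm r y \<le> 5 / 4" and e: "l2norm r e \<le> 1 / 4" using u by (simp_all add: y_def e_def)
    have "bilin r M y y = bilin r M u u / (4 * r)"
      using bilin_scale[of r M "1 / (2 * sqrt r)" u "1 / (2 * sqrt r)" u] by (simp add: y_def)
    then have yy: "\<bar>bilin r M y y\<bar> \<le> N"
      using net[OF u(1)] r by (simp only: abs_divide) (simp add: pos_divide_le_eq mult_ac)
    have "\<bar>bilin r M y e\<bar> \<le> ?\<sigma> * l2norm r y * l2norm r e" by (rule abs_bilin_le[OF sym])
    also have "\<dots> \<le> ?\<sigma> * (5 / 4) * (1 / 4)" by (intro mult_mono y e) auto
    finally have ye: "\<bar>bilin r M y e\<bar> \<le> 5 / 16 * ?\<sigma>" by simp
    have "\<bar>bilin r M e x\<bar> \<le> ?\<sigma> * l2norm r e * l2norm r x" by (rule abs_bilin_le[OF sym])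
    also have "\<dots> \<le> ?\<sigma> * (1 / 4) * 1" by (intro mult_mono x e) auto
    finally have ex: "\<bar>bilin r M e x\<bar> \<le> 1 / 4 * ?\<sigma>" by simp
    have "bilin r M x x = bilin r M (\<lambda>i. y i + e i) x" by (simp add: e_def)
    also have "\<dots> = bilin r M y (\<lambda>i. y i + e i) + bilin r M e x"
      by (simp only: bilin_add_left) (simp add: e_def)
    also have "\<dots> = bilin r M y y + bilin r M y e + bilin r M e x" by (simp only: bilin_add_right)
    finally show ?thesis using yy ye ex by linarith
  qed
  then have "?\<sigma> \<le> N + 9 / 16 * ?\<sigma>" by (rule spectral_norm_leI)
  then show ?thesis by simp
qed

lemma trace_power_le_sum_int_ball:
  assumes r: "0 < r" and sym: "sym_mat r M"
  shows "trace_power r M (2 * k) \<le>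
    r * (16 / 7) ^ (2 * k) * (\<Sum>u\<in>int_ball r (7 * r). (bilin r M u u / (4 * real r)) ^ (2 * k))"
proof -
  let ?net = "int_ball r (7 * r)"
  define F where "F u = \<bar>bilin r M u u / (4 * real r)\<bar>" for u :: "nat \<Rightarrow> int"
  define N where "N = Max (F ` ?net)"
  have "N \<in> F ` ?net"
    unfolding N_def using zero_in_int_ball by (intro Max_in) auto
  then obtain u where u: "u \<in> ?net" "N = F u" by auto
  have "\<bar>bilin r M v v\<bar> \<le> 4 * real r * N" if "v \<in> ?net" for v :: "nat \<Rightarrow> int"
  proof -
    have "F v \<le> N" unfolding N_def using that by (intro Max_ge) auto
    then show ?thesis using r by (simp add: F_def abs_divide field_simps)
  qed
  then have "spectral_norm r M \<le> 16 / 7 * N" by (rule spectral_norm_le_int_ball[OF r sym])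
  then have "r * spectral_norm r M ^ (2 * k) \<le> r * (16 / 7 * N) ^ (2 * k)"
    by (intro mult_left_mono power_mono) auto
  also have "\<dots> = r * (16 / 7) ^ (2 * k) * (bilin r M u u / (4 * real r)) ^ (2 * k)"
    unfolding u(2) F_def by (simp only: power_mult_distrib power_mult power2_abs mult.assoc)
  also have "\<dots> \<le> r * (16 / 7) ^ (2 * k) * (\<Sum>u\<in>?net. (bilin r M u u / (4 * real r)) ^ (2 * k))"
    by (intro mult_left_mono u(1) member_le_sum[where f =
          "\<lambda>u :: nat \<Rightarrow> int. (bilin r M u u / (4 * real r)) ^ (2 * k)"])
       (auto simp: power_mult)
  finally show ?thesis using trace_power_le_spectral_norm[OF sym, of k] by linarith
qed

section \<open>Trace moments of a dense comparison matrix\<close>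

lemma sum_pairs:
  fixes F :: "nat \<Rightarrow> nat \<Rightarrow> real"
  shows "(\<Sum>i<n. \<Sum>j<n. F i j) = (\<Sum>(i, j)\<in>pairs n. F i j + F j i) + (\<Sum>i<n. F i i)"
proof -
  let ?D = "(\<lambda>i. (i, i)) ` {..<n}" and ?L = "prod.swap ` pairs n"
  have "(\<Sum>i<n. \<Sum>j<n. F i j) = (\<Sum>(i, j)\<in>{..<n} \<times> {..<n}. F i j)"
    by (rule sum.cartesian_product)
  also have "{..<n} \<times> {..<n} = pairs n \<union> (?L \<union> ?D)"
    by (auto simp: pairs_def image_iff)
  also have "(\<Sum>(i, j)\<in>pairs n \<union> (?L \<union> ?D). F i j) =
      (\<Sum>(i, j)\<in>pairs n. F i j) + ((\<Sum>(i, j)\<in>?L. F i j) + (\<Sum>(i, j)\<in>?D. F i j))"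
  proof -
    have "pairs n \<inter> (?L \<union> ?D) = {}" "?L \<inter> ?D = {}" by (auto simp: pairs_def)
    then show ?thesis by (simp add: sum.union_disjoint)
  qed
  also have "(\<Sum>(i, j)\<in>?L. F i j) = (\<Sum>(i, j)\<in>pairs n. F j i)"
    by (subst sum.reindex) (auto simp: case_prod_unfold intro!: sum.cong inj_onI)
  also have "(\<Sum>(i, j)\<in>?D. F i j) = (\<Sum>i<n. F i i)"
    by (subst sum.reindex) (auto intro: inj_onI)
  finally show ?thesis by (simp add: sum.distrib case_prod_unfold)
qed

lemma quadratic_form_symmat:
  "bilin n (symmat x) u u = (\<Sum>e\<in>pairs n. x e * (2 * u (fst e) * u (snd e)))"
  unfolding bilin_def sum_pairs
  by (simp add: symmat_def) (intro sum.cong refl, auto simp: symmat_def pairs_def)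

text \<open>Under probability 1/3 this is centred and all its moments of order at least 2 are at least 1,
  which is exactly what the comparison of trace moments requires of the dense matrix.\<close>

definition two_point :: "bool \<Rightarrow> real" where
  "two_point v = (if v then 2 else -1)"

lemma entry_moment_two_point_1: "entry_moment (\<lambda>_. 1 / 3) (\<lambda>_. two_point) e 1 = 0"
  by (simp add: entry_moment_def two_point_def)

lemma entry_moment_two_point_ge_1:
  assumes "2 \<le> k"
  shows "1 \<le> entry_moment (\<lambda>_. 1 / 3) (\<lambda>_. two_point) e k"
proof (cases "k = 2")
  case False
  then have "(2 :: real) ^ 3 \<le> 2 ^ k" using assms by (intro power_increasing) auto
  moreover have "- 1 \<le> (- 1 :: real) ^ k" by (cases "even k") auto
  ultimately show ?thesis by (simp add: entry_moment_def two_point_def)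
qed (simp add: entry_moment_def two_point_def)

lemma Hoeffdings_lemma_pmf_pos:
  fixes f :: "'a \<Rightarrow> real"
  assumes fin: "finite (set_pmf p)" and f: "\<And>v. v \<in> set_pmf p \<Longrightarrow> lo \<le> f v \<and> f v \<le> hi"
    and mean: "measure_pmf.expectation p f = 0" and "0 < t"
  shows "measure_pmf.expectation p (\<lambda>v. exp (t * f v)) \<le> exp (t\<^sup>2 * (hi - lo)\<^sup>2 / 8)"
proof -
  interpret interval_bounded_random_variable "measure_pmf p" f lo hi
    by unfold_locales (auto simp: AE_measure_pmf_iff f)
  have "ennreal (measure_pmf.expectation p (\<lambda>v. exp (t * f v)))
      = (\<integral>\<^sup>+v. exp (t * f v) \<partial>measure_pmf p)"
    by (intro nn_integral_eq_integral[symmetric] integrable_measure_pmf_finite fin) auto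
  also have "\<dots> \<le> ennreal (exp (t\<^sup>2 * (hi - lo)\<^sup>2 / 8))"
    by (rule Hoeffdings_lemma_nn_integral_0) fact+
  finally show ?thesis by simp
qed

lemma Hoeffdings_lemma_pmf:
  fixes f :: "'a \<Rightarrow> real"
  assumes fin: "finite (set_pmf p)" and f: "\<And>v. v \<in> set_pmf p \<Longrightarrow> lo \<le> f v \<and> f v \<le> hi"
    and mean: "measure_pmf.expectation p f = 0"
  shows "measure_pmf.expectation p (\<lambda>v. exp (t * f v)) \<le> exp (t\<^sup>2 * (hi - lo)\<^sup>2 / 8)"
proof (cases t "0 :: real" rule: linorder_cases)
  case less
  have "measure_pmf.expectation p (\<lambda>v. exp (- t * - f v)) \<le> exp ((- t)\<^sup>2 * (- lo - - hi)\<^sup>2 / 8)"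
    by (rule Hoeffdings_lemma_pmf_pos[OF fin]) (use f mean less in auto)
  then show ?thesis by (simp add: power2_commute)
next
  case greater
  show ?thesis by (rule Hoeffdings_lemma_pmf_pos[OF fin f mean greater])
qed simp

lemma two_point_linear_form_mgf_le:
  "edge_expectation r (\<lambda>_. 1 / 3) (\<lambda>\<omega>. exp (t * (\<Sum>e\<in>pairs r. two_point (\<omega> e) * c e)))
    \<le> exp (9 / 8 * t\<^sup>2 * (\<Sum>e\<in>pairs r. (c e)\<^sup>2))"
proof -
  have "edge_expectation r (\<lambda>_. 1 / 3) (\<lambda>\<omega>. exp (t * (\<Sum>e\<in>pairs r. two_point (\<omega> e) * c e))) =
      edge_expectation r (\<lambda>_. 1 / 3) (\<lambda>\<omega>. \<Prod>e\<in>pairs r. exp (t * c e * two_point (\<omega> e)))"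
    by (simp add: exp_sum[symmetric] sum_distrib_left mult_ac)
  also have "\<dots> = (\<Prod>e\<in>pairs r.
      measure_pmf.expectation (bernoulli_pmf (1 / 3)) (\<lambda>b. exp (t * c e * two_point b)))"
    by (rule expectation_prod_edge_pmf[where g = "\<lambda>e b. exp (t * c e * two_point b)"])
  also have "\<dots> \<le> (\<Prod>e\<in>pairs r. exp ((t * c e)\<^sup>2 * (2 - - 1)\<^sup>2 / 8))"
    by (intro prod_mono conjI Hoeffdings_lemma_pmf integral_nonneg) (auto simp: two_point_def)
  also have "\<dots> = exp (9 / 8 * t\<^sup>2 * (\<Sum>e\<in>pairs r. (c e)\<^sup>2))"
    by (simp add: exp_sum[symmetric] sum_distrib_left power_mult_distrib mult_ac)
  finally show ?thesis .
qed

lemma sum_pairs_power2_le: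
  "(\<Sum>e\<in>pairs r. (2 * u (fst e) * u (snd e))\<^sup>2) \<le> 2 * (l2norm r u) ^ 4"
proof -
  have "(\<Sum>e\<in>pairs r. (2 * u (fst e) * u (snd e))\<^sup>2)
      = 2 * (\<Sum>(i, j)\<in>pairs r. (u i)\<^sup>2 * (u j)\<^sup>2 + (u j)\<^sup>2 * (u i)\<^sup>2)"
    by (simp add: sum_distrib_left case_prod_unfold power_mult_distrib mult_ac)
  also have "\<dots> \<le> 2 * (\<Sum>i<r. \<Sum>j<r. (u i)\<^sup>2 * (u j)\<^sup>2)"
    unfolding sum_pairs by (simp add: sum_nonneg)
  also have "\<dots> = 2 * ((l2norm r u)\<^sup>2 * (l2norm r u)\<^sup>2)"
    by (simp add: L2_set_power2 sum_product)
  finally show ?thesis by (simp flip: power_add)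
qed

lemma two_point_quadratic_form_mgf_le:
  assumes r: "0 < r" and u: "u \<in> int_ball r (7 * r)"
  shows "edge_expectation r (\<lambda>_. 1 / 3)
    (\<lambda>\<omega>. exp (t * (bilin r (symmat (\<lambda>e. two_point (\<omega> e))) u u / (4 * real r)))) \<le> exp (7 * t\<^sup>2)"
proof -
  have "real_of_int (\<Sum>i<r. (u i)\<^sup>2) \<le> real_of_int (int (7 * r))"
    using u unfolding of_int_le_iff by (simp add: int_ball_def)
  then have "(l2norm r u)\<^sup>2 \<le> 7 * r" by (simp add: L2_set_power2)
  then have "((l2norm r u)\<^sup>2)\<^sup>2 \<le> (7 * real r)\<^sup>2" by (intro power_mono) auto
  then have norm: "2 * (l2norm r u) ^ 4 \<le> 98 * (real r)\<^sup>2"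
    by (simp add: power_mult_distrib flip: power_mult)
  let ?c = "\<lambda>e. 2 * real_of_int (u (fst e)) * real_of_int (u (snd e))"
  have "edge_expectation r (\<lambda>_. 1 / 3)
      (\<lambda>\<omega>. exp (t * (bilin r (symmat (\<lambda>e. two_point (\<omega> e))) u u / (4 * real r)))) =
      edge_expectation r (\<lambda>_. 1 / 3)
        (\<lambda>\<omega>. exp (t / (4 * real r) * (\<Sum>e\<in>pairs r. two_point (\<omega> e) * ?c e)))"
    by (simp add: quadratic_form_symmat)
  also have "\<dots> \<le> exp (9 / 8 * (t / (4 * real r))\<^sup>2 * (\<Sum>e\<in>pairs r. (?c e)\<^sup>2))"
    by (rule two_point_linear_form_mgf_le)
  also have "\<dots> \<le> exp (9 / 8 * (t / (4 * real r))\<^sup>2 * (98 * (real r)\<^sup>2))"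
    using order_trans[OF sum_pairs_power2_le[of u] norm]
    by (intro iffD2[OF exp_le_cancel_iff] mult_left_mono) auto
  also have "9 / 8 * (t / (4 * real r))\<^sup>2 * (98 * (real r)\<^sup>2) = 441 / 64 * t\<^sup>2"
    using r by (simp add: power2_eq_square)
  also have "exp (441 / 64 * t\<^sup>2) \<le> exp (7 * t\<^sup>2)" by simp
  finally show ?thesis by simp
qed

lemma power_le_fact_mult_exp:
  fixes x :: real
  assumes "0 \<le> x"
  shows "x ^ k \<le> fact k * exp x"
proof -
  have "(\<Sum>i\<in>{k}. x ^ i /\<^sub>R fact i) \<le> (\<Sum>i. x ^ i /\<^sub>R fact i)"
    using assms by (intro sum_le_suminf summable_exp_generic) auto
  then show ?thesis by (simp add: exp_def field_simps scaleR_conv_of_real)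
qed

lemma even_power_le_fact_mult_exp:
  fixes x :: real
  shows "x ^ (2 * k) \<le> fact (2 * k) * (exp x + exp (- x))"
proof -
  have "x ^ (2 * k) = \<bar>x\<bar> ^ (2 * k)" by (simp add: power_mult)
  also have "\<dots> \<le> fact (2 * k) * exp \<bar>x\<bar>" by (rule power_le_fact_mult_exp) simp
  also have "\<dots> \<le> fact (2 * k) * (exp x + exp (- x))"
    by (intro mult_left_mono) (auto simp: abs_if)
  finally show ?thesis .
qed

lemma subgaussian_even_moment_le:
  fixes S :: "'a \<Rightarrow> real"
  assumes fin: "finite (set_pmf p)"
    and mgf: "\<And>t. measure_pmf.expectation p (\<lambda>\<omega>. exp (t * S \<omega>)) \<le> exp (c * t\<^sup>2)" and k: "0 < k"
  shows "measure_pmf.expectation p (\<lambda>\<omega>. S \<omega> ^ (2 * k)) \<le> 2 * (4 * exp c * k) ^ k"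
proof -
  note int = integrable_measure_pmf_finite[OF fin]
  let ?t = "sqrt k"
  have "(real k) ^ k * measure_pmf.expectation p (\<lambda>\<omega>. S \<omega> ^ (2 * k)) =
      measure_pmf.expectation p (\<lambda>\<omega>. (?t * S \<omega>) ^ (2 * k))"
    by (simp add: power_mult_distrib power_mult)
  also have "\<dots> \<le> measure_pmf.expectation p (\<lambda>\<omega>. fact (2 * k) * (exp (?t * S \<omega>) + exp ((- ?t) * S \<omega>)))"
    using even_power_le_fact_mult_exp by (intro integral_mono int) auto
  also have "\<dots> = fact (2 * k) * (measure_pmf.expectation p (\<lambda>\<omega>. exp (?t * S \<omega>)) +
      measure_pmf.expectation p (\<lambda>\<omega>. exp ((- ?t) * S \<omega>)))"
    by (subst integral_mult_right_zero, subst Bochner_Integration.integral_add) (auto intro: int)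
  also have "\<dots> \<le> fact (2 * k) * (exp (c * k) + exp (c * k))"
    using mgf[of ?t] mgf[of "- ?t"] by (intro mult_left_mono add_mono) auto
  also have "\<dots> \<le> (2 * real k) ^ (2 * k) * (2 * exp c ^ k)"
    using fact_le_power[of "2 * k", where 'a = real]
    by (intro mult_mono) (auto simp: exp_of_nat2_mult)
  also have "\<dots> = (real k) ^ k * (2 * (4 * exp c * k) ^ k)"
  proof -
    have "(2 * real k) ^ (2 * k) = (4 * (real k * real k)) ^ k"
      by (simp add: power_mult power2_eq_square)
    then show ?thesis by (simp add: power_mult_distrib mult_ac)
  qed
  finally show ?thesis using k by (simp add: mult_le_cancel_left_pos)
qed

lemma expectation_trace_power_two_point_le:
  assumes r: "0 < r" and k: "0 < k"
  shows "edge_expectation r (\<lambda>_. 1 / 3) (\<lambda>\<omega>. trace_power r (symmat (\<lambda>e. two_point (\<omega> e))) (2 * k))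
    \<le> 2 * real r * (16 / 7) ^ (2 * k) * 384 ^ r * (4 * exp 7 * k) ^ k"
proof -
  let ?E = "edge_expectation r (\<lambda>_. 1 / 3)"
  let ?Q = "\<lambda>(u :: nat \<Rightarrow> int) \<omega>. bilin r (symmat (\<lambda>e. two_point (\<omega> e))) u u / (4 * real r)"
  let ?net = "int_ball r (7 * r)"
  have "?E (\<lambda>\<omega>. trace_power r (symmat (\<lambda>e. two_point (\<omega> e))) (2 * k)) \<le>
      ?E (\<lambda>\<omega>. r * (16 / 7) ^ (2 * k) * (\<Sum>u\<in>?net. ?Q u \<omega> ^ (2 * k)))"
    by (intro integral_mono integrable_edge_pmf trace_power_le_sum_int_ball[OF r] sym_mat_symmat)
  also have "\<dots> = r * (16 / 7) ^ (2 * k) * (\<Sum>u\<in>?net. ?E (\<lambda>\<omega>. ?Q u \<omega> ^ (2 * k)))"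
    by (simp only: integral_mult_right_zero Bochner_Integration.integral_sum integrable_edge_pmf)
  also have "\<dots> \<le> r * (16 / 7) ^ (2 * k) * (\<Sum>u\<in>?net. 2 * (4 * exp 7 * k) ^ k)"
    by (intro mult_left_mono sum_mono subgaussian_even_moment_le finite_set_edge_pmf k
        two_point_quadratic_form_mgf_le r) auto
  also have "\<dots> = r * (16 / 7) ^ (2 * k) * (real (card ?net) * (2 * (4 * exp 7 * k) ^ k))"
    by simp
  also have "\<dots> \<le> r * (16 / 7) ^ (2 * k) * ((3 ^ r * 2 ^ (7 * r)) * (2 * (4 * exp 7 * k) ^ k))"
    by (intro mult_left_mono mult_right_mono card_int_ball_le) auto
  also have "(3 :: real) ^ r * 2 ^ (7 * r) = 384 ^ r"
    by (simp add: power_mult flip: power_mult_distrib)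
  finally show ?thesis by (simp add: mult_ac)
qed

section \<open>The spectral norm of a centred adjacency matrix\<close>

definition adjacency :: "(nat \<times> nat \<Rightarrow> bool) \<Rightarrow> nat \<Rightarrow> nat \<Rightarrow> real" where
  "adjacency \<omega> = symmat (\<lambda>e. of_bool (\<omega> e))"

definition centered_adjacency :: "(nat \<times> nat \<Rightarrow> real) \<Rightarrow> (nat \<times> nat \<Rightarrow> bool) \<Rightarrow> nat \<Rightarrow> nat \<Rightarrow> real" where
  "centered_adjacency P \<omega> = symmat (\<lambda>e. of_bool (\<omega> e) - P e)"

lemma abs_centered_bernoulli_moment_le:
  assumes p: "0 \<le> p" "p \<le> 1" and k: "2 \<le> k"
  shows "\<bar>measure_pmf.expectation (bernoulli_pmf p) (\<lambda>v. (of_bool v - p) ^ k)\<bar> \<le> p"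
proof -
  obtain l where l: "k = Suc l" "1 \<le> l" using k by (cases k) auto
  have "\<bar>measure_pmf.expectation (bernoulli_pmf p) (\<lambda>v. (of_bool v - p) ^ k)\<bar> =
      \<bar>(1 - p) ^ k * p + (- p) ^ k * (1 - p)\<bar>" using p by simp
  also have "\<dots> \<le> (1 - p) ^ k * p + p ^ k * (1 - p)"
    using p by (intro order_trans[OF abs_triangle_ineq]) (auto simp: abs_mult power_abs)
  also have "\<dots> = p * (1 - p) * ((1 - p) ^ l + p ^ l)" by (simp add: l algebra_simps)
  also have "\<dots> \<le> p * (1 - p) * ((1 - p) ^ 1 + p ^ 1)"
    using p l by (intro mult_left_mono add_mono power_decreasing) auto
  also have "\<dots> \<le> p * 1" using p by (simp add: mult_left_le)
  finally show ?thesis by simp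
qed

lemma expectation_trace_power_centered_le:
  assumes k: "0 < k" "real n * \<pi> + k \<le> r" and \<pi>: "0 \<le> \<pi>" "\<pi> \<le> 1"
    and P: "\<And>e. e \<in> pairs n \<Longrightarrow> 0 \<le> P e \<and> P e \<le> \<pi>"
  shows "edge_expectation n P (\<lambda>\<omega>. trace_power n (centered_adjacency P \<omega>) (2 * k))
    \<le> 2 * real n * (16 / 7) ^ (2 * k) * 384 ^ r * (4 * exp 7 * k) ^ k"
proof -
  have "0 \<le> real n * \<pi>" using \<pi> by simp
  with k have r: "0 < r" by linarith
  have "edge_expectation n P (\<lambda>\<omega>. trace_power n (symmat (\<lambda>e. of_bool (\<omega> e) - P e)) (2 * k)) \<le>
      real n / real r * edge_expectation r (\<lambda>_. 1 / 3)
        (\<lambda>\<omega>. trace_power r (symmat (\<lambda>e. two_point (\<omega> e))) (2 * k))"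
  proof (rule expectation_trace_power_compare[OF r k(2) \<pi>])
    fix e assume e: "e \<in> pairs n"
    have p: "0 \<le> P e" "P e \<le> 1" using P[OF e] \<pi> by auto
    show "entry_moment P (\<lambda>e v. of_bool v - P e) e 1 = 0"
      using p by (simp add: entry_moment_def algebra_simps)
    show "\<bar>entry_moment P (\<lambda>e v. of_bool v - P e) e k\<bar> \<le> \<pi>" if "2 \<le> k" for k
      using abs_centered_bernoulli_moment_le[OF p that] P[OF e] unfolding entry_moment_def
      by linarith
  qed (use entry_moment_two_point_1 entry_moment_two_point_ge_1 in auto)
  also have "\<dots> \<le> real n / real r * (2 * real r * (16 / 7) ^ (2 * k) * 384 ^ r * (4 * exp 7 * k) ^ k)"
    by (intro mult_left_mono expectation_trace_power_two_point_le r k(1)) auto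
  also have "\<dots> = 2 * real n * (16 / 7) ^ (2 * k) * 384 ^ r * (4 * exp 7 * k) ^ k"
    using r by simp
  finally show ?thesis unfolding centered_adjacency_def .
qed

definition moment_growth :: "real \<Rightarrow> real" where
  "moment_growth \<alpha> = (16 / 7)\<^sup>2 * 384 powr (\<alpha> + 2) * (4 * exp 7)"

lemma moment_growth_pos: "0 < moment_growth \<alpha>"
  by (simp add: moment_growth_def)

lemma expectation_trace_power_centered_le_power:
  fixes \<alpha> :: real
  assumes k: "0 < k" and \<pi>: "0 \<le> \<pi>" "\<pi> \<le> 1" "real n * \<pi> \<le> \<alpha> * k"
    and P: "\<And>e. e \<in> pairs n \<Longrightarrow> 0 \<le> P e \<and> P e \<le> \<pi>"
  shows "edge_expectation n P (\<lambda>\<omega>. trace_power n (centered_adjacency P \<omega>) (2 * k))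
    \<le> 2 * real n * (moment_growth \<alpha> * k) ^ k"
proof -
  define r where "r = nat \<lceil>\<alpha> * k\<rceil> + k"
  have \<alpha>k: "0 \<le> \<alpha> * k" using \<pi> by (intro order_trans[OF _ \<pi>(3)]) simp
  have r_ge: "real n * \<pi> + k \<le> r"
    using order_trans[OF \<pi>(3) le_of_int_ceiling] \<alpha>k by (simp add: r_def)
  have "real r \<le> \<alpha> * k + 1 + k" using \<alpha>k by (simp add: r_def)
  then have r_le: "real r \<le> (\<alpha> + 2) * k" using k by (simp add: algebra_simps)
  have "384 ^ r = 384 powr (real r)" by (simp add: powr_realpow)
  also have "\<dots> \<le> 384 powr ((\<alpha> + 2) * k)" using r_le by (intro powr_mono) auto
  also have "\<dots> = (384 powr (\<alpha> + 2)) ^ k" by (simp add: powr_powr[symmetric] powr_realpow)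
  finally have r_power: "384 ^ r \<le> (384 powr (\<alpha> + 2)) ^ k" .
  have "edge_expectation n P (\<lambda>\<omega>. trace_power n (centered_adjacency P \<omega>) (2 * k))
      \<le> 2 * real n * (16 / 7) ^ (2 * k) * 384 ^ r * (4 * exp 7 * k) ^ k"
    by (rule expectation_trace_power_centered_le[OF k r_ge \<pi>(1,2) P])
  also have "\<dots> \<le> 2 * real n * (16 / 7) ^ (2 * k) * (384 powr (\<alpha> + 2)) ^ k * (4 * exp 7 * k) ^ k"
    by (intro mult_left_mono mult_right_mono r_power) auto
  also have "\<dots> = 2 * real n * (moment_growth \<alpha> * k) ^ k"
    unfolding power_mult[of "16 / 7"] by (simp add: moment_growth_def power_mult_distrib mult_ac)
  finally show ?thesis .
qed

lemma prob_spectral_norm_gt_le: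
  fixes M :: "(nat \<times> nat \<Rightarrow> bool) \<Rightarrow> nat \<Rightarrow> nat \<Rightarrow> real"
  assumes sym: "\<And>\<omega>. sym_mat n (M \<omega>)" and t: "0 < t"
  shows "edge_prob n P {\<omega>. t < spectral_norm n (M \<omega>)} \<le>
    edge_expectation n P (\<lambda>\<omega>. trace_power n (M \<omega>) (2 * 2 ^ s)) / t ^ (2 * 2 ^ s)"
proof -
  let ?T = "\<lambda>\<omega>. trace_power n (M \<omega>) (2 * 2 ^ s)"
  have T_nonneg: "0 \<le> ?T \<omega>" for \<omega>
    by (subst trace_power_double[OF sym]) (auto intro: sum_nonneg)
  have "t ^ (2 * 2 ^ s) \<le> ?T \<omega>" if "t < spectral_norm n (M \<omega>)" for \<omega>
    using spectral_norm_le_of_trace_power_le[OF sym, of t \<omega> s] that t by fastforce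
  then have "edge_prob n P {\<omega>. t < spectral_norm n (M \<omega>)} \<le> edge_prob n P {\<omega>. t ^ (2 * 2 ^ s) \<le> ?T \<omega>}"
    by (intro measure_pmf.finite_measure_mono) auto
  also have "\<dots> \<le> edge_expectation n P ?T / t ^ (2 * 2 ^ s)"
    using T_nonneg
      integral_Markov_inequality_measure[of "measure_pmf (edge_pmf n P)" ?T UNIV "t ^ (2 * 2 ^ s)"] t by simp
  finally show ?thesis .
qed

lemma prob_spectral_norm_centered_gt_le:
  fixes s :: nat and \<alpha> c :: real
  defines "k \<equiv> 2 ^ s :: nat"
  assumes \<pi>: "0 \<le> \<pi>" "\<pi> \<le> 1" "real n * \<pi> \<le> \<alpha> * k"
    and P: "\<And>e. e \<in> pairs n \<Longrightarrow> 0 \<le> P e \<and> P e \<le> \<pi>"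
  shows "edge_prob n P
      {\<omega>. sqrt (moment_growth \<alpha> * exp c * k) < spectral_norm n (centered_adjacency P \<omega>)}
    \<le> 2 * real n * exp (- (c * k))"
proof -
  define t where "t = sqrt (moment_growth \<alpha> * exp c * k)"
  have k: "0 < k" by (simp add: k_def)
  have t: "0 < t" using k moment_growth_pos by (simp add: t_def)
  have base: "moment_growth \<alpha> * k \<noteq> 0" using k moment_growth_pos[of \<alpha>] by simp
  have "edge_prob n P {\<omega>. t < spectral_norm n (centered_adjacency P \<omega>)} \<le>
      edge_expectation n P (\<lambda>\<omega>. trace_power n (centered_adjacency P \<omega>) (2 * k)) / t ^ (2 * k)"
    unfolding k_def by (rule prob_spectral_norm_gt_le[OF _ t]) (simp add: centered_adjacency_def)
  also have "\<dots> \<le> 2 * real n * (moment_growth \<alpha> * k) ^ k / t ^ (2 * k)"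
    using t by (intro divide_right_mono expectation_trace_power_centered_le_power[OF k \<pi> P]) auto
  also have "t ^ (2 * k) = (moment_growth \<alpha> * k) ^ k * exp (c * k)"
    unfolding t_def power_mult using moment_growth_pos[of \<alpha>]
    by (simp add: power_mult_distrib exp_of_nat2_mult)
  also have "2 * real n * (moment_growth \<alpha> * k) ^ k / ((moment_growth \<alpha> * k) ^ k * exp (c * k))
      = 2 * real n * exp (- (c * k))"
    using base by (simp add: exp_minus divide_inverse)
  finally show ?thesis unfolding t_def .
qed

lemma ex_power_of_two_between:
  fixes x :: real
  assumes "1 \<le> x"
  obtains s :: nat where "x \<le> 2 ^ s" "2 ^ s \<le> 2 * x"
proof -
  obtain m :: nat where m: "x < 2 ^ m" using real_arch_pow[of 2 x] by auto
  define s where "s = (LEAST s. x \<le> 2 ^ s)"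
  have s: "x \<le> 2 ^ s" unfolding s_def by (rule LeastI[of _ m]) (use m in simp)
  have "2 ^ s \<le> 2 * x"
  proof (cases s)
    case (Suc t)
    then have "\<not> x \<le> 2 ^ t" using not_less_Least[of t "\<lambda>s. x \<le> 2 ^ s"] by (simp add: s_def)
    then show ?thesis by (simp add: Suc)
  qed (use assms in simp)
  with s that show ?thesis by blast
qed

theorem ex_spectral_norm_centered_tail:
  fixes a :: real
  assumes a: "0 < a"
  shows "\<exists>C>0. \<forall>n P. 3 \<le> n \<longrightarrow> a * ln n / n \<le> 1 \<longrightarrow>
    (\<forall>e\<in>pairs n. 0 \<le> P e \<and> P e \<le> a * ln n / n) \<longrightarrow>
    edge_prob n P {\<omega>. C * sqrt (ln n) < spectral_norm n (centered_adjacency P \<omega>)}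
        \<le> 2 * real n powr (-3)"
proof (intro exI[of _ "sqrt (2 * (moment_growth a * exp 4))"] conjI allI impI)
  let ?G = "moment_growth a * exp 4"
  have G: "0 < ?G" using moment_growth_pos by simp
  then show "0 < sqrt (2 * ?G)" by simp
  fix n :: nat and P :: "nat \<times> nat \<Rightarrow> real"
  assume n: "3 \<le> n" and p: "a * ln n / n \<le> 1" and P: "\<forall>e\<in>pairs n. 0 \<le> P e \<and> P e \<le> a * ln n / n"
  have "exp 1 \<le> real n" using exp_le n by linarith
  then have ln_n: "1 \<le> ln n" using n by (subst ln_ge_iff) auto
  from ex_power_of_two_between[OF ln_n] obtain s where s: "ln n \<le> 2 ^ s" "2 ^ s \<le> 2 * ln n" .
  have "?G * 2 ^ s \<le> ?G * (2 * ln n)" using s G by (intro mult_left_mono) auto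
  then have threshold: "sqrt (?G * 2 ^ s) \<le> sqrt (2 * ?G) * sqrt (ln n)"
    by (simp flip: real_sqrt_mult add: mult_ac)
  have "edge_prob n P {\<omega>. sqrt (2 * ?G) * sqrt (ln n) < spectral_norm n (centered_adjacency P \<omega>)} \<le>
      edge_prob n P {\<omega>. sqrt (?G * 2 ^ s) < spectral_norm n (centered_adjacency P \<omega>)}"
    using threshold by (intro measure_pmf.finite_measure_mono) auto
  also have "\<dots> \<le> 2 * real n * exp (- (4 * 2 ^ s))"
    using prob_spectral_norm_centered_gt_le[of "a * ln n / real n" n a s P 4] a ln_n n p P s by simp
  also have "\<dots> \<le> 2 * real n * exp (- (4 * ln n))" using s by (intro mult_left_mono) auto
  also have "\<dots> = 2 * (real n powr 1 * real n powr (- 4))" using n by (simp add: powr_def)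
  also have "real n powr 1 * real n powr (- 4) = real n powr (- 3)" unfolding powr_add[symmetric]
    by simp
  finally show "edge_prob n P
      {\<omega>. sqrt (2 * ?G) * sqrt (ln n) < spectral_norm n (centered_adjacency P \<omega>)}
      \<le> 2 * real n powr (- 3)" .
qed

section \<open>Gram representations of positive semidefinite matrices\<close>

lemma psd_n_iff: "psd_n n Z \<longleftrightarrow> sym_mat n Z \<and> (\<forall>x. 0 \<le> bilin n Z x x)"
  by (auto simp: psd_n_def sym_mat_def bilin_def)

lemma bilin_Suc:
  assumes "sym_mat (Suc n) Z"
  shows "bilin (Suc n) Z x x = bilin n Z x x + 2 * x n * (\<Sum>j<n. Z n j * x j) + Z n n * (x n)\<^sup>2"
proof -
  have "(\<Sum>i<n. x i * Z i n * x n) = (\<Sum>i<n. x n * Z n i * x i)"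
    by (intro sum.cong refl) (use sym_matD[OF assms, of _ n] in simp)
  then show ?thesis
    by (simp add: bilin_def sum.distrib sum_distrib_left power2_eq_square mult_ac)
qed

lemma psd_n_Suc_nonneg:
  assumes "psd_n (Suc n) Z"
  shows "0 \<le> bilin n Z x x + 2 * t * (\<Sum>j<n. Z n j * x j) + Z n n * t\<^sup>2"
proof -
  have "0 \<le> bilin (Suc n) Z (x(n := t)) (x(n := t))" using assms by (simp add: psd_n_iff)
  also have "\<dots> = bilin n Z (x(n := t)) (x(n := t)) +
      2 * t * (\<Sum>j<n. Z n j * (x(n := t)) j) + Z n n * t\<^sup>2"
    using assms by (subst bilin_Suc) (auto simp: psd_n_iff)
  also have "bilin n Z (x(n := t)) (x(n := t)) = bilin n Z x x" by (simp add: bilin_def)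
  also have "(\<Sum>j<n. Z n j * (x(n := t)) j) = (\<Sum>j<n. Z n j * x j)" by simp
  finally show ?thesis .
qed

lemma psd_n_Suc_diag_nonneg:
  assumes "psd_n (Suc n) Z"
  shows "0 \<le> Z n n"
  using psd_n_Suc_nonneg[OF assms, of "\<lambda>_. 0" 1] by (simp add: bilin_def)

lemma psd_n_Suc_eq_0_of_diag_eq_0:
  assumes psd: "psd_n (Suc n) Z" and zero: "Z n n = 0" and i: "i < n"
  shows "Z n i = 0"
proof (rule ccontr)
  assume nonzero: "Z n i \<noteq> 0"
  have "bilin n Z (indicator {i}) (indicator {i}) = Z i i"
    using i
    by (simp only: bilin_eq_sum_mat_vec mat_vec_def
        sum_mult_indicator_singleton sum_indicator_singleton_mult)
  then have "0 \<le> Z i i + 2 * t * Z n i" for t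
    using psd_n_Suc_nonneg[OF psd, of "indicator {i}" t]
    by (simp only: zero sum_mult_indicator_singleton[OF i])
  from this[of "- (Z i i + 1) / (2 * Z n i)"] show False using nonzero by (simp add: field_simps)
qed

lemma psd_n_schur_complement:
  assumes psd: "psd_n (Suc n) Z"
  shows "psd_n n (\<lambda>i j. Z i j - Z i n * Z n j / Z n n)"
  unfolding psd_n_iff
proof (intro conjI allI)
  have sym: "Z i j = Z j i" if "i < Suc n" "j < Suc n" for i j
    using psd that by (auto simp: psd_n_iff intro: sym_matD)
  show "sym_mat n (\<lambda>i j. Z i j - Z i n * Z n j / Z n n)"
    unfolding sym_mat_def
  proof (intro allI impI)
    fix i j assume "i < n" "j < n"
    then show "Z i j - Z i n * Z n j / Z n n = Z j i - Z j n * Z n i / Z n n"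
      using sym[of i j] sym[of i n] sym[of j n] by simp
  qed
  fix x
  define w where "w = (\<Sum>j<n. Z n j * x j)"
  have w': "(\<Sum>i<n. x i * Z i n) = w"
    unfolding w_def by (intro sum.cong refl) (use sym[of _ n] in simp)
  have "bilin n (\<lambda>i j. Z i j - Z i n * Z n j / Z n n) x x =
      bilin n Z x x - (\<Sum>i<n. \<Sum>j<n. (x i * Z i n) * (Z n j * x j)) / Z n n"
    by (simp add: bilin_def algebra_simps sum_subtractf sum_divide_distrib)
  also have "(\<Sum>i<n. \<Sum>j<n. (x i * Z i n) * (Z n j * x j)) = w * w"
    unfolding sum_product[symmetric] w' by (simp add: w_def)
  also have "bilin n Z x x - w * w / Z n n =
      bilin n Z x x + 2 * (- w / Z n n) * w + Z n n * (- w / Z n n)\<^sup>2"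
    by (simp add: power2_eq_square field_simps)
  finally show "0 \<le> bilin n (\<lambda>i j. Z i j - Z i n * Z n j / Z n n) x x"
    using psd_n_Suc_nonneg[OF psd, of x "- w / Z n n"] by (simp add: w_def)
qed

text \<open>By Schur complements; a zero pivot is harmless because its row vanishes and \<open>x / 0 = 0\<close>.\<close>

lemma psd_n_gram:
  assumes "psd_n n Z"
  shows "\<exists>v. \<forall>i<n. \<forall>j<n. Z i j = (\<Sum>m<n. v m i * v m j)"
  using assms
proof (induction n arbitrary: Z)
  case (Suc n)
  define z where "z = Z n n"
  have z: "0 \<le> z" unfolding z_def by (rule psd_n_Suc_diag_nonneg[OF Suc.prems])
  have sym: "Z i j = Z j i" if "i < Suc n" "j < Suc n" for i j
    using Suc.prems that by (auto simp: psd_n_iff intro: sym_matD)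
  have zero: "Z n i = 0" if "z = 0" "i < n" for i
    using psd_n_Suc_eq_0_of_diag_eq_0[OF Suc.prems] that by (simp add: z_def)
  obtain v where v: "\<And>i j. i < n \<Longrightarrow> j < n \<Longrightarrow> Z i j - Z i n * Z n j / z = (\<Sum>m<n. v m i * v m j)"
    using Suc.IH[OF psd_n_schur_complement[OF Suc.prems]] unfolding z_def by blast
  define v' where "v' m j = (if m < n then (if j < n then v m j else 0) else Z n j / sqrt z)"
    for m j
  have "Z i j = (\<Sum>m<Suc n. v' m i * v' m j)" if ij: "i < Suc n" "j < Suc n" for i j
  proof -
    have pivot: "(\<Sum>m<Suc n. v' m i * v' m j) = (\<Sum>m<n. v' m i * v' m j) + Z n i * Z n j / z"
      using z by (simp add: v'_def)
    show ?thesis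
    proof (cases "i < n \<and> j < n")
      case True
      then have "(\<Sum>m<n. v' m i * v' m j) = Z i j - Z i n * Z n j / z"
        by (simp add: v v'_def)
      then show ?thesis unfolding pivot using sym[of i n] ij by simp
    next
      case False
      then have "(\<Sum>m<n. v' m i * v' m j) = 0" by (auto simp: v'_def intro!: sum.neutral)
      moreover have "Z n i * Z n j / z = Z i j"
        using False ij sym[of i j] zero[of i] zero[of j]
        by (cases "z = 0") (auto simp: z_def less_Suc_eq)
      ultimately show ?thesis unfolding pivot by simp
    qed
  qed
  then show ?case by blast
qed simp

section \<open>Dual certificates\<close>

lemma inner_n_gram:
  assumes "\<forall>i<n. \<forall>j<n. Z i j = (\<Sum>m<n. v m i * v m j)"
  shows "inner_n n S Z = (\<Sum>m<n. bilin n S (v m) (v m))"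
proof -
  have "inner_n n S Z = (\<Sum>i<n. \<Sum>j<n. \<Sum>m<n. v m i * S i j * v m j)"
    unfolding inner_n_def by (intro sum.cong refl) (auto simp: assms sum_distrib_left mult_ac)
  also have "\<dots> = (\<Sum>i<n. \<Sum>m<n. \<Sum>j<n. v m i * S i j * v m j)"
    by (intro sum.cong refl sum.swap)
  also have "\<dots> = (\<Sum>m<n. bilin n S (v m) (v m))"
    unfolding bilin_def by (rule sum.swap)
  finally show ?thesis .
qed

lemma inner_n_nonneg:
  "(\<And>i j. i < n \<Longrightarrow> j < n \<Longrightarrow> 0 \<le> B i j \<and> 0 \<le> Z i j) \<Longrightarrow> 0 \<le> inner_n n B Z"
  unfolding inner_n_def by (intro sum_nonneg) auto

lemma inner_n_eq_0D:
  assumes nonneg: "\<And>i j. i < n \<Longrightarrow> j < n \<Longrightarrow> 0 \<le> B i j \<and> 0 \<le> Z i j"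
    and "inner_n n B Z = 0" "i < n" "j < n"
  shows "B i j * Z i j = 0"
proof -
  have "(\<Sum>j<n. B i j * Z i j) = 0"
    using assms unfolding inner_n_def by (subst (asm) sum_nonneg_eq_0_iff) (auto intro!: sum_nonneg)
  then show ?thesis
    using assms by (subst (asm) sum_nonneg_eq_0_iff) auto
qed

lemma inner_n_Id: "inner_n n (Id_n n) Z = (\<Sum>i<n. Z i i)"
proof -
  have "(\<Sum>j<n. Id_n n i j * Z i j) = Z i i" if "i < n" for i
    using that by (simp add: Id_n_def if_distrib[of "\<lambda>c. c * _"] cong: if_cong conj_cong)
  then show ?thesis by (simp add: inner_n_def)
qed

lemma inner_n_J: "inner_n n (J_n n) Z = (\<Sum>i<n. \<Sum>j<n. Z i j)"
  by (simp add: inner_n_def J_n_def)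

definition dual_slack ::
    "real \<Rightarrow> real \<Rightarrow> (nat \<Rightarrow> nat \<Rightarrow> real) \<Rightarrow> (nat \<Rightarrow> nat \<Rightarrow> real) \<Rightarrow> (nat \<Rightarrow> real) \<Rightarrow> nat \<Rightarrow> nat \<Rightarrow> real" where
  "dual_slack \<eta> lam A B d = (\<lambda>i j. (if i = j then d i + \<eta> else 0) - B i j - A i j + lam)"

lemma sdp2_objective_eq_dual_slack:
  "sdp2_objective n \<eta> lam A Z
      = (\<Sum>i<n. d i * Z i i) - inner_n n B Z - inner_n n (dual_slack \<eta> lam A B d) Z"
proof -
  have row: "(\<Sum>j<n. dual_slack \<eta> lam A B d i j * Z i j) = d i * Z i i + \<eta> * Z i i
      - (\<Sum>j<n. B i j * Z i j) - (\<Sum>j<n. A i j * Z i j) + lam * (\<Sum>j<n. Z i j)" if "i < n" for i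
  proof -
    have "(\<Sum>j<n. dual_slack \<eta> lam A B d i j * Z i j) =
        (\<Sum>j<n. (if i = j then (d i + \<eta>) * Z i j else 0)
          - B i j * Z i j - A i j * Z i j + lam * Z i j)"
      by (intro sum.cong refl) (auto simp: dual_slack_def algebra_simps)
    then show ?thesis using that
      by (simp add: sum.distrib sum_subtractf sum_distrib_left distrib_right)
  qed
  have "inner_n n (dual_slack \<eta> lam A B d) Z = (\<Sum>i<n. d i * Z i i + \<eta> * Z i i
      - (\<Sum>j<n. B i j * Z i j) - (\<Sum>j<n. A i j * Z i j) + lam * (\<Sum>j<n. Z i j))"
    unfolding inner_n_def by (intro sum.cong refl row) simp
  then have "inner_n n (dual_slack \<eta> lam A B d) Z = (\<Sum>i<n. d i * Z i i) + \<eta> * (\<Sum>i<n. Z i i)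
      - inner_n n B Z - inner_n n A Z + lam * (\<Sum>i<n. \<Sum>j<n. Z i j)"
    by (simp only: sum.distrib sum_subtractf sum_distrib_left inner_n_def)
  then show ?thesis by (simp add: sdp2_objective_def inner_n_Id inner_n_J)
qed

locale clustering =
  fixes n r :: nat and K :: "nat \<Rightarrow> nat" and C :: "nat \<Rightarrow> nat set"
  assumes valid: "valid_clusters n r K C"
begin

text \<open>Outliers get the label 0.\<close>

definition label :: "nat \<Rightarrow> nat" where
  "label j = (\<Sum>k\<in>{1..r}. if j \<in> C k then k else 0)"

lemma cluster_subset: "k \<in> {1..r} \<Longrightarrow> C k \<subseteq> {..<n}"
  and card_cluster: "k \<in> {1..r} \<Longrightarrow> card (C k) = K k"
  using valid by (auto simp: valid_clusters_def)

lemma finite_cluster: "k \<in> {1..r} \<Longrightarrow> finite (C k)"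
  using cluster_subset by (rule finite_subset) auto

lemma cluster_unique: "k \<in> {1..r} \<Longrightarrow> l \<in> {1..r} \<Longrightarrow> j \<in> C k \<Longrightarrow> j \<in> C l \<Longrightarrow> k = l"
  using valid unfolding valid_clusters_def by blast

lemma label_eq:
  assumes "k \<in> {1..r}" "j \<in> C k"
  shows "label j = k"
proof -
  have "j \<in> C l \<longleftrightarrow> l = k" if "l \<in> {1..r}" for l
    using cluster_unique[OF that assms(1)] assms(2) by blast
  then have "label j = (\<Sum>l\<in>{1..r}. if l = k then l else 0)"
    unfolding label_def by (intro sum.cong refl) auto
  then show ?thesis using assms by simp
qed

lemma label_nonzero:
  assumes "label j \<noteq> 0"
  shows "label j \<in> {1..r}" "j \<in> C (label j)"
proof -
  obtain k where k: "k \<in> {1..r}" "j \<in> C k"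
    using assms by (auto simp: label_def split: if_splits)
  then show "label j \<in> {1..r}" "j \<in> C (label j)" by (simp_all only: label_eq[OF k])
qed

lemma label_eq_iff: "k \<in> {1..r} \<Longrightarrow> label j = k \<longleftrightarrow> j \<in> C k"
  by (metis atLeastAtMost_iff label_eq label_nonzero(2) not_one_le_zero)

lemma same_cluster_iff: "same_cluster r C i j \<longleftrightarrow> label i = label j \<and> label i \<noteq> 0"
  unfolding same_cluster_def by (metis atLeastAtMost_iff label_eq label_nonzero not_one_le_zero)

lemma cluster_matrix_eq: "cluster_matrix r C i j = (if same_cluster r C i j then 1 else 0)"
proof -
  have "cluster_matrix r C i j = (\<Sum>k\<in>{1..r}. if k = label i then of_bool (label i = label j) else 0)"
    unfolding cluster_matrix_def
    by (intro sum.cong refl) (auto simp: indicator_def simp flip: label_eq_iff)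
  also have "\<dots> = (if same_cluster r C i j then 1 else 0)"
    using label_nonzero[of i] by (auto simp: same_cluster_iff)
  finally show ?thesis .
qed

lemma sum_mult_indicator_cluster:
  fixes f :: "nat \<Rightarrow> real"
  assumes "k \<in> {1..r}"
  shows "(\<Sum>j<n. f j * indicator (C k) j) = (\<Sum>j\<in>C k. f j)"
  using cluster_subset[OF assms]
  by (intro sum.mono_neutral_cong_right) (auto simp: indicator_def)

lemma sum_label_mult:
  fixes c y :: "nat \<Rightarrow> real"
  assumes "c 0 = 0"
  shows "(\<Sum>j<n. c (label j) * y j) = (\<Sum>k\<in>{1..r}. c k * (\<Sum>j\<in>C k. y j))"
proof -
  have "c (label j) * y j = (\<Sum>k\<in>{1..r}. c k * (y j * indicator (C k) j))" for j
  proof -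
    have "(\<Sum>k\<in>{1..r}. c k * (y j * indicator (C k) j))
        = (\<Sum>k\<in>{1..r}. if k = label j then c k * y j else 0)"
      by (intro sum.cong refl) (auto simp: indicator_def simp flip: label_eq_iff)
    then show ?thesis using label_nonzero[of j] assms by (cases "label j = 0") auto
  qed
  then have "(\<Sum>j<n. c (label j) * y j) = (\<Sum>k\<in>{1..r}. \<Sum>j<n. c k * (y j * indicator (C k) j))"
    by (simp add: sum.swap[of _ "{..<n}"])
  also have "\<dots> = (\<Sum>k\<in>{1..r}. c k * (\<Sum>j\<in>C k. y j))"
    by (intro sum.cong refl) (simp only: sum_distrib_left[symmetric] sum_mult_indicator_cluster)
  finally show ?thesis .
qed

lemma inner_n_cluster_matrix:
  "inner_n n M (cluster_matrix r C) = (\<Sum>k\<in>{1..r}. \<Sum>i\<in>C k. \<Sum>j\<in>C k. M i j)"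
proof -
  have "inner_n n M (cluster_matrix r C) =
      (\<Sum>i<n. \<Sum>j<n. \<Sum>k\<in>{1..r}. M i j * indicator (C k) j * indicator (C k) i)"
    by (simp only: inner_n_def cluster_matrix_def sum_distrib_left mult_ac)
  also have "\<dots> = (\<Sum>i<n. \<Sum>k\<in>{1..r}. \<Sum>j<n. M i j * indicator (C k) j * indicator (C k) i)"
    by (intro sum.cong refl sum.swap)
  also have "\<dots> = (\<Sum>k\<in>{1..r}. \<Sum>i<n. \<Sum>j<n. M i j * indicator (C k) j * indicator (C k) i)"
    by (rule sum.swap)
  also have "\<dots> = (\<Sum>k\<in>{1..r}. \<Sum>i\<in>C k. \<Sum>j\<in>C k. M i j)"
    by (rule sum.cong) (simp_all only: sum_distrib_right[symmetric] sum_mult_indicator_cluster)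
  finally show ?thesis .
qed

lemma bilin_cluster_matrix: "bilin n (cluster_matrix r C) x x = (\<Sum>k\<in>{1..r}. (\<Sum>j\<in>C k. x j)\<^sup>2)"
proof -
  have "bilin n (cluster_matrix r C) x x = inner_n n (\<lambda>i j. x i * x j) (cluster_matrix r C)"
    by (simp add: bilin_def inner_n_def mult_ac)
  then show ?thesis by (simp add: inner_n_cluster_matrix power2_eq_square sum_product)
qed

lemma cluster_matrix_feasible: "sdp_base_feasible n (cluster_matrix r C)"
proof -
  have "supported_n n (cluster_matrix r C)"
    using cluster_subset by (fastforce simp: supported_n_def cluster_matrix_eq same_cluster_def)
  moreover have "sym_mat n (cluster_matrix r C)"
    by (auto simp: sym_mat_def cluster_matrix_eq same_cluster_iff)
  ultimately show ?thesis
    by (simp add: sdp_base_feasible_def psd_n_iff bilin_cluster_matrix sum_nonneg cluster_matrix_eq)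
qed

lemma inner_n_Id_cluster_matrix: "inner_n n (Id_n n) (cluster_matrix r C) = real (\<Sum>k\<in>{1..r}. K k)"
proof -
  have "(\<Sum>j\<in>C k. Id_n n i j) = 1" if "k \<in> {1..r}" "i \<in> C k" for i k
  proof -
    have "(\<Sum>j\<in>C k. Id_n n i j) = (\<Sum>j\<in>C k. if i = j then 1 else 0)"
      using that cluster_subset by (intro sum.cong refl) (auto simp: Id_n_def)
    then show ?thesis using that finite_cluster by simp
  qed
  then show ?thesis by (simp add: inner_n_cluster_matrix card_cluster)
qed

lemma inner_n_J_cluster_matrix: "inner_n n (J_n n) (cluster_matrix r C) = real (\<Sum>k\<in>{1..r}. (K k)\<^sup>2)"
proof -
  have "(\<Sum>i\<in>C k. \<Sum>j\<in>C k. J_n n i j) = (\<Sum>i\<in>C k. \<Sum>j\<in>C k. 1)" if "k \<in> {1..r}" for k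
    using cluster_subset[OF that] by (intro sum.cong refl) (auto simp: J_n_def)
  then show ?thesis by (simp add: inner_n_cluster_matrix card_cluster power2_eq_square)
qed

lemma unique_maximizer_sdp1_of_sdp2:
  assumes uniq:
    "unique_maximizer (sdp_base_feasible n) (sdp2_objective n \<eta> lam A) (cluster_matrix r C)"
  shows "unique_maximizer (sdp1_feasible n r K) (\<lambda>Z. inner_n n A Z) (cluster_matrix r C)"
  unfolding unique_maximizer_def
proof (intro conjI allI impI)
  let ?Z = "cluster_matrix r C"
  show "sdp1_feasible n r K ?Z"
    by (simp add: sdp1_feasible_def cluster_matrix_feasible
        inner_n_Id_cluster_matrix inner_n_J_cluster_matrix)
  fix Z assume Z: "sdp1_feasible n r K Z \<and> Z \<noteq> ?Z"
  then have "sdp2_objective n \<eta> lam A Z < sdp2_objective n \<eta> lam A ?Z"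
    using uniq by (simp add: sdp1_feasible_def unique_maximizer_def)
  then show "inner_n n A Z < inner_n n A ?Z"
    using Z
    by (simp add: sdp2_objective_def sdp1_feasible_def
        inner_n_Id_cluster_matrix inner_n_J_cluster_matrix)
qed

end

locale dual_certificate = clustering +
  fixes A B :: "nat \<Rightarrow> nat \<Rightarrow> real" and d :: "nat \<Rightarrow> real" and \<eta> lam :: real
  assumes size_pos: "k \<in> {1..r} \<Longrightarrow> 0 < K k"
    and sym_slack: "sym_mat n (dual_slack \<eta> lam A B d)"
    and d_pos: "i < n \<Longrightarrow> label i \<noteq> 0 \<Longrightarrow> 0 < d i"
    and d_outlier: "i < n \<Longrightarrow> label i = 0 \<Longrightarrow> d i = 0"
    and B_nonneg: "i < n \<Longrightarrow> j < n \<Longrightarrow> 0 \<le> B i j"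
    and B_same: "i < n \<Longrightarrow> j < n \<Longrightarrow> label i = label j \<Longrightarrow> B i j = 0"
    and B_pos: "i < n \<Longrightarrow> j < n \<Longrightarrow> label i \<noteq> label j \<Longrightarrow> label i \<noteq> 0 \<Longrightarrow> label j \<noteq> 0 \<Longrightarrow> 0 < B i j"
    and slack_null: "i < n \<Longrightarrow> k \<in> {1..r} \<Longrightarrow> (\<Sum>j\<in>C k. dual_slack \<eta> lam A B d i j) = 0"
    and slack_pos: "(\<And>k. k \<in> {1..r} \<Longrightarrow> (\<Sum>j\<in>C k. y j) = 0) \<Longrightarrow> l2norm n y \<noteq> 0 \<Longrightarrow>
      0 < bilin n (dual_slack \<eta> lam A B d) y y"
begin

abbreviation slack :: "nat \<Rightarrow> nat \<Rightarrow> real" where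
  "slack \<equiv> dual_slack \<eta> lam A B d"

definition cluster_mean :: "(nat \<Rightarrow> real) \<Rightarrow> nat \<Rightarrow> real" where
  "cluster_mean v k = (if k = 0 then 0 else (\<Sum>j\<in>C k. v j) / K k)"

lemma bilin_slack_label_eq_0:
  assumes "c 0 = 0"
  shows "bilin n slack x (\<lambda>j. c (label j)) = 0" "bilin n slack (\<lambda>j. c (label j)) x = 0"
proof -
  have "mat_vec n slack (\<lambda>j. c (label j)) i = 0" if "i < n" for i
    using sum_label_mult[of c "slack i"] assms slack_null[OF that]
    by (simp add: mat_vec_def mult.commute)
  then show "bilin n slack x (\<lambda>j. c (label j)) = 0" by (simp add: bilin_eq_sum_mat_vec)
  then show "bilin n slack (\<lambda>j. c (label j)) x = 0" using bilin_commute[OF sym_slack] by simp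
qed

lemma bilin_slack_residual:
  "bilin n slack v v =
    bilin n slack (\<lambda>i. v i - cluster_mean v (label i)) (\<lambda>i. v i - cluster_mean v (label i))"
proof -
  have "cluster_mean v 0 = 0" by (simp add: cluster_mean_def)
  from bilin_slack_label_eq_0[of "cluster_mean v", OF this] show ?thesis
    unfolding bilin_diff_left bilin_diff_right by simp
qed

lemma sum_residual_eq_0:
  assumes k: "k \<in> {1..r}"
  shows "(\<Sum>j\<in>C k. v j - cluster_mean v (label j)) = 0"
proof -
  have "(\<Sum>j\<in>C k. v j - cluster_mean v (label j)) = (\<Sum>j\<in>C k. v j - cluster_mean v k)"
    by (intro sum.cong refl) (simp add: label_eq[OF k])
  then show ?thesis using k size_pos[OF k]
    by (simp add: sum_subtractf cluster_mean_def card_cluster)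
qed

lemma bilin_slack_nonneg: "0 \<le> bilin n slack v v"
  unfolding bilin_slack_residual[of v]
  using slack_pos[OF sum_residual_eq_0, of v] bilin_eq_0_of_l2norm_eq_0 by force

lemma bilin_slack_eq_0D:
  assumes "bilin n slack v v = 0" "i < n"
  shows "v i = cluster_mean v (label i)"
proof -
  have "l2norm n (\<lambda>i. v i - cluster_mean v (label i)) = 0"
    using slack_pos[OF sum_residual_eq_0, of v] assms(1) unfolding bilin_slack_residual[of v]
    by force
  then show ?thesis using assms(2) by (simp add: L2_set_eq_0_iff)
qed

lemma d_nonneg: "i < n \<Longrightarrow> 0 \<le> d i"
  using d_pos[of i] d_outlier[of i] by (cases "label i = 0") auto

lemma objective_cluster_matrix: "sdp2_objective n \<eta> lam A (cluster_matrix r C) = (\<Sum>i<n. d i)"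
proof -
  have "inner_n n slack (cluster_matrix r C) = 0"
  proof -
    have "(\<Sum>j\<in>C k. slack i j) = 0" if "k \<in> {1..r}" "i \<in> C k" for k i
      using slack_null cluster_subset that by blast
    then show ?thesis by (simp add: inner_n_cluster_matrix)
  qed
  moreover have "inner_n n B (cluster_matrix r C) = 0"
    unfolding inner_n_def
    by (intro sum.neutral ballI) (auto simp: cluster_matrix_eq same_cluster_iff B_same)
  moreover have "(\<Sum>i<n. d i * cluster_matrix r C i i) = (\<Sum>i<n. d i)"
    by (intro sum.cong refl) (auto simp: cluster_matrix_eq same_cluster_iff d_outlier)
  ultimately show ?thesis by (simp add: sdp2_objective_eq_dual_slack[where B = B and d = d])
qed

lemma complementary_slackness:
  assumes Z: "sdp_base_feasible n Z"
    and optimal: "sdp2_objective n \<eta> lam A (cluster_matrix r C) \<le> sdp2_objective n \<eta> lam A Z"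
  shows "inner_n n slack Z = 0" "inner_n n B Z = 0" "(\<Sum>i<n. d i * (1 - Z i i)) = 0"
proof -
  obtain v where v: "\<forall>i<n. \<forall>j<n. Z i j = (\<Sum>m<n. v m i * v m j)"
    using psd_n_gram[of n Z] Z by (auto simp: sdp_base_feasible_def)
  have "0 \<le> inner_n n slack Z"
    unfolding inner_n_gram[OF v] by (intro sum_nonneg bilin_slack_nonneg)
  moreover have "0 \<le> inner_n n B Z"
    by (rule inner_n_nonneg) (use B_nonneg Z in \<open>auto simp: sdp_base_feasible_def\<close>)
  moreover have "0 \<le> (\<Sum>i<n. d i * (1 - Z i i))"
    using Z d_nonneg by (intro sum_nonneg mult_nonneg_nonneg) (auto simp: sdp_base_feasible_def)
  moreover have "(\<Sum>i<n. d i * (1 - Z i i)) + inner_n n B Z + inner_n n slack Z \<le> 0"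
    using optimal sdp2_objective_eq_dual_slack[of n \<eta> lam A Z d B]
    by (simp add: objective_cluster_matrix algebra_simps sum_subtractf)
  ultimately show "inner_n n slack Z = 0" "inner_n n B Z = 0" "(\<Sum>i<n. d i * (1 - Z i i)) = 0"
    by linarith+
qed

lemma optimal_entry_eq:
  assumes Z: "sdp_base_feasible n Z"
    and optimal: "sdp2_objective n \<eta> lam A (cluster_matrix r C) \<le> sdp2_objective n \<eta> lam A Z"
    and ij: "i < n" "j < n"
  shows "Z i j = cluster_matrix r C i j"
proof -
  note slackness = complementary_slackness[OF Z optimal]
  have nonneg: "0 \<le> B i j \<and> 0 \<le> Z i j" if "i < n" "j < n" for i j
    using B_nonneg Z that by (auto simp: sdp_base_feasible_def)
  obtain v where v: "\<forall>i<n. \<forall>j<n. Z i j = (\<Sum>m<n. v m i * v m j)"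
    using psd_n_gram[of n Z] Z by (auto simp: sdp_base_feasible_def)
  have "(\<Sum>m<n. bilin n slack (v m) (v m)) = 0" using slackness(1) by (simp add: inner_n_gram[OF v])
  then have "bilin n slack (v m) (v m) = 0" if "m < n" for m
    using that by (subst (asm) sum_nonneg_eq_0_iff) (auto simp: bilin_slack_nonneg)
  then have v_eq: "v m i = cluster_mean (v m) (label i)" if "m < n" "i < n" for m i
    using bilin_slack_eq_0D that by blast
  consider "label i = 0 \<or> label j = 0" | "label i = label j" "label i \<noteq> 0"
    | "label i \<noteq> label j" "label i \<noteq> 0" "label j \<noteq> 0"
    by auto
  then show ?thesis
  proof cases
    case 1
    then have "Z i j = 0" using ij by (auto simp: v v_eq cluster_mean_def intro!: sum.neutral)
    then show ?thesis using 1 by (auto simp: cluster_matrix_eq same_cluster_iff)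
  next
    case 2
    have "Z i j = Z i i" using ij 2 by (simp add: v v_eq)
    moreover have "d i * (1 - Z i i) = 0"
      using slackness(3) ij d_nonneg Z
      by (subst (asm) sum_nonneg_eq_0_iff) (auto simp: sdp_base_feasible_def)
    ultimately show ?thesis using d_pos[OF ij(1)] 2
      by (simp add: cluster_matrix_eq same_cluster_iff)
  next
    case 3
    then show ?thesis
      using inner_n_eq_0D[OF nonneg slackness(2) ij] B_pos[OF ij]
      by (simp add: cluster_matrix_eq same_cluster_iff)
  qed
qed

theorem unique_maximizer_cluster_matrix:
  "unique_maximizer (sdp_base_feasible n) (sdp2_objective n \<eta> lam A) (cluster_matrix r C)"
  unfolding unique_maximizer_def
proof (intro conjI allI impI cluster_matrix_feasible)
  fix Z assume Z: "sdp_base_feasible n Z \<and> Z \<noteq> cluster_matrix r C"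
  show "sdp2_objective n \<eta> lam A Z < sdp2_objective n \<eta> lam A (cluster_matrix r C)"
  proof (rule ccontr)
    assume "\<not> ?thesis"
    then have "Z i j = cluster_matrix r C i j" if "i < n" "j < n" for i j
      using optimal_entry_eq Z that by auto
    moreover have "Z i j = cluster_matrix r C i j" if "n \<le> i \<or> n \<le> j" for i j
      using Z cluster_matrix_feasible that by (auto simp: sdp_base_feasible_def supported_n_def)
    ultimately have "Z = cluster_matrix r C" by (intro ext) (meson not_le)
    with Z show False by simp
  qed
qed

end

section \<open>Construction of the certificate\<close>

definition row_sum :: "(nat \<Rightarrow> nat \<Rightarrow> real) \<Rightarrow> nat set \<Rightarrow> nat \<Rightarrow> real" where
  "row_sum M T i = (\<Sum>j\<in>T. M i j)"

definition sbm_edge_prob :: "nat \<Rightarrow> (nat \<Rightarrow> nat set) \<Rightarrow> real \<Rightarrow> real \<Rightarrow> nat \<times> nat \<Rightarrow> real" where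
  "sbm_edge_prob r C p q = (\<lambda>(i, j). if same_cluster r C i j then p else q)"

lemma symmat_sbm_edge_prob:
  "symmat (sbm_edge_prob r C p q) i j = (if i = j then 0 else if same_cluster r C i j then p else q)"
  by (auto simp: symmat_def sbm_edge_prob_def same_cluster_def)

lemma bilin_cong:
  "(\<And>i j. i < n \<Longrightarrow> j < n \<Longrightarrow> M i j = N i j) \<Longrightarrow> bilin n M x y = bilin n N x y"
  unfolding bilin_def by (intro sum.cong refl) simp

lemma bilin_mat_add: "bilin n (\<lambda>i j. M i j + N i j) x y = bilin n M x y + bilin n N x y"
  by (simp add: bilin_def algebra_simps sum.distrib)

lemma bilin_mat_diff: "bilin n (\<lambda>i j. M i j - N i j) x y = bilin n M x y - bilin n N x y"
  by (simp add: bilin_def algebra_simps sum_subtractf)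

lemma bilin_mat_scale: "bilin n (\<lambda>i j. c * M i j) x y = c * bilin n M x y"
  by (simp add: bilin_def sum_distrib_left mult_ac)

lemma bilin_mat_const: "bilin n (\<lambda>i j. c) x x = c * (\<Sum>i<n. x i)\<^sup>2"
  by (simp add: bilin_def power2_eq_square sum_product sum_distrib_left mult_ac)

lemma bilin_mat_diag: "bilin n (\<lambda>i j. if i = j then m i else 0) x x = (\<Sum>i<n. m i * (x i)\<^sup>2)"
proof -
  have "(\<Sum>j<n. x i * (if i = j then m i else 0) * x j) = m i * (x i)\<^sup>2" if "i < n" for i
  proof -
    have "(\<Sum>j<n. x i * (if i = j then m i else 0) * x j) = (\<Sum>j<n. if i = j then m i * (x i)\<^sup>2 else 0)"
      by (intro sum.cong refl) (simp add: power2_eq_square)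
    then show ?thesis using that by simp
  qed
  then show ?thesis by (simp add: bilin_def)
qed

context clustering
begin

lemma l2norm_indicator_cluster:
  assumes "k \<in> {1..r}"
  shows "l2norm n (indicator (C k)) = sqrt (K k)"
proof -
  have "(\<Sum>j<n. (indicator (C k) j)\<^sup>2) = (\<Sum>j<n. 1 * indicator (C k) j :: real)"
    by (intro sum.cong refl) (simp add: indicator_def)
  then show ?thesis
    unfolding L2_set_def using sum_mult_indicator_cluster[OF assms, of "\<lambda>_. 1"] card_cluster[OF assms]
    by simp
qed

lemma bilin_indicator_cluster:
  assumes k: "k \<in> {1..r}" and l: "l \<in> {1..r}"
  shows "bilin n M (indicator (C k)) (indicator (C l)) = (\<Sum>i\<in>C k. row_sum M (C l) i)"
  unfolding bilin_eq_sum_mat_vec mat_vec_def sum_mult_indicator_cluster[OF l]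
  using sum_mult_indicator_cluster[OF k, of "row_sum M (C l)"]
  by (simp add: row_sum_def mult.commute)

lemma bilin_mean_matrix_le:
  assumes "0 \<le> p" "0 \<le> q" and y: "\<And>k. k \<in> {1..r} \<Longrightarrow> (\<Sum>j\<in>C k. y j) = 0"
  shows "bilin n (symmat (sbm_edge_prob r C p q)) y y \<le> q * (\<Sum>i<n. y i)\<^sup>2"
proof -
  let ?m = "\<lambda>i. if same_cluster r C i i then p else q"
  have "bilin n (symmat (sbm_edge_prob r C p q)) y y =
      bilin n (\<lambda>i j. (q + (p - q) * cluster_matrix r C i j) - (if i = j then ?m i else 0)) y y"
    by (rule bilin_cong) (auto simp: symmat_sbm_edge_prob cluster_matrix_eq)
  also have "\<dots> = q * (\<Sum>i<n. y i)\<^sup>2 + (p - q) * bilin n (cluster_matrix r C) y y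
      - (\<Sum>i<n. ?m i * (y i)\<^sup>2)"
    unfolding bilin_mat_diff bilin_mat_add bilin_mat_scale bilin_mat_const bilin_mat_diag ..
  also have "bilin n (cluster_matrix r C) y y = 0" by (simp add: bilin_cluster_matrix y)
  also have "q * (\<Sum>i<n. y i)\<^sup>2 + (p - q) * 0 - (\<Sum>i<n. ?m i * (y i)\<^sup>2) \<le> q * (\<Sum>i<n. y i)\<^sup>2"
    using assms(1,2) by (simp add: sum_nonneg)
  finally show ?thesis .
qed

end

lemma mult_sqrt_mult_less:
  fixes t \<delta> x y :: real
  assumes "0 \<le> t" "t < \<delta> * x" "t < \<delta> * y" "0 < x" "0 < y"
  shows "t * (sqrt x * sqrt y) < \<delta> * (x * y)"
proof -
  have "t * t < (\<delta> * x) * (\<delta> * y)"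
    using assms by (intro mult_strict_mono') auto
  then have "t\<^sup>2 < (\<delta> * sqrt (x * y))\<^sup>2"
    using assms by (simp add: power2_eq_square mult_ac)
  moreover have "0 < \<delta>" using assms by (smt (verit) zero_less_mult_iff)
  ultimately have "t < \<delta> * sqrt (x * y)"
    using assms by (intro power_less_imp_less_base[of t 2]) auto
  then have "t * sqrt (x * y) < \<delta> * sqrt (x * y) * sqrt (x * y)"
    using assms by (intro mult_strict_right_mono) auto
  then show ?thesis using assms by (simp add: real_sqrt_mult mult_ac)
qed

locale regular_adjacency = clustering +
  fixes A :: "nat \<Rightarrow> nat \<Rightarrow> real" and p q t \<eta> lam \<delta> :: real and \<theta> :: "nat \<Rightarrow> real"
  assumes sym_A: "sym_mat n A"
    and noise_le: "spectral_norm n (\<lambda>i j. A i j - symmat (sbm_edge_prob r C p q) i j) \<le> t"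
    and p_nonneg: "0 \<le> p" and q_nonneg: "0 \<le> q" and q_le: "q \<le> lam" and t_less: "t < \<eta>"
    and t_less_size: "k \<in> {1..r} \<Longrightarrow> t < \<delta> * K k"
    and degree_within_gt: "k \<in> {1..r} \<Longrightarrow> i \<in> C k \<Longrightarrow> \<eta> + lam * K k < row_sum A (C k) i"
    and degree_across_le: "k \<in> {1..r} \<Longrightarrow> i < n \<Longrightarrow> i \<notin> C k \<Longrightarrow> row_sum A (C k) i \<le> \<theta> k * K k"
    and \<theta>_le: "k \<in> {1..r} \<Longrightarrow> \<theta> k \<le> lam"
    and \<theta>_add_le: "k \<in> {1..r} \<Longrightarrow> l \<in> {1..r} \<Longrightarrow> k \<noteq> l \<Longrightarrow> \<theta> k + \<theta> l + \<delta> \<le> lam + q"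
begin

abbreviation noise_matrix :: "nat \<Rightarrow> nat \<Rightarrow> real" where
  "noise_matrix \<equiv> \<lambda>i j. A i j - symmat (sbm_edge_prob r C p q) i j"

lemma sym_mat_noise: "sym_mat n noise_matrix"
  using sym_A sym_mat_symmat[of n "sbm_edge_prob r C p q"] by (simp add: sym_mat_def)

lemma t_nonneg: "0 \<le> t"
  using noise_le spectral_norm_nonneg order_trans by blast

lemma K_pos: "k \<in> {1..r} \<Longrightarrow> 0 < real (K k)"
  using t_less_size[of k] t_nonneg by (cases "K k = 0") auto

definition cluster_density :: "nat \<Rightarrow> nat \<Rightarrow> real" where
  "cluster_density k l = (\<Sum>i\<in>C k. row_sum A (C l) i) / (K k * K l)"

lemma cluster_density_commute:
  assumes "k \<in> {1..r}" "l \<in> {1..r}"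
  shows "cluster_density k l = cluster_density l k"
  using bilin_commute[OF sym_A, of "indicator (C k)" "indicator (C l)"] assms
  by (simp add: cluster_density_def bilin_indicator_cluster mult.commute)

lemma bilin_noise_cross:
  assumes k: "k \<in> {1..r}" and l: "l \<in> {1..r}" and kl: "k \<noteq> l"
  shows "bilin n noise_matrix (indicator (C k)) (indicator (C l))
      = (cluster_density k l - q) * (K k * K l)"
proof -
  have "(\<Sum>i\<in>C k. row_sum noise_matrix (C l) i) = (\<Sum>i\<in>C k. row_sum A (C l) i - q * K l)"
  proof (intro sum.cong refl)
    fix i assume i: "i \<in> C k"
    have "row_sum noise_matrix (C l) i = (\<Sum>j\<in>C l. A i j - q)"
      unfolding row_sum_def
    proof (intro sum.cong refl)
      fix j assume j: "j \<in> C l"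
      have "label i \<noteq> label j" using kl by (simp add: label_eq[OF k i] label_eq[OF l j])
      then show "A i j - symmat (sbm_edge_prob r C p q) i j = A i j - q"
        by (auto simp: symmat_sbm_edge_prob same_cluster_iff)
    qed
    then show "row_sum noise_matrix (C l) i = row_sum A (C l) i - q * K l"
      by (simp add: sum_subtractf card_cluster[OF l] row_sum_def)
  qed
  also have "\<dots> = (cluster_density k l - q) * (K k * K l)"
    using K_pos[OF k] K_pos[OF l]
    by (simp add: sum_subtractf card_cluster[OF k] cluster_density_def algebra_simps)
  finally show ?thesis by (simp add: bilin_indicator_cluster[OF k l])
qed

lemma cluster_density_gt:
  assumes k: "k \<in> {1..r}" and l: "l \<in> {1..r}" and kl: "k \<noteq> l"
  shows "q - \<delta> < cluster_density k l"
proof -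
  have "\<bar>(cluster_density k l - q) * (K k * K l)\<bar>
      \<le> spectral_norm n noise_matrix * (sqrt (K k) * sqrt (K l))"
    using abs_bilin_le[OF sym_mat_noise, of "indicator (C k)" "indicator (C l)"]
    unfolding bilin_noise_cross[OF assms]
      l2norm_indicator_cluster[OF k] l2norm_indicator_cluster[OF l]
    by (simp only: mult.assoc)
  also have "\<dots> \<le> t * (sqrt (K k) * sqrt (K l))" using noise_le by (intro mult_right_mono) auto
  also have "\<dots> < \<delta> * (K k * K l)"
    using mult_sqrt_mult_less[OF t_nonneg t_less_size[OF k] t_less_size[OF l]] K_pos[OF k] K_pos[OF l]
    by simp
  finally have "- (\<delta> * real (K k * K l)) < (cluster_density k l - q) * real (K k * K l)"
    by linarith
  then have "- \<delta> * real (K k * K l) < (cluster_density k l - q) * real (K k * K l)" by simp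
  then have "- \<delta> < cluster_density k l - q"
    using K_pos[OF k] K_pos[OF l] by (subst (asm) mult_less_cancel_right_pos) auto
  then show ?thesis by simp
qed

definition dual_half :: "nat \<Rightarrow> nat \<Rightarrow> real" where
  "dual_half i k = (if k = 0 \<or> k = label i then 0
    else (if label i = 0 then lam else (lam + cluster_density (label i) k) / 2)
      - row_sum A (C k) i / K k)"

text \<open>Each term depends on one of its two indices only through the label, so the quadratic form
  vanishes on the vectors that sum to 0 over each cluster.\<close>

definition cross_dual :: "nat \<Rightarrow> nat \<Rightarrow> real" where
  "cross_dual i j = dual_half i (label j) + dual_half j (label i)"

definition dual_diag :: "nat \<Rightarrow> real" where
  "dual_diag i = (if label i = 0 then 0 else row_sum A (C (label i)) i - \<eta> - lam * K (label i))"

abbreviation certificate :: "nat \<Rightarrow> nat \<Rightarrow> real" where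
  "certificate \<equiv> dual_slack \<eta> lam A cross_dual dual_diag"

lemma dual_half_0 [simp]: "dual_half i 0 = 0"
  by (simp add: dual_half_def)

lemma cross_dual_same: "label i = label j \<Longrightarrow> cross_dual i j = 0"
  by (simp add: cross_dual_def dual_half_def)

lemma cross_dual_of_clustered:
  assumes "label i \<noteq> 0" "label j \<noteq> 0" "label i \<noteq> label j"
  shows "cross_dual i j = lam + cluster_density (label i) (label j)
    - row_sum A (C (label j)) i / K (label j) - row_sum A (C (label i)) j / K (label i)"
  using assms cluster_density_commute[OF label_nonzero(1)[OF assms(2)] label_nonzero(1)[OF assms(1)]]
  by (simp add: cross_dual_def dual_half_def add_divide_distrib)

lemma row_sum_div_le:
  assumes "k \<in> {1..r}" "i < n" "i \<notin> C k"
  shows "row_sum A (C k) i / K k \<le> \<theta> k"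
  using degree_across_le[OF assms] K_pos[OF assms(1)] by (simp add: pos_divide_le_eq)

lemma cross_dual_pos:
  assumes ij: "i < n" "j < n" and label: "label i \<noteq> 0" "label j \<noteq> 0" "label i \<noteq> label j"
  shows "0 < cross_dual i j"
proof -
  note k = label_nonzero(1)[OF label(1)] and l = label_nonzero(1)[OF label(2)]
  have "i \<notin> C (label j)" "j \<notin> C (label i)"
    using label label_eq[OF l] label_eq[OF k] by metis+
  then show ?thesis
    using row_sum_div_le[OF l ij(1)] row_sum_div_le[OF k ij(2)]
      \<theta>_add_le[OF k l label(3)] cluster_density_gt[OF k l label(3)]
    unfolding cross_dual_of_clustered[OF label] by linarith
qed

lemma dual_half_outlier_nonneg:
  assumes "i < n" "label i = 0" "k \<le> r"
  shows "0 \<le> dual_half i k"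
proof (cases "k = 0")
  case False
  then have k: "k \<in> {1..r}" using assms by simp
  then have "i \<notin> C k" using label_eq[of k i] assms by auto
  then show ?thesis
    using row_sum_div_le[OF k assms(1)] \<theta>_le[OF k] assms(2) by (simp add: dual_half_def)
qed simp

lemma label_le: "label i \<le> r"
  using label_nonzero(1)[of i] by (cases "label i = 0") auto

lemma cross_dual_nonneg:
  assumes ij: "i < n" "j < n"
  shows "0 \<le> cross_dual i j"
proof -
  consider "label i = label j" | "label i = 0" | "label j = 0"
    | "label i \<noteq> 0" "label j \<noteq> 0" "label i \<noteq> label j"
    by blast
  then show ?thesis
  proof cases
    case 1
    then show ?thesis by (simp add: cross_dual_same)
  next
    case 2
    then show ?thesis using dual_half_outlier_nonneg[OF ij(1)] label_le
      by (simp add: cross_dual_def)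
  next
    case 3
    then show ?thesis using dual_half_outlier_nonneg[OF ij(2)] label_le
      by (simp add: cross_dual_def)
  next
    case 4
    then show ?thesis using cross_dual_pos[OF ij] by simp
  qed
qed

lemma sum_cross_dual_of_clustered:
  assumes k: "k \<in> {1..r}" and i: "label i \<noteq> 0" "label i \<noteq> k"
  shows "(\<Sum>j\<in>C k. cross_dual i j) = lam * K k - row_sum A (C k) i"
proof -
  let ?l = "label i"
  note l = label_nonzero(1)[OF i(1)]
  have "cross_dual i j =
      lam + cluster_density k ?l - row_sum A (C k) i / K k - row_sum A (C ?l) j / K ?l"
    if "j \<in> C k" for j
  proof -
    have "label j = k" using label_eq[OF k that] .
    moreover from this have "label j \<noteq> 0" "?l \<noteq> label j" using k i by auto
    ultimately show ?thesis using cross_dual_of_clustered[OF i(1)] cluster_density_commute[OF k l]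
      by simp
  qed
  then have "(\<Sum>j\<in>C k. cross_dual i j) =
      (\<Sum>j\<in>C k. lam + cluster_density k ?l - row_sum A (C k) i / K k - row_sum A (C ?l) j / K ?l)"
    by (intro sum.cong refl)
  also have "\<dots> = K k * (lam + cluster_density k ?l - row_sum A (C k) i / K k)
      - (\<Sum>j\<in>C k. row_sum A (C ?l) j) / K ?l"
    by (simp add: sum_subtractf sum_divide_distrib card_cluster[OF k])
  also have "(\<Sum>j\<in>C k. row_sum A (C ?l) j) / K ?l = K k * cluster_density k ?l"
    using K_pos[OF k] by (simp add: cluster_density_def)
  finally show ?thesis using K_pos[OF k] by (simp add: algebra_simps)
qed

lemma sum_cross_dual:
  assumes k: "k \<in> {1..r}" and i: "label i \<noteq> k"
  shows "(\<Sum>j\<in>C k. cross_dual i j) = lam * K k - row_sum A (C k) i"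
proof (cases "label i = 0")
  case True
  have "(\<Sum>j\<in>C k. cross_dual i j) = (\<Sum>j\<in>C k. lam - row_sum A (C k) i / K k)"
    by (intro sum.cong refl)
       (use True i k in \<open>auto simp: cross_dual_def dual_half_def label_eq[OF k]\<close>)
  then show ?thesis using K_pos[OF k] by (simp add: card_cluster[OF k] algebra_simps)
next
  case False
  then show ?thesis by (rule sum_cross_dual_of_clustered[OF k _ i])
qed

lemma certificate_null:
  assumes i: "i < n" and k: "k \<in> {1..r}"
  shows "(\<Sum>j\<in>C k. certificate i j) = 0"
proof -
  have diag: "(\<Sum>j\<in>C k. if i = j then dual_diag i + \<eta> else 0)
      = (if i \<in> C k then dual_diag i + \<eta> else 0)"
    using finite_cluster[OF k] by simp
  have split: "(\<Sum>j\<in>C k. certificate i j) = (if i \<in> C k then dual_diag i + \<eta> else 0)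
      - (\<Sum>j\<in>C k. cross_dual i j) - row_sum A (C k) i + lam * K k"
    unfolding dual_slack_def sum.distrib sum_subtractf diag
    by (simp add: row_sum_def card_cluster[OF k])
  show ?thesis
  proof (cases "i \<in> C k")
    case True
    have "(\<Sum>j\<in>C k. cross_dual i j) = 0"
      by (intro sum.neutral ballI cross_dual_same) (simp add: label_eq[OF k] True)
    then show ?thesis
      unfolding split using True k by (simp add: dual_diag_def label_eq[OF k])
  next
    case False
    then have "label i \<noteq> k" using label_eq_iff[OF k] by simp
    then show ?thesis unfolding split sum_cross_dual[OF k \<open>label i \<noteq> k\<close>] using False by simp
  qed
qed

lemma bilin_cross_dual_eq_0:
  assumes y: "\<And>k. k \<in> {1..r} \<Longrightarrow> (\<Sum>j\<in>C k. y j) = 0"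
  shows "bilin n cross_dual y y = 0"
proof -
  have "mat_vec n (\<lambda>i j. dual_half i (label j)) y i = 0" for i
    using sum_label_mult[of "dual_half i" y] y by (simp add: mat_vec_def)
  then have "bilin n (\<lambda>i j. dual_half i (label j)) y y = 0"
    by (simp add: bilin_eq_sum_mat_vec)
  moreover have "bilin n (\<lambda>i j. dual_half j (label i)) y y
      = bilin n (\<lambda>i j. dual_half i (label j)) y y"
    unfolding bilin_def by (subst sum.swap) (simp add: mult_ac)
  ultimately show ?thesis
    using bilin_mat_add[of n "\<lambda>i j. dual_half i (label j)" "\<lambda>i j. dual_half j (label i)"]
    by (simp flip: cross_dual_def)
qed

lemma bilin_A_le:
  assumes y: "\<And>k. k \<in> {1..r} \<Longrightarrow> (\<Sum>j\<in>C k. y j) = 0"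
  shows "bilin n A y y \<le> t * (l2norm n y)\<^sup>2 + q * (\<Sum>i<n. y i)\<^sup>2"
proof -
  have "bilin n noise_matrix y y \<le> spectral_norm n noise_matrix * (l2norm n y)\<^sup>2"
    using abs_quadratic_form_le[of n noise_matrix y] by linarith
  also have "\<dots> \<le> t * (l2norm n y)\<^sup>2" using noise_le by (intro mult_right_mono) auto
  finally show ?thesis
    using bilin_mean_matrix_le[OF p_nonneg q_nonneg y] by (simp add: bilin_mat_diff)
qed

lemma dual_diag_pos: "label i \<noteq> 0 \<Longrightarrow> 0 < dual_diag i"
  using degree_within_gt[of "label i" i] label_nonzero[of i] by (simp add: dual_diag_def)

lemma certificate_pos:
  assumes y: "\<And>k. k \<in> {1..r} \<Longrightarrow> (\<Sum>j\<in>C k. y j) = 0" and nonzero: "l2norm n y \<noteq> 0"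
  shows "0 < bilin n certificate y y"
proof -
  have form: "bilin n certificate y y = (\<Sum>i<n. (dual_diag i + \<eta>) * (y i)\<^sup>2) - bilin n cross_dual y y
      - bilin n A y y + lam * (\<Sum>i<n. y i)\<^sup>2"
    unfolding dual_slack_def bilin_mat_add bilin_mat_diff bilin_mat_const bilin_mat_diag ..
  have "0 \<le> dual_diag i" for i using dual_diag_pos[of i]
    by (cases "label i = 0") (auto simp: dual_diag_def)
  then have "\<eta> * (l2norm n y)\<^sup>2 \<le> (\<Sum>i<n. (dual_diag i + \<eta>) * (y i)\<^sup>2)"
    unfolding L2_set_power2 sum_distrib_left by (intro sum_mono mult_right_mono) auto
  moreover have "q * (\<Sum>i<n. y i)\<^sup>2 \<le> lam * (\<Sum>i<n. y i)\<^sup>2" using q_le by (intro mult_right_mono) auto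
  moreover have "t * (l2norm n y)\<^sup>2 < \<eta> * (l2norm n y)\<^sup>2"
    using t_less nonzero by (intro mult_strict_right_mono) auto
  ultimately show ?thesis
    using form bilin_cross_dual_eq_0[OF y] bilin_A_le[OF y] by linarith
qed

sublocale dual_certificate n r K C A cross_dual dual_diag \<eta> lam
proof
  show "0 < K k" if "k \<in> {1..r}" for k using K_pos[OF that] by simp
  show "sym_mat n certificate"
    using sym_A by (auto simp: sym_mat_def dual_slack_def cross_dual_def)
qed (use cross_dual_nonneg cross_dual_pos certificate_null certificate_pos dual_diag_pos
    in \<open>auto simp: cross_dual_same dual_diag_def\<close>)

end

section \<open>Chernoff bounds for edge counts\<close>

definition edge_count :: "(nat \<times> nat) set \<Rightarrow> (nat \<times> nat \<Rightarrow> bool) \<Rightarrow> real" where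
  "edge_count E \<omega> = (\<Sum>e\<in>E. of_bool (\<omega> e))"

lemma expectation_exp_edge_count_le:
  assumes E: "E \<subseteq> pairs n" and P: "\<And>e. e \<in> E \<Longrightarrow> 0 \<le> P e \<and> P e \<le> 1"
  shows "edge_expectation n P (\<lambda>\<omega>. exp (\<theta> * edge_count E \<omega>)) \<le> exp ((exp \<theta> - 1) * (\<Sum>e\<in>E. P e))"
proof -
  let ?g = "\<lambda>e v. if e \<in> E then exp (\<theta> * of_bool v) else 1"
  have fin: "finite E" by (rule finite_subset[OF E]) simp
  have "exp (\<theta> * edge_count E \<omega>) = (\<Prod>e\<in>pairs n. ?g e (\<omega> e))" for \<omega>
  proof -
    have "exp (\<theta> * edge_count E \<omega>) = (\<Prod>e\<in>E. exp (\<theta> * of_bool (\<omega> e)))"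
      by (simp add: edge_count_def sum_distrib_left exp_sum[OF fin])
    also have "\<dots> = (\<Prod>e\<in>pairs n. ?g e (\<omega> e))"
      by (rule prod.mono_neutral_cong_left) (use E in auto)
    finally show ?thesis .
  qed
  then have "edge_expectation n P (\<lambda>\<omega>. exp (\<theta> * edge_count E \<omega>)) =
      (\<Prod>e\<in>pairs n. measure_pmf.expectation (bernoulli_pmf (P e)) (?g e))"
    by (simp only: expectation_prod_edge_pmf[where g = ?g])
  also have "\<dots> = (\<Prod>e\<in>E. measure_pmf.expectation (bernoulli_pmf (P e)) (\<lambda>v. exp (\<theta> * of_bool v)))"
    by (rule prod.mono_neutral_cong_right) (use E in auto)
  also have "\<dots> \<le> (\<Prod>e\<in>E. exp ((exp \<theta> - 1) * P e))"
  proof (intro prod_mono conjI)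
    fix e assume e: "e \<in> E"
    show "0 \<le> measure_pmf.expectation (bernoulli_pmf (P e)) (\<lambda>v. exp (\<theta> * of_bool v))"
      by (intro Bochner_Integration.integral_nonneg) simp
    have "measure_pmf.expectation (bernoulli_pmf (P e)) (\<lambda>v. exp (\<theta> * of_bool v))
        = 1 + (exp \<theta> - 1) * P e"
      using P[OF e] by (simp add: algebra_simps)
    then show "measure_pmf.expectation (bernoulli_pmf (P e)) (\<lambda>v. exp (\<theta> * of_bool v))
        \<le> exp ((exp \<theta> - 1) * P e)"
      using exp_ge_add_one_self[of "(exp \<theta> - 1) * P e"] by simp
  qed
  also have "\<dots> = exp ((exp \<theta> - 1) * (\<Sum>e\<in>E. P e))"
    by (simp add: exp_sum[OF fin] sum_distrib_left)
  finally show ?thesis .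
qed

lemma chernoff_edge_count:
  assumes E: "E \<subseteq> pairs n" and P: "\<And>e. e \<in> E \<Longrightarrow> 0 \<le> P e \<and> P e \<le> 1"
  shows "edge_prob n P {\<omega>. \<theta> * x \<le> \<theta> * edge_count E \<omega>} \<le> exp ((exp \<theta> - 1) * (\<Sum>e\<in>E. P e) - \<theta> * x)"
proof -
  let ?X = "\<lambda>\<omega>. exp (\<theta> * edge_count E \<omega>)"
  have "edge_prob n P {\<omega> \<in> space (measure_pmf (edge_pmf n P)). exp (\<theta> * x) \<le> ?X \<omega>}
      \<le> edge_expectation n P ?X / exp (\<theta> * x)"
    by (rule integral_Markov_inequality_measure[where A = UNIV]) auto
  also have "\<dots> \<le> exp ((exp \<theta> - 1) * (\<Sum>e\<in>E. P e)) / exp (\<theta> * x)"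
    by (intro divide_right_mono expectation_exp_edge_count_le[OF E P]) auto
  finally show ?thesis by (simp add: exp_diff)
qed

lemma rate_I_eq:
  assumes "0 < \<mu>" "0 < d"
  shows "rate_I \<mu> d = \<mu> - d + d * ln (d / \<mu>)"
  using assms by (simp add: rate_I_def ln_div ln_mult algebra_simps)

lemma edge_count_upper_tail:
  assumes E: "E \<subseteq> pairs n" and P: "\<And>e. e \<in> E \<Longrightarrow> P e = b * s" and s: "0 \<le> s" "b * s \<le> 1"
    and b: "0 < b" "b < \<beta>"
  shows "edge_prob n P {\<omega>. \<beta> * s * card E < edge_count E \<omega>} \<le> exp (- (s * card E * rate_I b \<beta>))"
proof -
  let ?\<theta> = "ln (\<beta> / b)"
  have \<theta>: "0 \<le> ?\<theta>" "exp ?\<theta> = \<beta> / b" using b by auto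
  have "edge_prob n P {\<omega>. \<beta> * s * card E < edge_count E \<omega>}
      \<le> edge_prob n P {\<omega>. ?\<theta> * (\<beta> * s * card E) \<le> ?\<theta> * edge_count E \<omega>}"
    using \<theta> by (intro measure_pmf.finite_measure_mono) (auto intro!: mult_left_mono)
  also have "\<dots> \<le> exp ((exp ?\<theta> - 1) * (\<Sum>e\<in>E. P e) - ?\<theta> * (\<beta> * s * card E))"
    using P s b by (intro chernoff_edge_count E) auto
  also have "(exp ?\<theta> - 1) * (\<Sum>e\<in>E. P e) - ?\<theta> * (\<beta> * s * card E) = - (s * card E * rate_I b \<beta>)"
    using b P by (simp add: \<theta>(2) rate_I_eq field_simps)
  finally show ?thesis .
qed

text \<open>The threshold counts one pair more than \<open>E\<close> has, because a vertex is not joined to itself.\<close>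

lemma edge_count_lower_tail:
  assumes E: "E \<subseteq> pairs n" and P: "\<And>e. e \<in> E \<Longrightarrow> P e = a * s" and s: "0 \<le> s" "a * s \<le> 1"
    and a: "0 < \<beta>" "\<beta> < a"
  shows "edge_prob n P {\<omega>. edge_count E \<omega> < \<beta> * s * Suc (card E)}
    \<le> exp ((a - \<beta>) * s) * exp (- (s * Suc (card E) * rate_I a \<beta>))"
proof -
  let ?\<theta> = "ln (\<beta> / a)"
  have \<theta>: "?\<theta> \<le> 0" "exp ?\<theta> = \<beta> / a" using a by auto
  have "edge_prob n P {\<omega>. edge_count E \<omega> < \<beta> * s * Suc (card E)}
      \<le> edge_prob n P {\<omega>. ?\<theta> * (\<beta> * s * Suc (card E)) \<le> ?\<theta> * edge_count E \<omega>}"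
    using \<theta>
    by (intro measure_pmf.finite_measure_mono)
       (auto intro!: mult_left_mono_neg simp del: of_nat_Suc)
  also have "\<dots> \<le> exp ((exp ?\<theta> - 1) * (\<Sum>e\<in>E. P e) - ?\<theta> * (\<beta> * s * Suc (card E)))"
    using P s a by (intro chernoff_edge_count E) auto
  also have "(exp ?\<theta> - 1) * (\<Sum>e\<in>E. P e) - ?\<theta> * (\<beta> * s * Suc (card E)) =
      (a - \<beta>) * s + - (s * Suc (card E) * rate_I a \<beta>)"
    using a P by (simp add: \<theta>(2) rate_I_eq field_simps)
  finally show ?thesis by (simp only: exp_add)
qed

definition star :: "nat \<Rightarrow> nat set \<Rightarrow> (nat \<times> nat) set" where
  "star i T = (\<lambda>j. (min i j, max i j)) ` (T - {i})"

lemma inj_on_star: "inj_on (\<lambda>j. (min i j, max i j)) (T - {i})"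
  by (auto simp: inj_on_def min_def max_def split: if_splits)

lemma star_subset_pairs: "i < n \<Longrightarrow> T \<subseteq> {..<n} \<Longrightarrow> star i T \<subseteq> pairs n"
  by (auto simp: star_def pairs_def min_def max_def)

lemma card_star: "card (star i T) = card (T - {i})"
  unfolding star_def by (rule card_image[OF inj_on_star])

lemma row_sum_adjacency:
  assumes "finite T"
  shows "row_sum (adjacency \<omega>) T i = edge_count (star i T) \<omega>"
proof -
  have "row_sum (adjacency \<omega>) T i = (\<Sum>j\<in>T - {i}. adjacency \<omega> i j)"
    unfolding row_sum_def using assms
    by (intro sum.mono_neutral_right) (auto simp: adjacency_def symmat_def)
  also have "\<dots> = (\<Sum>j\<in>T - {i}. of_bool (\<omega> (min i j, max i j)))"
    by (intro sum.cong refl) (auto simp: adjacency_def symmat_def min_def max_def)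
  also have "\<dots> = edge_count (star i T) \<omega>"
    unfolding edge_count_def star_def by (simp add: sum.reindex[OF inj_on_star])
  finally show ?thesis .
qed

lemma same_cluster_commute: "same_cluster r C i j \<longleftrightarrow> same_cluster r C j i"
  by (auto simp: same_cluster_def)

lemma sbm_edge_prob_star:
  assumes e: "e \<in> star i T" and same: "\<And>j. j \<in> T \<Longrightarrow> same_cluster r C i j \<longleftrightarrow> b"
  shows "sbm_edge_prob r C p q e = (if b then p else q)"
proof -
  obtain j where j: "j \<in> T" "e = (min i j, max i j)" using e by (auto simp: star_def)
  show ?thesis
  proof (cases "i \<le> j")
    case True
    then show ?thesis using same[OF j(1)] by (simp add: j(2) sbm_edge_prob_def min_def max_def)
  next
    case False
    then show ?thesis
      using same[OF j(1)] same_cluster_commute[of r C i j]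
      by (simp add: j(2) sbm_edge_prob_def min_def max_def)
  qed
qed

section \<open>Recovery at finite size\<close>

lemma sbm_adj_eq: "sbm_adj n r C p q = map_pmf adjacency (edge_pmf n (sbm_edge_prob r C p q))"
proof -
  have "(\<lambda>e i j. if i < j then (if e (i, j) then 1 else 0)
      else if j < i then (if e (j, i) then 1 else 0) else 0) = adjacency"
    by (auto simp: adjacency_def symmat_def fun_eq_iff)
  moreover have "(\<lambda>(i, j). bernoulli_pmf (if same_cluster r C i j then p else q)) =
      (\<lambda>e. bernoulli_pmf (sbm_edge_prob r C p q e))"
    by (auto simp: sbm_edge_prob_def fun_eq_iff)
  ultimately show ?thesis unfolding sbm_adj_def edge_pmf_def pairs_def by simp
qed

lemma adjacency_minus_mean:
  "(\<lambda>i j. adjacency \<omega> i j - symmat P i j) = centered_adjacency P \<omega>"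
  by (auto simp: adjacency_def centered_adjacency_def symmat_def fun_eq_iff)

context clustering
begin

lemma prob_row_sum_across_gt_le:
  assumes k: "k \<in> {1..r}" and i: "i < n" "i \<notin> C k" and s: "0 \<le> s" "b * s \<le> 1" and b: "0 < b" "b < \<beta>"
  shows "edge_prob n (sbm_edge_prob r C p (b * s)) {\<omega>. \<beta> * s * K k < row_sum (adjacency \<omega>) (C k) i}
    \<le> exp (- (s * K k * rate_I b \<beta>))"
proof -
  have "\<not> same_cluster r C i j" if "j \<in> C k" for j
    using i label_eq[OF k that] label_eq_iff[OF k, of i] by (auto simp: same_cluster_iff)
  then have "sbm_edge_prob r C p (b * s) e = b * s" if "e \<in> star i (C k)" for e
    using sbm_edge_prob_star[OF that, of r C False p "b * s"] by simp
  moreover have "card (star i (C k)) = K k" using i by (simp add: card_star card_cluster[OF k])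
  ultimately show ?thesis
    using edge_count_upper_tail[OF star_subset_pairs[OF i(1) cluster_subset[OF k]] _ s b,
        of "sbm_edge_prob r C p (b * s)"]
    by (simp add: row_sum_adjacency[OF finite_cluster[OF k]])
qed

lemma prob_row_sum_within_less_le:
  assumes k: "k \<in> {1..r}" and i: "i \<in> C k" and s: "0 \<le> s" "a * s \<le> 1" and a: "0 < \<beta>" "\<beta> < a"
  shows "edge_prob n (sbm_edge_prob r C (a * s) q) {\<omega>. row_sum (adjacency \<omega>) (C k) i < \<beta> * s * K k}
    \<le> 3 * exp (- (s * K k * rate_I a \<beta>))"
proof -
  have n: "i < n" using cluster_subset[OF k] i by auto
  have "same_cluster r C i j" if "j \<in> C k" for j
    using i k that by (auto simp: same_cluster_def)
  then have "sbm_edge_prob r C (a * s) q e = a * s" if "e \<in> star i (C k)" for e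
    using sbm_edge_prob_star[OF that, of r C True "a * s" q] by simp
  moreover have "Suc (card (star i (C k))) = K k"
    using card_Suc_Diff1[OF finite_cluster[OF k] i] by (simp add: card_star card_cluster[OF k])
  ultimately have "edge_prob n (sbm_edge_prob r C (a * s) q)
        {\<omega>. row_sum (adjacency \<omega>) (C k) i < \<beta> * s * K k}
      \<le> exp ((a - \<beta>) * s) * exp (- (s * K k * rate_I a \<beta>))"
    using edge_count_lower_tail[OF star_subset_pairs[OF n cluster_subset[OF k]] _ s a,
        of "sbm_edge_prob r C (a * s) q"]
    by (simp only: row_sum_adjacency[OF finite_cluster[OF k]])
  also have "\<dots> \<le> 3 * exp (- (s * K k * rate_I a \<beta>))"
  proof (rule mult_right_mono)
    have "(a - \<beta>) * s \<le> a * s" using a s by (intro mult_right_mono) auto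
    then have "exp ((a - \<beta>) * s) \<le> exp 1" using s by simp
    then show "exp ((a - \<beta>) * s) \<le> 3" using exp_le by linarith
  qed simp
  finally show ?thesis .
qed

end

definition degree_failure_bound :: "nat \<Rightarrow> nat \<Rightarrow> real \<Rightarrow> real \<Rightarrow> real \<Rightarrow> real" where
  "degree_failure_bound n m s I J
      = m * (3 * exp (- (s * m * I))) + real (n - m) * exp (- (s * m * J))"

text \<open>\<open>\<tau> k\<close> caps the density, in units of \<open>s\<close>, of the edges from an outside vertex to \<open>C k\<close>.
  The caps of two clusters must add up to less than \<open>\<psi> + b\<close> for the certificate to be positive
  on the block between them.\<close>

locale planted_clusters = clustering +
  fixes a b \<psi> \<epsilon> s t \<eta> :: real and \<tau> :: "nat \<Rightarrow> real"
  assumes b_pos: "0 < b" and b_less: "b < \<psi>" and \<psi>_less: "\<psi> + \<epsilon> < a"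
    and s_pos: "0 < s" and as_le: "a * s \<le> 1" and \<epsilon>_pos: "0 < \<epsilon>"
    and \<tau>_gt: "k \<in> {1..r} \<Longrightarrow> b < \<tau> k" and \<tau>_le: "k \<in> {1..r} \<Longrightarrow> \<tau> k \<le> \<psi>"
    and \<tau>_add_le: "k \<in> {1..r} \<Longrightarrow> l \<in> {1..r} \<Longrightarrow> k \<noteq> l \<Longrightarrow> \<tau> k + \<tau> l + \<epsilon> \<le> \<psi> + b"
    and t_less: "t < \<eta>" and \<eta>_less: "k \<in> {1..r} \<Longrightarrow> \<eta> < \<epsilon> * s * K k"
begin

abbreviation edge_probs :: "nat \<times> nat \<Rightarrow> real" where
  "edge_probs \<equiv> sbm_edge_prob r C (a * s) (b * s)"

abbreviation prob :: "(nat \<times> nat \<Rightarrow> bool) set \<Rightarrow> real" where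
  "prob \<equiv> edge_prob n edge_probs"

definition large_noise :: "(nat \<times> nat \<Rightarrow> bool) set" where
  "large_noise = {\<omega>. t < spectral_norm n (centered_adjacency edge_probs \<omega>)}"

definition low_degree :: "nat \<Rightarrow> nat \<Rightarrow> (nat \<times> nat \<Rightarrow> bool) set" where
  "low_degree k i = {\<omega>. row_sum (adjacency \<omega>) (C k) i < (\<psi> + \<epsilon>) * s * K k}"

definition high_degree :: "nat \<Rightarrow> nat \<Rightarrow> (nat \<times> nat \<Rightarrow> bool) set" where
  "high_degree k i = {\<omega>. \<tau> k * s * K k < row_sum (adjacency \<omega>) (C k) i}"

definition bad_event :: "(nat \<times> nat \<Rightarrow> bool) set" where
  "bad_event = large_noise \<union>
    (\<Union>k\<in>{1..r}. (\<Union>i\<in>C k. low_degree k i) \<union> (\<Union>i\<in>{..<n} - C k. high_degree k i))"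

abbreviation degree_failure :: "nat \<Rightarrow> real" where
  "degree_failure k \<equiv> degree_failure_bound n (K k) s (rate_I a (\<psi> + \<epsilon>)) (rate_I b (\<tau> k))"

lemma unique_maximizer_of_not_bad:
  assumes \<omega>: "\<omega> \<notin> bad_event"
  shows "unique_maximizer (sdp_base_feasible n) (sdp2_objective n \<eta> (\<psi> * s) (adjacency \<omega>))
    (cluster_matrix r C)"
proof -
  interpret regular_adjacency n r K C "adjacency \<omega>" "a * s" "b * s" t \<eta> "\<psi> * s" "\<epsilon> * s" "\<lambda>k. \<tau> k * s"
  proof
    show "spectral_norm n (\<lambda>i j. adjacency \<omega> i j - symmat edge_probs i j) \<le> t"
      using \<omega> unfolding adjacency_minus_mean by (simp add: bad_event_def large_noise_def)
    show "\<eta> + \<psi> * s * K k < row_sum (adjacency \<omega>) (C k) i" if "k \<in> {1..r}" "i \<in> C k" for k i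
    proof -
      have "(\<psi> + \<epsilon>) * s * K k \<le> row_sum (adjacency \<omega>) (C k) i"
        using \<omega> that by (auto simp: bad_event_def low_degree_def not_less)
      then show ?thesis using \<eta>_less[OF that(1)] by (simp add: algebra_simps)
    qed
    show "row_sum (adjacency \<omega>) (C k) i \<le> \<tau> k * s * K k" if "k \<in> {1..r}" "i < n" "i \<notin> C k" for k i
      using \<omega> that by (auto simp: bad_event_def high_degree_def not_less)
    show "\<tau> k * s + \<tau> l * s + \<epsilon> * s \<le> \<psi> * s + b * s" if "k \<in> {1..r}" "l \<in> {1..r}" "k \<noteq> l" for k l
      using mult_right_mono[OF \<tau>_add_le[OF that], of s] s_pos by (simp add: algebra_simps)
    show "t < \<epsilon> * s * K k" if "k \<in> {1..r}" for k using \<eta>_less[OF that] t_less by linarith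
  qed (use b_pos b_less \<psi>_less s_pos \<epsilon>_pos \<tau>_le t_less in \<open>auto simp: adjacency_def\<close>)
  show ?thesis by (rule unique_maximizer_cluster_matrix)
qed

lemma prob_bad_degrees_le:
  assumes k: "k \<in> {1..r}"
  shows "prob ((\<Union>i\<in>C k. low_degree k i) \<union> (\<Union>i\<in>{..<n} - C k. high_degree k i)) \<le> degree_failure k"
proof -
  have "b * s \<le> a * s" using b_less \<psi>_less \<epsilon>_pos s_pos by (intro mult_right_mono) auto
  then have bs: "b * s \<le> 1" using as_le by linarith
  have "prob (\<Union>i\<in>C k. low_degree k i) \<le> (\<Sum>i\<in>C k. prob (low_degree k i))"
    using finite_cluster[OF k] by (intro measure_UNION_le) auto
  also have "\<dots> \<le> (\<Sum>i\<in>C k. 3 * exp (- (s * K k * rate_I a (\<psi> + \<epsilon>))))"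
    unfolding low_degree_def using b_pos b_less \<psi>_less \<epsilon>_pos s_pos as_le
    by (intro sum_mono prob_row_sum_within_less_le[OF k]) auto
  finally have low: "prob (\<Union>i\<in>C k. low_degree k i) \<le> K k * (3 * exp (- (s * K k * rate_I a (\<psi> + \<epsilon>))))"
    by (simp add: card_cluster[OF k])
  have "prob (\<Union>i\<in>{..<n} - C k. high_degree k i) \<le> (\<Sum>i\<in>{..<n} - C k. prob (high_degree k i))"
    by (intro measure_UNION_le) auto
  also have "\<dots> \<le> (\<Sum>i\<in>{..<n} - C k. exp (- (s * K k * rate_I b (\<tau> k))))"
    unfolding high_degree_def using b_pos \<tau>_gt[OF k] s_pos bs
    by (intro sum_mono prob_row_sum_across_gt_le[OF k]) auto
  finally have high: "prob (\<Union>i\<in>{..<n} - C k. high_degree k i)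
      \<le> real (n - K k) * exp (- (s * K k * rate_I b (\<tau> k)))"
    using card_Diff_subset[OF finite_cluster[OF k] cluster_subset[OF k]]
    by (simp add: card_cluster[OF k])
  show ?thesis
    unfolding degree_failure_bound_def
    by (intro order_trans[OF measure_Un_le] add_mono low high) auto
qed

lemma prob_bad_event_le:
  "prob bad_event \<le> prob large_noise + (\<Sum>k\<in>{1..r}. degree_failure k)"
proof -
  have "prob (\<Union>k\<in>{1..r}. (\<Union>i\<in>C k. low_degree k i) \<union> (\<Union>i\<in>{..<n} - C k. high_degree k i))
      \<le> (\<Sum>k\<in>{1..r}. degree_failure k)"
    by (intro order_trans[OF measure_UNION_le] sum_mono prob_bad_degrees_le) auto
  then show ?thesis
    unfolding bad_event_def by (intro order_trans[OF measure_Un_le] add_left_mono) auto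
qed

theorem prob_unique_maximizer_ge:
  "1 - (prob large_noise + (\<Sum>k\<in>{1..r}. degree_failure k))
    \<le> measure_pmf.prob (sbm_adj n r C (a * s) (b * s))
        {A. unique_maximizer (sdp_base_feasible n) (sdp2_objective n \<eta> (\<psi> * s) A)
          (cluster_matrix r C)}"
proof -
  have "1 - (prob large_noise + (\<Sum>k\<in>{1..r}. degree_failure k)) \<le> 1 - prob bad_event"
    using prob_bad_event_le by simp
  also have "\<dots> = prob (- bad_event)"
    using measure_pmf.prob_compl[of bad_event "edge_pmf n edge_probs"]
    by (simp add: Compl_eq_Diff_UNIV)
  also have "\<dots> \<le> prob {\<omega>. unique_maximizer (sdp_base_feasible n)
      (sdp2_objective n \<eta> (\<psi> * s) (adjacency \<omega>)) (cluster_matrix r C)}"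
    using unique_maximizer_of_not_bad by (intro measure_pmf.finite_measure_mono) auto
  finally show ?thesis by (simp add: sbm_adj_eq vimage_def)
qed

end

section \<open>Polynomially small failure probabilities\<close>

definition polynomially_small :: "(nat \<Rightarrow> real) \<Rightarrow> bool" where
  "polynomially_small f \<longleftrightarrow> (\<exists>c>0. \<forall>\<^sub>F n in sequentially. f n \<le> real n powr (- c))"

lemma polynomially_small_mono:
  assumes "polynomially_small g" and "\<forall>\<^sub>F n in sequentially. f n \<le> g n"
  shows "polynomially_small f"
proof -
  obtain c where "0 < c" "\<forall>\<^sub>F n in sequentially. g n \<le> real n powr (- c)"
    using assms(1) by (auto simp: polynomially_small_def)
  with assms(2) have "\<forall>\<^sub>F n in sequentially. f n \<le> real n powr (- c)"
    by (auto elim: eventually_elim2)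
  with \<open>0 < c\<close> show ?thesis by (auto simp: polynomially_small_def)
qed

lemma polynomially_small_cmult:
  assumes "polynomially_small f" "0 \<le> a"
  shows "polynomially_small (\<lambda>n. a * f n)"
proof -
  obtain c where c: "0 < c" "\<forall>\<^sub>F n in sequentially. f n \<le> real n powr (- c)"
    using assms(1) by (auto simp: polynomially_small_def)
  have "\<forall>\<^sub>F n in sequentially. a \<le> real n powr (c / 2)"
    using c(1) by real_asymp
  then have "\<forall>\<^sub>F n in sequentially. a * f n \<le> real n powr (- (c / 2))"
    using c(2)
  proof eventually_elim
    case (elim n)
    have "a * f n \<le> real n powr (c / 2) * real n powr (- c)"
      using elim assms(2) by (meson mult_left_mono mult_right_mono order_trans powr_ge_zero)
    also have "\<dots> = real n powr (- (c / 2))" by (simp flip: powr_add)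
    finally show ?case .
  qed
  with c(1) show ?thesis unfolding polynomially_small_def by (intro exI[of _ "c / 2"]) simp
qed

lemma polynomially_small_max:
  assumes "polynomially_small f" "polynomially_small g"
  shows "polynomially_small (\<lambda>n. max (f n) (g n))"
proof -
  obtain c d where cd: "0 < c" "\<forall>\<^sub>F n in sequentially. f n \<le> real n powr (- c)"
      "0 < d" "\<forall>\<^sub>F n in sequentially. g n \<le> real n powr (- d)"
    using assms by (auto simp: polynomially_small_def)
  have "\<forall>\<^sub>F n in sequentially. max (f n) (g n) \<le> real n powr (- min c d)"
    using cd(2,4) eventually_ge_at_top[of 1]
  proof eventually_elim
    case (elim n)
    then have "real n powr (- c) \<le> real n powr (- min c d)"
      "real n powr (- d) \<le> real n powr (- min c d)"
      by (auto intro: powr_mono)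
    with elim show ?case by simp
  qed
  then show ?thesis using cd unfolding polynomially_small_def by (intro exI[of _ "min c d"]) simp
qed

lemma polynomially_small_add:
  assumes "polynomially_small f" "polynomially_small g"
  shows "polynomially_small (\<lambda>n. f n + g n)"
  using polynomially_small_cmult[OF polynomially_small_max[OF assms], of 2]
  by (rule polynomially_small_mono) (auto intro!: always_eventually)

lemma polynomially_small_powr: "0 < c \<Longrightarrow> polynomially_small (\<lambda>n. real n powr (- c))"
  by (auto simp: polynomially_small_def)

lemma polynomially_small_sum:
  assumes "finite I" "\<And>i. i \<in> I \<Longrightarrow> polynomially_small (f i)"
  shows "polynomially_small (\<lambda>n. \<Sum>i\<in>I. f i n)"
  using assms
proof (induction rule: finite_induct)
  case empty
  then show ?case by (auto simp: polynomially_small_def intro: exI[of _ 1])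
next
  case (insert i I)
  then show ?case by (simp add: polynomially_small_add)
qed

lemma cluster_size_ge: "0 \<le> \<rho> k \<Longrightarrow> \<rho> k * n - 1 \<le> real (cluster_size \<rho> n k)"
  by (simp add: cluster_size_def)

lemma cluster_size_le:
  assumes "0 \<le> \<rho> k" "\<rho> k \<le> 1"
  shows "cluster_size \<rho> n k \<le> n"
proof -
  have "\<rho> k * n \<le> 1 * real n" using assms by (intro mult_right_mono) auto
  then have "\<lfloor>\<rho> k * n\<rfloor> \<le> int n" by (simp add: floor_le_iff)
  then show ?thesis by (simp add: cluster_size_def)
qed

lemma polynomially_small_exp_rate:
  assumes \<rho>: "0 < \<rho> k" and I: "1 < \<rho> k * I"
  shows "polynomially_small (\<lambda>n. n * exp (- (ln n / n * cluster_size \<rho> n k * I)))"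
proof -
  define c where "c = \<rho> k * I - 1"
  have c: "0 < c" using I by (simp add: c_def)
  have "0 < \<rho> k * I" using I by linarith
  then have I_pos: "0 < I" using \<rho> by (simp add: zero_less_mult_iff)
  have "\<forall>\<^sub>F n in sequentially. exp (I * (ln (real n) / real n)) \<le> real n powr (c / 2)"
    using c by real_asymp
  then have "\<forall>\<^sub>F n in sequentially. n * exp (- (ln n / n * cluster_size \<rho> n k * I))
      \<le> real n powr (- (c / 2))"
    using eventually_ge_at_top[of 1]
  proof eventually_elim
    case (elim n)
    have "ln n / n * (\<rho> k * n - 1) * I \<le> ln n / n * cluster_size \<rho> n k * I"
      using elim I_pos \<rho> cluster_size_ge[of \<rho> k n] by (intro mult_right_mono mult_left_mono) auto
    moreover have "ln n / n * (\<rho> k * n - 1) * I = (c + 1) * ln n - I * (ln n / n)"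
      using elim by (simp add: c_def field_simps)
    ultimately have "n * exp (- (ln n / n * cluster_size \<rho> n k * I)) \<le>
        n * exp (I * (ln n / n) - (c + 1) * ln n)"
      by (intro mult_left_mono) auto
    also have "\<dots> = exp (ln n) * exp (I * (ln n / n) - (c + 1) * ln n)" using elim by simp
    also have "\<dots> = exp (- c * ln n + I * (ln n / n))"
      unfolding mult_exp_exp by (simp add: algebra_simps)
    also have "\<dots> = real n powr (- c) * exp (I * (ln n / n))"
      unfolding exp_add using elim by (simp add: powr_def)
    also have "\<dots> \<le> real n powr (- c) * real n powr (c / 2)"
      using elim by (intro mult_left_mono) auto
    also have "\<dots> = real n powr (- (c / 2))" by (simp flip: powr_add)
    finally show ?case .
  qed
  then show ?thesis using c unfolding polynomially_small_def by (intro exI[of _ "c / 2"]) simp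
qed

lemma polynomially_small_degree_failure_bound:
  assumes \<rho>: "0 < \<rho> k" "\<rho> k \<le> 1" and I: "1 < \<rho> k * I" and J: "\<rho> k < 1 \<Longrightarrow> 1 < \<rho> k * J"
  shows "polynomially_small (\<lambda>n. degree_failure_bound n (cluster_size \<rho> n k) (ln n / n) I J)"
proof -
  let ?K = "\<lambda>n. cluster_size \<rho> n k"
  have size: "?K n \<le> n" for n using cluster_size_le[of \<rho> k n] \<rho> by simp
  have "polynomially_small (\<lambda>n. 3 * (n * exp (- (ln n / n * ?K n * I))))"
    by (intro polynomially_small_cmult polynomially_small_exp_rate \<rho> I) simp
  then have within: "polynomially_small (\<lambda>n. ?K n * (3 * exp (- (ln n / n * ?K n * I))))"
    by (rule polynomially_small_mono) (use size in \<open>auto intro!: always_eventually mult_right_mono\<close>)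
  have across: "polynomially_small (\<lambda>n. real (n - ?K n) * exp (- (ln n / n * ?K n * J)))"
  proof (cases "\<rho> k < 1")
    case True
    show ?thesis
      using polynomially_small_exp_rate[where \<rho> = \<rho> and k = k, OF \<rho>(1) J[OF True]]
      by (rule polynomially_small_mono) (auto intro!: always_eventually mult_right_mono)
  next
    case False
    then have "n - ?K n = 0" for n using \<rho> by (simp add: cluster_size_def)
    then have "(\<lambda>n. real (n - ?K n) * exp (- (ln n / n * ?K n * J))) = (\<lambda>_. 0)" by simp
    then show ?thesis by (auto simp: polynomially_small_def intro: exI[of _ 1])
  qed
  show ?thesis
    unfolding degree_failure_bound_def by (rule polynomially_small_add[OF within across])
qed

definition recovers_whp :: "nat \<Rightarrow> (nat \<Rightarrow> real) \<Rightarrow> (nat \<Rightarrow> (nat \<Rightarrow> nat set) \<Rightarrow> real) \<Rightarrow> bool" where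
  "recovers_whp r \<rho> success \<longleftrightarrow> (\<exists>c>0. \<exists>N. \<forall>n\<ge>N. \<forall>C. valid_clusters n r (cluster_size \<rho> n) C \<longrightarrow>
    success n C \<ge> 1 - real n powr (- c))"

lemma recovers_whpI:
  assumes "polynomially_small f"
    and "\<forall>\<^sub>F n in sequentially. \<forall>C. valid_clusters n r (cluster_size \<rho> n) C \<longrightarrow> 1 - f n \<le> success n C"
  shows "recovers_whp r \<rho> success"
proof -
  obtain c where c: "0 < c" "\<forall>\<^sub>F n in sequentially. f n \<le> real n powr (- c)"
    using assms(1) by (auto simp: polynomially_small_def)
  from c(2) assms(2) have "\<forall>\<^sub>F n in sequentially. \<forall>C. valid_clusters n r (cluster_size \<rho> n) C \<longrightarrow>
      success n C \<ge> 1 - real n powr (- c)"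
    by eventually_elim fastforce
  with c(1) show ?thesis unfolding recovers_whp_def eventually_sequentially by blast
qed

lemma recovers_whp_mono:
  assumes "recovers_whp r \<rho> success"
    and "\<And>n C. valid_clusters n r (cluster_size \<rho> n) C \<Longrightarrow> success n C \<le> success' n C"
  shows "recovers_whp r \<rho> success'"
  using assms unfolding recovers_whp_def by (meson order_trans)

section \<open>Exact recovery\<close>

definition sdp1_success_prob :: "nat \<Rightarrow> real \<Rightarrow> real \<Rightarrow> (nat \<Rightarrow> real) \<Rightarrow> nat \<Rightarrow> (nat \<Rightarrow> nat set) \<Rightarrow> real"
  where
  "sdp1_success_prob r a b \<rho> n C = measure_pmf.prob (sbm_adj n r C (a * ln n / n) (b * ln n / n))
    {A. unique_maximizer (sdp1_feasible n r (cluster_size \<rho> n)) (\<lambda>Z. inner_n n A Z)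
      (cluster_matrix r C)}"

definition sdp2_success_prob :: "nat \<Rightarrow> real \<Rightarrow> real \<Rightarrow> real \<Rightarrow> real \<Rightarrow> nat \<Rightarrow> (nat \<Rightarrow> nat set) \<Rightarrow> real"
  where
  "sdp2_success_prob r a b \<psi> Cc n C = measure_pmf.prob (sbm_adj n r C (a * ln n / n) (b * ln n / n))
    {A. unique_maximizer (sdp_base_feasible n) (sdp2_objective n (Cc * sqrt (ln n)) (\<psi> * ln n / n) A)
      (cluster_matrix r C)}"

lemma sdp2_success_prob_le_sdp1:
  assumes "valid_clusters n r (cluster_size \<rho> n) C"
  shows "sdp2_success_prob r a b \<psi> Cc n C \<le> sdp1_success_prob r a b \<rho> n C"
  unfolding sdp1_success_prob_def sdp2_success_prob_def
  using clustering.unique_maximizer_sdp1_of_sdp2[OF clustering.intro[OF assms]]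
  by (intro measure_pmf.finite_measure_mono) auto

lemma eventually_rate_I_perturbed:
  assumes "0 < \<mu>" "0 < d" "1 < x * rate_I \<mu> d"
  shows "\<forall>\<^sub>F \<epsilon> in at_right 0. 1 < x * rate_I \<mu> (d + \<sigma> * \<epsilon>)"
proof -
  have "isCont (\<lambda>d. x * rate_I \<mu> d) d"
    unfolding rate_I_def using assms by (intro continuous_intros) auto
  moreover have "((\<lambda>\<epsilon>. d + \<sigma> * \<epsilon>) \<longlongrightarrow> d + \<sigma> * 0) (at_right 0)"
    by (intro tendsto_intros)
  ultimately have "((\<lambda>\<epsilon>. x * rate_I \<mu> (d + \<sigma> * \<epsilon>)) \<longlongrightarrow> x * rate_I \<mu> d) (at_right 0)"
    by (intro isCont_tendsto_compose[of d "\<lambda>d. x * rate_I \<mu> d"]) auto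
  then show ?thesis using assms(3) by (rule order_tendstoD(1))
qed

locale recovery_thresholds =
  fixes r :: nat and a b \<psi> :: real and \<rho> \<tau> :: "nat \<Rightarrow> real"
  assumes b_pos: "0 < b" and b_less: "b < \<psi>" and \<psi>_less: "\<psi> < a"
    and \<rho>_pos: "k \<in> {1..r} \<Longrightarrow> 0 < \<rho> k" and \<rho>_le: "k \<in> {1..r} \<Longrightarrow> \<rho> k \<le> 1"
    and \<tau>_gt: "k \<in> {1..r} \<Longrightarrow> b < \<tau> k" and \<tau>_le: "k \<in> {1..r} \<Longrightarrow> \<tau> k \<le> \<psi>"
    and \<tau>_add_le: "k \<in> {1..r} \<Longrightarrow> l \<in> {1..r} \<Longrightarrow> k \<noteq> l \<Longrightarrow> \<tau> k + \<tau> l \<le> \<psi> + b"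
    and rate_within: "k \<in> {1..r} \<Longrightarrow> 1 < \<rho> k * rate_I a \<psi>"
    and rate_across: "k \<in> {1..r} \<Longrightarrow> \<rho> k < 1 \<Longrightarrow> 1 < \<rho> k * rate_I b (\<tau> k)"
begin

definition admissible_slack :: "real \<Rightarrow> bool" where
  "admissible_slack \<epsilon> \<longleftrightarrow> 0 < \<epsilon> \<and> \<psi> + \<epsilon> < a \<and> (\<forall>k\<in>{1..r}. b < \<tau> k - \<epsilon> \<and>
    1 < \<rho> k * rate_I a (\<psi> + \<epsilon>) \<and> (\<rho> k < 1 \<longrightarrow> 1 < \<rho> k * rate_I b (\<tau> k - \<epsilon>)))"

lemma ex_admissible_slack: "\<exists>\<epsilon>. admissible_slack \<epsilon>"
proof -
  have "\<forall>\<^sub>F \<epsilon> in at_right 0. b < \<tau> k - \<epsilon> \<and> 1 < \<rho> k * rate_I a (\<psi> + \<epsilon>) \<and>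
      (\<rho> k < 1 \<longrightarrow> 1 < \<rho> k * rate_I b (\<tau> k - \<epsilon>))" if k: "k \<in> {1..r}" for k
  proof (intro eventually_conj)
    show "\<forall>\<^sub>F \<epsilon> in at_right 0. b < \<tau> k - \<epsilon>"
      using \<tau>_gt[OF k] by real_asymp
    show "\<forall>\<^sub>F \<epsilon> in at_right 0. 1 < \<rho> k * rate_I a (\<psi> + \<epsilon>)"
      using eventually_rate_I_perturbed[of a \<psi> "\<rho> k" 1] rate_within[OF k] b_pos b_less \<psi>_less
      by simp
    show "\<forall>\<^sub>F \<epsilon> in at_right 0. \<rho> k < 1 \<longrightarrow> 1 < \<rho> k * rate_I b (\<tau> k - \<epsilon>)"
      using eventually_rate_I_perturbed[of b "\<tau> k" "\<rho> k" "- 1"] rate_across[OF k] b_pos \<tau>_gt[OF k]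
      by (cases "\<rho> k < 1") auto
  qed
  moreover have "\<forall>\<^sub>F \<epsilon> in at_right 0. \<psi> + \<epsilon> < a" using \<psi>_less by real_asymp
  moreover have "\<forall>\<^sub>F \<epsilon> in at_right 0. (0 :: real) < \<epsilon>" by (rule eventually_at_right_less)
  ultimately have "\<forall>\<^sub>F \<epsilon> in at_right 0. admissible_slack \<epsilon>"
    by (simp add: admissible_slack_def eventually_conj_iff eventually_ball_finite_distrib)
  then show ?thesis by (rule eventually_happens'[OF trivial_limit_at_right_real])
qed

lemma eventually_penalty_less:
  assumes "0 < \<epsilon>"
  shows "\<forall>\<^sub>F n in sequentially. \<forall>k\<in>{1..r}. Cc * sqrt (ln n) < \<epsilon> * (ln n / n) * cluster_size \<rho> n k"
proof (intro eventually_ball_finite ballI)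
  fix k assume k: "k \<in> {1..r}"
  have "\<forall>\<^sub>F n in sequentially. Cc * sqrt (ln (real n))
      < \<epsilon> * (ln (real n) / real n) * (\<rho> k * real n - 1)"
    using assms \<rho>_pos[OF k] by real_asymp
  then show "\<forall>\<^sub>F n in sequentially. Cc * sqrt (ln n) < \<epsilon> * (ln n / n) * cluster_size \<rho> n k"
    using eventually_ge_at_top[of 1]
  proof eventually_elim
    case (elim n)
    have "\<epsilon> * (ln n / n) * (\<rho> k * n - 1) \<le> \<epsilon> * (ln n / n) * cluster_size \<rho> n k"
      using elim assms \<rho>_pos[OF k] cluster_size_ge[of \<rho> k n] by (intro mult_left_mono) auto
    with elim show ?case by linarith
  qed
qed simp

definition failure_bound :: "real \<Rightarrow> nat \<Rightarrow> real" where
  "failure_bound \<epsilon> n = 2 * real n powr (-3) + (\<Sum>k\<in>{1..r}. degree_failure_bound n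
    (cluster_size \<rho> n k) (ln n / n) (rate_I a (\<psi> + \<epsilon>)) (rate_I b (\<tau> k - \<epsilon>)))"

lemma polynomially_small_failure_bound:
  assumes "admissible_slack \<epsilon>"
  shows "polynomially_small (failure_bound \<epsilon>)"
  unfolding failure_bound_def using assms \<rho>_pos \<rho>_le
  by (intro polynomially_small_add polynomially_small_cmult polynomially_small_powr
      polynomially_small_sum polynomially_small_degree_failure_bound)
    (auto simp: admissible_slack_def)

lemma sdp2_success_prob_ge:
  assumes \<epsilon>: "admissible_slack \<epsilon>" and valid: "valid_clusters n r (cluster_size \<rho> n) C"
    and n: "3 \<le> n" "a * ln n / n \<le> 1" and t: "t < Cc * sqrt (ln n)"
    and penalty: "\<forall>k\<in>{1..r}. Cc * sqrt (ln n) < \<epsilon> * (ln n / n) * cluster_size \<rho> n k"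
    and spectral: "\<And>P. \<forall>e\<in>pairs n. 0 \<le> P e \<and> P e \<le> a * ln n / n \<Longrightarrow>
      edge_prob n P {\<omega>. t < spectral_norm n (centered_adjacency P \<omega>)} \<le> 2 * real n powr (-3)"
  shows "1 - failure_bound \<epsilon> n \<le> sdp2_success_prob r a b \<psi> Cc n C"
proof -
  have ln_n: "0 < ln n" using n by simp
  interpret planted_clusters n r "cluster_size \<rho> n" C a b \<psi> \<epsilon>
    "ln n / n" t "Cc * sqrt (ln n)" "\<lambda>k. \<tau> k - \<epsilon>"
  proof
    show "\<tau> k - \<epsilon> + (\<tau> l - \<epsilon>) + \<epsilon> \<le> \<psi> + b" if "k \<in> {1..r}" "l \<in> {1..r}" "k \<noteq> l" for k l
      using \<tau>_add_le[OF that] \<epsilon> by (simp add: admissible_slack_def)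
    show "\<tau> k - \<epsilon> \<le> \<psi>" if "k \<in> {1..r}" for k
      using \<tau>_le[OF that] \<epsilon> by (simp add: admissible_slack_def)
  qed (use valid b_pos b_less \<epsilon> n t penalty ln_n in \<open>auto simp: admissible_slack_def\<close>)
  have "b * (ln n / n) \<le> a * (ln n / n)"
    using b_less \<psi>_less \<epsilon>_pos ln_n by (intro mult_right_mono) auto
  then have "prob large_noise \<le> 2 * real n powr (-3)"
    unfolding large_noise_def using b_pos b_less \<psi>_less \<epsilon>_pos ln_n
    by (intro spectral) (auto simp: sbm_edge_prob_def split: prod.split)
  then show ?thesis
    using prob_unique_maximizer_ge by (simp add: failure_bound_def sdp2_success_prob_def)
qed

theorem sdp2_recovers_whp: "\<exists>C0. \<forall>Cc\<ge>C0. recovers_whp r \<rho> (sdp2_success_prob r a b \<psi> Cc)"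
proof -
  have "0 < a" using b_pos b_less \<psi>_less by linarith
  then obtain Cs where spectral: "\<And>n P. 3 \<le> n \<Longrightarrow> a * ln n / n \<le> 1 \<Longrightarrow>
      (\<forall>e\<in>pairs n. 0 \<le> P e \<and> P e \<le> a * ln n / n) \<Longrightarrow>
      edge_prob n P {\<omega>. Cs * sqrt (ln n) < spectral_norm n (centered_adjacency P \<omega>)}
        \<le> 2 * real n powr (-3)"
    using ex_spectral_norm_centered_tail by blast
  obtain \<epsilon> where \<epsilon>: "admissible_slack \<epsilon>" using ex_admissible_slack by blast
  then have "0 < \<epsilon>" by (simp add: admissible_slack_def)
  have "recovers_whp r \<rho> (sdp2_success_prob r a b \<psi> Cc)" if Cc: "Cs + 1 \<le> Cc" for Cc
  proof (rule recovers_whpI[OF polynomially_small_failure_bound[OF \<epsilon>]])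
    have "\<forall>\<^sub>F n in sequentially. a * ln (real n) / real n \<le> 1" by real_asymp
    then show "\<forall>\<^sub>F n in sequentially. \<forall>C. valid_clusters n r (cluster_size \<rho> n) C \<longrightarrow>
        1 - failure_bound \<epsilon> n \<le> sdp2_success_prob r a b \<psi> Cc n C"
      using eventually_penalty_less[OF \<open>0 < \<epsilon>\<close>, of Cc] eventually_ge_at_top[of 3]
    proof eventually_elim
      case (elim n)
      then have "Cs * sqrt (ln n) < Cc * sqrt (ln n)" using Cc by simp
      then show ?case using sdp2_success_prob_ge[OF \<epsilon>] spectral elim by blast
    qed
  qed
  then show ?thesis by blast
qed

end

lemma one_less_mult_of_inverse_less:
  fixes x y I :: real
  assumes "0 < x" "x \<le> y" "1 / x < I"
  shows "1 < y * I"
proof -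
  have "1 < x * I" using assms by (simp add: field_simps)
  moreover from this have "x * I \<le> y * I"
    using assms
    by (intro mult_right_mono) (auto simp: zero_less_mult_iff dest: less_trans[OF zero_less_one])
  ultimately show ?thesis by linarith
qed

lemma sdp_conditions_imp_thresholds:
  fixes \<rho> :: "nat \<Rightarrow> real"
  assumes r_pos: "1 \<le> r" and b: "0 < b"
    and rho_mono: "\<forall>k\<in>{1..<r}. \<rho> (Suc k) \<le> \<rho> k"
    and rho_pos: "0 < \<rho> r" and rho_sum: "(\<Sum>k\<in>{1..r}. \<rho> k) \<le> 1"
    and psi: "0 < \<psi>1" "0 < \<psi>2" "b + \<psi>1 + \<psi>2 < a"
    and cond1: "rate_I a (b + \<psi>1 + \<psi>2) > 1 / \<rho> r"
    and cond2: "2 \<le> r \<longrightarrow> rate_I b (b + \<psi>1) > 1 / \<rho> r"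
    and cond3: "2 \<le> r \<longrightarrow> rate_I b (b + \<psi>2) > 1 / \<rho> (r - 1)"
    and cond4: "(r = 1 \<and> (\<Sum>k\<in>{1..r}. \<rho> k) < 1) \<longrightarrow> rate_I b (b + \<psi>1 + \<psi>2) > 1 / \<rho> r"
  shows "\<exists>\<tau>. recovery_thresholds r a b (b + \<psi>1 + \<psi>2) \<rho> \<tau>"
proof
  define \<tau> where "\<tau> k = (if r = 1 then b + \<psi>1 + \<psi>2 else if k = r then b + \<psi>1 else b + min \<psi>1 \<psi>2)" for k
  have rho_antimono: "\<rho> m \<le> \<rho> k" if "1 \<le> k" "k \<le> m" "m \<le> r" for k m
    by (rule lift_Suc_antimono_le_ivl[of "{1..<r}"]) (use rho_mono that in auto)
  then have rho_ge: "\<rho> r \<le> \<rho> k" if "k \<in> {1..r}" for k using that by simp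
  have rho_pos': "0 < \<rho> k" if "k \<in> {1..r}" for k using rho_ge[OF that] rho_pos by linarith
  show "recovery_thresholds r a b (b + \<psi>1 + \<psi>2) \<rho> \<tau>"
  proof
    fix k assume k: "k \<in> {1..r}"
    show "\<rho> k \<le> 1"
      using member_le_sum[of k "{1..r}" \<rho>] k rho_pos' rho_sum by (auto simp: less_imp_le)
    show "1 < \<rho> k * rate_I a (b + \<psi>1 + \<psi>2)"
      by (rule one_less_mult_of_inverse_less[OF rho_pos rho_ge[OF k] cond1])
    assume "\<rho> k < 1"
    consider "r = 1" | "2 \<le> r" "k = r \<or> \<psi>1 \<le> \<psi>2" | "2 \<le> r" "k < r" "\<psi>2 < \<psi>1"
      using k by fastforce
    then show "1 < \<rho> k * rate_I b (\<tau> k)"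
    proof cases
      case 1
      then show ?thesis
        using k \<open>\<rho> k < 1\<close> cond4 one_less_mult_of_inverse_less[OF rho_pos rho_ge[OF k]]
        by (simp add: \<tau>_def)
    next
      case 2
      then have "\<tau> k = b + \<psi>1" by (auto simp: \<tau>_def)
      then show ?thesis using 2 cond2 one_less_mult_of_inverse_less[OF rho_pos rho_ge[OF k]] by simp
    next
      case 3
      then have "\<tau> k = b + \<psi>2" by (simp add: \<tau>_def)
      moreover have "\<rho> (r - 1) \<le> \<rho> k" "0 < \<rho> (r - 1)"
        using 3 rho_antimono[of k "r - 1"] k rho_pos'[of "r - 1"] by auto
      ultimately show ?thesis using 3 cond3 one_less_mult_of_inverse_less by simp
    qed
  qed (use b psi rho_pos' in \<open>auto simp: \<tau>_def\<close>)
qed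

theorem theorem8:
  fixes r :: nat and a b \<psi>1 \<psi>2 :: real and \<rho> :: "nat \<Rightarrow> real"
  assumes r_pos: "1 \<le> r"
    and ab: "0 < b" "b < a"
    and rho_mono: "\<forall>k\<in>{1..<r}. \<rho> (Suc k) \<le> \<rho> k"
    and rho_pos: "0 < \<rho> r"
    and rho_sum: "(\<Sum>k\<in>{1..r}. \<rho> k) \<le> 1"
    and psi: "0 < \<psi>1" "0 < \<psi>2" "b + \<psi>1 + \<psi>2 < a"
    and cond1: "rate_I a (b + \<psi>1 + \<psi>2) > 1 / \<rho> r"
    and cond2: "2 \<le> r \<longrightarrow> rate_I b (b + \<psi>1) > 1 / \<rho> r"
    and cond3: "2 \<le> r \<longrightarrow> rate_I b (b + \<psi>2) > 1 / \<rho> (r - 1)"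
    and cond4: "(r = 1 \<and> (\<Sum>k\<in>{1..r}. \<rho> k) < 1) \<longrightarrow> rate_I b (b + \<psi>1 + \<psi>2) > 1 / \<rho> r"
  shows
    \<comment> \<open>program (i)\<close>
    "(\<exists>c>0. \<exists>N. \<forall>n\<ge>N. \<forall>C. valid_clusters n r (cluster_size \<rho> n) C \<longrightarrow>
        measure_pmf.prob
          (sbm_adj n r C (a * ln n / n) (b * ln n / n))
          {A. unique_maximizer (sdp1_feasible n r (cluster_size \<rho> n))
                (\<lambda>Z. inner_n n A Z) (cluster_matrix r C)}
        \<ge> 1 - real n powr (- c))
     \<and>
     \<comment> \<open>program (ii), with eta* = Cc sqrt(log n) for all sufficiently large Cc\<close>
     (\<exists>C0. \<forall>Cc\<ge>C0. \<exists>c>0. \<exists>N. \<forall>n\<ge>N. \<forall>C. valid_clusters n r (cluster_size \<rho> n) C \<longrightarrow>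
        measure_pmf.prob
          (sbm_adj n r C (a * ln n / n) (b * ln n / n))
          {A. unique_maximizer (sdp_base_feasible n)
                (sdp2_objective n (Cc * sqrt (ln n)) ((b + \<psi>1 + \<psi>2) * ln n / n) A)
                (cluster_matrix r C)}
        \<ge> 1 - real n powr (- c))"
proof -
  obtain \<tau> where "recovery_thresholds r a b (b + \<psi>1 + \<psi>2) \<rho> \<tau>"
    using sdp_conditions_imp_thresholds[OF r_pos ab(1) rho_mono rho_pos rho_sum psi
        cond1 cond2 cond3 cond4]
    by blast
  then obtain C0 where sdp2: "\<forall>Cc\<ge>C0. recovers_whp r \<rho> (sdp2_success_prob r a b (b + \<psi>1 + \<psi>2) Cc)"
    using recovery_thresholds.sdp2_recovers_whp by blast
  then have "recovers_whp r \<rho> (sdp2_success_prob r a b (b + \<psi>1 + \<psi>2) C0)" by simp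
  then have "recovers_whp r \<rho> (sdp1_success_prob r a b \<rho>)"
    by (rule recovers_whp_mono) (rule sdp2_success_prob_le_sdp1)
  with sdp2 show ?thesis
    unfolding recovers_whp_def sdp1_success_prob_def sdp2_success_prob_def by blast
qed

end
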